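(* Let $\Omega\subset\mathbb{R}^n$, $n\ge2$, be a bounded smooth domain and let $z\in\mathbb{R}^m\setminus A$ be a fixed vector. There is a constant $C>0$, independent of $\epsilon$, such that if $u=u_\epsilon$ is a minimizer of $$J^\epsilon_\Omega(v)=\int_\Omega\Big(\frac{\epsilon}{2}|\nabla v|^2+\frac1\epsilon W(v)\Big)dx$$ in the class $\{v\in H^1(\Omega;\mathbb{R}^m): v=z\text{ on }\partial\Omega\}$, then $$J^\epsilon_\Omega(u)\ge\sigma^+\,\mathcal{H}^{n-1}(\partial\Omega)\,\big(1-C\epsilon^{\frac13}\big).$$
   Context: $W:\mathbb{R}^m\to\mathbb{R}$, $m\ge1$, is a $C^2$ nonnegative function vanishing exactly on a finite set $A=\{a_1,\dots,a_N\}$ of $N\ge2$ distinct points; the Hessian of $W$ at each $a\in A$ is positive definite; $\liminf_{|u|\to\infty}W(u)>0$; and there is $M>0$ such that $W_u(u)\cdot u>0$ for $|u|>M$ ($W_u$ the gradient), and $|z|\le M$. $\sigma^+$ is the minimum (known to be attained) of $\int_0^{+\infty}(\frac12|v'|^2+W(v))ds$ over $v\in H^1_{\rm loc}((0,+\infty);\mathbb{R}^m)$ with $v(0)=z$ (i.e. $\lim_{s\to0^+}v(s)=z$) and $\lim_{s\to+\infty}d(v(s),A)=0$. $\mathcal{H}^{n-1}$ is Hausdorff measure. *)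

theory Defs
  imports "HOL-Analysis.Analysis"
begin

section \<open>Classical derivatives\<close>

text \<open>Continuous differentiability of order \<open>k\<close> on an open set \<open>S\<close>.\<close>

primrec Ck_on :: "nat \<Rightarrow> ('a::euclidean_space \<Rightarrow> 'b::real_normed_vector) \<Rightarrow> 'a set \<Rightarrow> bool" where
  "Ck_on 0 f S \<longleftrightarrow> continuous_on S f"
| "Ck_on (Suc k) f S \<longleftrightarrow> f differentiable_on S \<and>
     (\<forall>i\<in>Basis. Ck_on k (\<lambda>x. frechet_derivative f (at x) i) S)"

definition smooth_on :: "('a::euclidean_space \<Rightarrow> 'b::real_normed_vector) \<Rightarrow> 'a set \<Rightarrow> bool" where
  "smooth_on f S \<longleftrightarrow> (\<forall>k. Ck_on k f S)"

definition gradient :: "('a::euclidean_space \<Rightarrow> real) \<Rightarrow> 'a \<Rightarrow> 'a" where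
  "gradient f x = (\<Sum>i\<in>Basis. frechet_derivative f (at x) i *\<^sub>R i)"

definition hessian :: "('a::euclidean_space \<Rightarrow> real) \<Rightarrow> 'a \<Rightarrow> 'a \<Rightarrow> 'a" where
  "hessian f x = frechet_derivative (gradient f) (at x)"

section \<open>Smooth domains\<close>

text \<open>The boundary is described by local defining functions: near each boundary point the set is
  a sublevel set of a smooth function without critical points.\<close>

definition smooth_bounded_domain :: "'a::euclidean_space set \<Rightarrow> bool" where
  "smooth_bounded_domain \<Omega> \<longleftrightarrow> open \<Omega> \<and> connected \<Omega> \<and> \<Omega> \<noteq> {} \<and> bounded \<Omega> \<and>
     (\<forall>p\<in>frontier \<Omega>. \<exists>U \<rho>. open U \<and> p \<in> U \<and> smooth_on \<rho> U \<and>
        (\<forall>x\<in>U. gradient \<rho> x \<noteq> 0) \<and> \<Omega> \<inter> U = {x\<in>U. \<rho> x < (0::real)})"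

section \<open>Hausdorff measure\<close>

text \<open>Hausdorff (outer) measure of integer dimension \<open>k\<close>, normalised by the volume of the unit
  ball in dimension \<open>k\<close>, so that it is the surface area on smooth \<open>k\<close>-dimensional surfaces.
  Covering sets are required to be bounded because \<^const>\<open>diameter\<close> is unspecified on
  unbounded sets; the empty set gets weight \<open>0\<close> also for \<open>k = 0\<close>.\<close>

definition hausdorff_weight :: "nat \<Rightarrow> 'a::metric_space set \<Rightarrow> ennreal" where
  "hausdorff_weight k S =
     (if S = {} then 0 else ennreal (unit_ball_vol (real k) * (diameter S / 2) ^ k))"

definition hausdorff_premeasure :: "nat \<Rightarrow> real \<Rightarrow> 'a::metric_space set \<Rightarrow> ennreal" where
  "hausdorff_premeasure k \<delta> S =
     (INF K \<in> {K :: nat \<Rightarrow> 'a set. S \<subseteq> (\<Union>j. K j) \<and> (\<forall>j. bounded (K j) \<and> diameter (K j) \<le> \<delta>)}.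
        (\<Sum>j. hausdorff_weight k (K j)))"

definition hausdorff_measure :: "nat \<Rightarrow> 'a::metric_space set \<Rightarrow> ennreal" where
  "hausdorff_measure k S = (SUP \<delta>\<in>{0<..}. hausdorff_premeasure k \<delta> S)"

section \<open>Sobolev spaces\<close>

definition test_function :: "'a::euclidean_space set \<Rightarrow> ('a \<Rightarrow> 'b::real_normed_vector) \<Rightarrow> bool" where
  "test_function \<Omega> \<phi> \<longleftrightarrow> smooth_on \<phi> UNIV \<and>
     compact (closure {x. \<phi> x \<noteq> 0}) \<and> closure {x. \<phi> x \<noteq> 0} \<subseteq> \<Omega>"

definition locally_integrable_on ::
    "'a::euclidean_space set \<Rightarrow> ('a \<Rightarrow> 'b::euclidean_space) \<Rightarrow> bool" where
  "locally_integrable_on \<Omega> f \<longleftrightarrow> (\<forall>K. compact K \<and> K \<subseteq> \<Omega> \<longrightarrow> set_integrable lebesgue K f)"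

definition has_weak_partial :: "'a::euclidean_space set \<Rightarrow> 'a \<Rightarrow>
    ('a \<Rightarrow> 'b::euclidean_space) \<Rightarrow> ('a \<Rightarrow> 'b) \<Rightarrow> bool" where
  "has_weak_partial \<Omega> i u g \<longleftrightarrow> locally_integrable_on \<Omega> u \<and> locally_integrable_on \<Omega> g \<and>
     (\<forall>\<phi> :: 'a \<Rightarrow> real. test_function \<Omega> \<phi> \<longrightarrow>
        (LINT x:\<Omega>|lebesgue. frechet_derivative \<phi> (at x) i *\<^sub>R u x)
          = - (LINT x:\<Omega>|lebesgue. \<phi> x *\<^sub>R g x))"

text \<open>The weak partial derivative is determined only up to a null set; every use below is
  insensitive to the representative chosen.\<close>

definition weak_partial :: "'a::euclidean_space set \<Rightarrow> 'a \<Rightarrow>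
    ('a \<Rightarrow> 'b::euclidean_space) \<Rightarrow> 'a \<Rightarrow> 'b" where
  "weak_partial \<Omega> i u = (SOME g. has_weak_partial \<Omega> i u g)"

definition weak_gradient_sq :: "'a::euclidean_space set \<Rightarrow>
    ('a \<Rightarrow> 'b::euclidean_space) \<Rightarrow> 'a \<Rightarrow> real" where
  "weak_gradient_sq \<Omega> u x = (\<Sum>i\<in>Basis. (norm (weak_partial \<Omega> i u x))\<^sup>2)"

definition L2_on :: "'a::euclidean_space set \<Rightarrow> ('a \<Rightarrow> 'b::euclidean_space) \<Rightarrow> bool" where
  "L2_on S f \<longleftrightarrow> set_borel_measurable lebesgue S f \<and>
     set_integrable lebesgue S (\<lambda>x. (norm (f x))\<^sup>2)"

definition L2_loc :: "'a::euclidean_space set \<Rightarrow> ('a \<Rightarrow> 'b::euclidean_space) \<Rightarrow> bool" where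
  "L2_loc \<Omega> f \<longleftrightarrow> (\<forall>K. compact K \<and> K \<subseteq> \<Omega> \<longrightarrow> L2_on K f)"

definition H1 :: "'a::euclidean_space set \<Rightarrow> ('a \<Rightarrow> 'b::euclidean_space) set" where
  "H1 \<Omega> = {u. L2_on \<Omega> u \<and> (\<forall>i\<in>Basis. \<exists>g. has_weak_partial \<Omega> i u g \<and> L2_on \<Omega> g)}"

definition H1_loc :: "'a::euclidean_space set \<Rightarrow> ('a \<Rightarrow> 'b::euclidean_space) set" where
  "H1_loc \<Omega> = {u. L2_loc \<Omega> u \<and> (\<forall>i\<in>Basis. \<exists>g. has_weak_partial \<Omega> i u g \<and> L2_loc \<Omega> g)}"

definition H1_norm :: "'a::euclidean_space set \<Rightarrow> ('a \<Rightarrow> 'b::euclidean_space) \<Rightarrow> real" where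
  "H1_norm \<Omega> u = sqrt (LINT x:\<Omega>|lebesgue. (norm (u x))\<^sup>2 + weak_gradient_sq \<Omega> u x)"

definition H1_0 :: "'a::euclidean_space set \<Rightarrow> ('a \<Rightarrow> 'b::euclidean_space) set" where
  "H1_0 \<Omega> = {u \<in> H1 \<Omega>. \<exists>\<phi>. (\<forall>k. test_function \<Omega> (\<phi> k)) \<and>
     (\<lambda>k. H1_norm \<Omega> (\<lambda>x. u x - \<phi> k x)) \<longlonglongrightarrow> 0}"

text \<open>The boundary condition \<open>v = z\<close> on the boundary is understood in the usual Sobolev sense
  \<open>v - z \<in> H1_0\<close>, i.e. \<open>v - z\<close> is an \<open>H1\<close>-limit of test functions.\<close>

definition dirichlet_class :: "'a::euclidean_space set \<Rightarrow> 'b::euclidean_space \<Rightarrow> ('a \<Rightarrow> 'b) set" where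
  "dirichlet_class \<Omega> z = {v \<in> H1 \<Omega>. (\<lambda>x. v x - z) \<in> H1_0 \<Omega>}"

section \<open>The energies\<close>

text \<open>Both energies take values in \<open>[0, \<infinity>]\<close>, since \<open>W \<circ> v\<close> need not be integrable.\<close>

definition J_energy :: "('b::euclidean_space \<Rightarrow> real) \<Rightarrow> real \<Rightarrow> 'a::euclidean_space set \<Rightarrow>
    ('a \<Rightarrow> 'b) \<Rightarrow> ennreal" where
  "J_energy W \<epsilon> \<Omega> v =
     (\<integral>\<^sup>+x\<in>\<Omega>. ennreal (\<epsilon> / 2 * weak_gradient_sq \<Omega> v x + 1 / \<epsilon> * W (v x)) \<partial>lebesgue)"

definition is_J_minimizer :: "('b::euclidean_space \<Rightarrow> real) \<Rightarrow> 'b \<Rightarrow> real \<Rightarrow>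
    'a::euclidean_space set \<Rightarrow> ('a \<Rightarrow> 'b) \<Rightarrow> bool" where
  "is_J_minimizer W z \<epsilon> \<Omega> u \<longleftrightarrow> u \<in> dirichlet_class \<Omega> z \<and>
     (\<forall>v\<in>dirichlet_class \<Omega> z. J_energy W \<epsilon> \<Omega> u \<le> J_energy W \<epsilon> \<Omega> v)"

definition half_line_energy :: "('b::euclidean_space \<Rightarrow> real) \<Rightarrow> (real \<Rightarrow> 'b) \<Rightarrow> ennreal" where
  "half_line_energy W v =
     (\<integral>\<^sup>+s\<in>{0<..}. ennreal (1 / 2 * (norm (weak_partial {0<..} 1 v s))\<^sup>2 + W (v s)) \<partial>lebesgue)"

text \<open>Elements of \<open>H1_loc\<close> are functions rather than classes modulo null sets. If some
  representative has the two limits below, then so does the continuous one, with the same values.\<close>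

definition half_line_class :: "'b::euclidean_space set \<Rightarrow> 'b \<Rightarrow> (real \<Rightarrow> 'b) set" where
  "half_line_class A z = {v \<in> H1_loc {0<..}. (v \<longlongrightarrow> z) (at_right 0) \<and>
     ((\<lambda>s. infdist (v s) A) \<longlongrightarrow> 0) at_top}"

text \<open>For the potentials considered here the infimum is attained, so it is the minimum.\<close>

definition sigma_plus :: "('b::euclidean_space \<Rightarrow> real) \<Rightarrow> 'b set \<Rightarrow> 'b \<Rightarrow> ennreal" where
  "sigma_plus W A z = (INF v\<in>half_line_class A z. half_line_energy W v)"

end

(*
  Let F be the distance to A in the degenerate metric sqrt(2 W) |du|, truncated at its value sigma^+
  at z. For a vector field X with |X| <= 1 the inequality |grad F| <= sqrt(2 W) and Young's inequality
  give, for every v with v = z on the boundary,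
    int_Omega (sigma^+ - F(v)) div X  <=  int_Omega |X| sqrt(2 W(v)) |grad v|  <=  J(v).
  Choosing X to be the outer normal on the boundary makes int_Omega div X at least the area of the
  boundary, and F <= K W, as the wells are nondegenerate, bounds the remaining term by
  int_Omega F(v) |div X| <= C eps J(v). Hence J >= sigma^+ H(boundary) / (1 + C eps), which is stronger
  than the claim. No tubular coordinates are needed: the area of the boundary is bounded from
  above by a Vitali covering, with the flux of X through small balls computed by blow-up.
*)
theory Submission
  imports Defs
begin

section \<open>Calculus of \<open>C\<^sup>k\<close> functions\<close>

text \<open>Both comparisons with an infimum go in the cheap direction: \<open>sigma_plus\<close>
  and the Hausdorff measure are only bounded from above, so explicit competitors (polygonal curves,
  coverings) suffice. This is why the degenerate distance is an infimum over polygonal chains of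
  upper Riemann sums: its triangle inequality is built in, and no geodesic or reparametrisation
  occurs. The main obstacle is regularity. F is only Lipschitz, so the chain rule for its
  composition with v is replaced by difference quotients of smooth test functions. Passing from
  these to general v must avoid W itself, whose growth is not controlled. Truncation makes F
  constant outside a large ball, so W can be cut off to a compactly supported Lipschitz G <= W there
  without losing the gradient bound. Surface integrals are never defined. The functional sending
  \<zeta> to the integral over \<Omega> of div (\<zeta> X) takes their place; its positivity lets
  the contributions of disjoint boundary balls add up to at most the total flux.\<close>

lemma Ck_on_cong:
  assumes "open S" "\<And>x. x \<in> S \<Longrightarrow> f x = g x" "Ck_on k f S"
  shows "Ck_on k g S"
  using assms(2,3)
proof (induction k arbitrary: f g)
  case 0
  then show ?case by (simp cong: continuous_on_cong)
next
  case (Suc k)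
  have fd: "frechet_derivative f (at x) = frechet_derivative g (at x)" if "x \<in> S" for x
  proof -
    have "(f has_derivative D) (at x) \<longleftrightarrow> (g has_derivative D) (at x)" for D
      by (rule iffI; erule has_derivative_transform_within_open[OF _ assms(1) that]; use Suc.prems(1) in simp)
    then show ?thesis by (simp add: frechet_derivative_def)
  qed
  have "g differentiable_on S"
    using Suc.prems by (auto simp: differentiable_on_def intro: differentiable_transform_within[of f _ S 1 g])
  moreover have "Ck_on k (\<lambda>x. frechet_derivative g (at x) i) S" if "i \<in> Basis" for i
    by (rule Suc.IH[of "\<lambda>x. frechet_derivative f (at x) i"]) (use Suc.prems that fd in auto)
  ultimately show ?case by simp
qed

text \<open>The closure properties below rest on this rule: it accepts any explicit derivative D,
  which uniqueness of derivatives identifies with the chosen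
  \<open>frechet_derivative\<close>.\<close>

lemma Ck_on_SucI:
  assumes "open S" and "\<And>x. x \<in> S \<Longrightarrow> (f has_derivative D x) (at x)"
    and "\<And>i. i \<in> Basis \<Longrightarrow> Ck_on k (\<lambda>x. D x i) S"
  shows "Ck_on (Suc k) f S"
proof -
  have "f differentiable_on S"
    using assms(2) by (meson differentiable_at_withinI differentiable_def differentiable_on_def)
  moreover have "frechet_derivative f (at x) = D x" if "x \<in> S" for x
    using frechet_derivative_at[OF assms(2)[OF that]] by simp
  ultimately show ?thesis
    using assms by (auto intro!: Ck_on_cong[OF assms(1) _ assms(3)])
qed

lemma Ck_on_Suc_has_derivative:
  assumes "Ck_on (Suc k) f S" "open S" "x \<in> S"
  shows "(f has_derivative frechet_derivative f (at x)) (at x)"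
  using assms by (simp add: differentiable_on_eq_differentiable_at frechet_derivative_works)

lemma Ck_on_imp_continuous_on: "Ck_on k f S \<Longrightarrow> continuous_on S f"
  by (cases k) (auto intro: differentiable_imp_continuous_on)

lemma Ck_on_SucD: "Ck_on (Suc k) f S \<Longrightarrow> Ck_on k f S"
proof (induction k arbitrary: f)
  case 0
  then show ?case by (auto intro: differentiable_imp_continuous_on)
qed simp

lemma Ck_on_subset: "Ck_on k f T \<Longrightarrow> S \<subseteq> T \<Longrightarrow> Ck_on k f S"
  by (induction k arbitrary: f) (auto intro: continuous_on_subset differentiable_on_subset)

lemma Ck_on_open_Un:
  assumes "open S" "open T" "Ck_on k f S" "Ck_on k f T"
  shows "Ck_on k f (S \<union> T)"
  using assms(3,4)
proof (induction k arbitrary: f)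
  case 0
  then show ?case using assms by (simp add: continuous_on_open_Un)
next
  case (Suc k)
  then show ?case using assms by (auto simp: differentiable_on_eq_differentiable_at open_Un)
qed

lemma Ck_on_const [simp]: "open S \<Longrightarrow> Ck_on k (\<lambda>x. c) S"
proof (induction k arbitrary: c)
  case (Suc k)
  show ?case by (rule Ck_on_SucI[where D="\<lambda>x h. 0"]) (use Suc in auto)
qed simp

lemma Ck_on_linear:
  assumes "bounded_linear f" "open S"
  shows "Ck_on k f S"
proof (cases k)
  case (Suc j)
  show ?thesis unfolding Suc
    by (rule Ck_on_SucI[where D="\<lambda>x. f"]) (use assms in \<open>auto intro: bounded_linear_imp_has_derivative\<close>)
qed (use assms in \<open>simp add: linear_continuous_on\<close>)

lemma Ck_on_id [simp]: "open S \<Longrightarrow> Ck_on k (\<lambda>x. x) S"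
  by (rule Ck_on_linear) auto

lemma Ck_on_add:
  assumes "open S" "Ck_on k f S" "Ck_on k g S"
  shows "Ck_on k (\<lambda>x. f x + g x) S"
  using assms(2,3)
proof (induction k arbitrary: f g)
  case (Suc k)
  show ?case
    by (rule Ck_on_SucI[OF assms(1) has_derivative_add[OF
        Ck_on_Suc_has_derivative[OF Suc.prems(1) assms(1)] Ck_on_Suc_has_derivative[OF Suc.prems(2) assms(1)]]])
      (use Suc in auto)
qed (auto intro: continuous_intros)

lemma Ck_on_bounded_linear:
  assumes "bounded_linear L" "open S" "Ck_on k f S"
  shows "Ck_on k (\<lambda>x. L (f x)) S"
  using assms(3)
proof (induction k arbitrary: f)
  case 0
  then show ?case using assms by (auto intro: bounded_linear.continuous_on)
next
  case (Suc k)
  show ?case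
    by (rule Ck_on_SucI[OF assms(2) bounded_linear.has_derivative[OF assms(1)
        Ck_on_Suc_has_derivative[OF Suc.prems(1) assms(2)]]])
      (use Suc in auto)
qed

text \<open>One Leibniz induction serves scalar multiples, products and inner products. Each term of
  the derivative keeps one factor undifferentiated, and \<open>Ck_on_SucD\<close> lowers that factor
  to order k so that the hypothesis applies.\<close>

lemma Ck_on_bilinear:
  assumes "bounded_bilinear B" "open S" "Ck_on k f S" "Ck_on k g S"
  shows "Ck_on k (\<lambda>x. B (f x) (g x)) S"
  using assms(3,4)
proof (induction k arbitrary: f g)
  case 0
  then show ?case using assms by (auto intro: bounded_bilinear.continuous_on)
next
  case (Suc k)
  show ?case
    by (rule Ck_on_SucI[OF assms(2) bounded_bilinear.FDERIV[OF assms(1)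
        Ck_on_Suc_has_derivative[OF Suc.prems(1) assms(2)] Ck_on_Suc_has_derivative[OF Suc.prems(2) assms(2)]]])
      (use Suc.prems Ck_on_SucD[OF Suc.prems(1)] Ck_on_SucD[OF Suc.prems(2)] Suc.IH in
        \<open>auto intro!: Ck_on_add[OF assms(2)] simp: assms(2)\<close>)
qed

lemmas Ck_on_scaleR = Ck_on_bilinear[OF bounded_bilinear_scaleR]
  and Ck_on_mult = Ck_on_bilinear[OF bounded_bilinear_mult]
  and Ck_on_inner = Ck_on_bilinear[OF bounded_bilinear_inner]
  and Ck_on_minus = Ck_on_bounded_linear[OF bounded_linear_minus[OF bounded_linear_ident]]

lemma Ck_on_diff:
  assumes "open S" "Ck_on k f S" "Ck_on k g S"
  shows "Ck_on k (\<lambda>x. f x - g x) S"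
  using Ck_on_add[OF assms(1,2) Ck_on_minus[OF assms(1,3)]] by simp

lemma Ck_on_sum:
  assumes "open S" "\<And>i. i \<in> I \<Longrightarrow> Ck_on k (f i) S"
  shows "Ck_on k (\<lambda>x. \<Sum>i\<in>I. f i x) S"
  using assms(2) by (induction I rule: infinite_finite_induct) (auto intro!: Ck_on_add assms(1) simp: assms(1))

lemma Ck_on_prod:
  fixes f :: "'i \<Rightarrow> 'a::euclidean_space \<Rightarrow> real"
  assumes "open S" "\<And>i. i \<in> I \<Longrightarrow> Ck_on k (f i) S"
  shows "Ck_on k (\<lambda>x. \<Prod>i\<in>I. f i x) S"
  using assms(2) by (induction I rule: infinite_finite_induct) (auto intro!: Ck_on_mult assms(1) simp: assms(1))

text \<open>With a real inner function the derivative of g is multiplication by the vector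
  \<open>?g'\<close>, so the chain rule is a scalar multiple and the induction runs over functions g
  of one real variable.\<close>

lemma Ck_on_compose_real:
  fixes g :: "real \<Rightarrow> 'b::real_normed_vector"
  assumes "open S" "open T" "f ` S \<subseteq> T" "Ck_on k f S" "Ck_on k g T"
  shows "Ck_on k (\<lambda>x. g (f x)) S"
  using assms(4,5)
proof (induction k arbitrary: g)
  case 0
  then show ?case using assms by (auto intro: continuous_on_compose2)
next
  case (Suc k)
  let ?g' = "\<lambda>t. frechet_derivative g (at t) 1"
  have g': "(g has_derivative (\<lambda>h. h *\<^sub>R ?g' t)) (at t)" if "t \<in> T" for t
  proof -
    have *: "(g has_derivative frechet_derivative g (at t)) (at t)"
      using Ck_on_Suc_has_derivative[OF Suc.prems(2) assms(2) that] .
    have "frechet_derivative g (at t) h = h *\<^sub>R ?g' t" for h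
      using linear_scale[OF has_derivative_linear[OF *], of h 1] by simp
    then have "frechet_derivative g (at t) = (\<lambda>h. h *\<^sub>R ?g' t)" by blast
    with * show ?thesis by metis
  qed
  have Cg': "Ck_on k (\<lambda>x. ?g' (f x)) S"
    using Suc.prems Ck_on_SucD[OF Suc.prems(1)] by (intro Suc.IH) auto
  show ?case
  proof (rule Ck_on_SucI[OF assms(1), where D="\<lambda>x h. frechet_derivative f (at x) h *\<^sub>R ?g' (f x)"])
    fix x assume x: "x \<in> S"
    then have "f x \<in> T" using assms by auto
    from has_derivative_compose[OF Ck_on_Suc_has_derivative[OF Suc.prems(1) assms(1) x] g'[OF this]]
    show "((\<lambda>x. g (f x)) has_derivative (\<lambda>h. frechet_derivative f (at x) h *\<^sub>R ?g' (f x))) (at x)" .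
  next
    fix i :: 'a assume "i \<in> Basis"
    then show "Ck_on k (\<lambda>x. frechet_derivative f (at x) i *\<^sub>R ?g' (f x)) S"
      using Suc.prems by (intro Ck_on_scaleR assms(1) Cg') auto
  qed
qed

lemma Ck_on_real_SucI:
  fixes f :: "real \<Rightarrow> real"
  assumes "open S" "\<And>x. x \<in> S \<Longrightarrow> (f has_real_derivative f' x) (at x)" "Ck_on k f' S"
  shows "Ck_on (Suc k) f S"
  by (rule Ck_on_SucI[where D="\<lambda>x h. f' x * h"]) (use assms in \<open>auto simp: has_field_derivative_def\<close>)

text \<open>The derivative is again a product of copies of \<open>inverse\<close>, so the induction
  closes.\<close>

lemma Ck_on_inverse: "Ck_on k (inverse :: real \<Rightarrow> real) {0<..}"
proof (induction k)
  case 0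
  then show ?case by (auto intro!: continuous_intros)
next
  case (Suc k)
  show ?case
  proof (rule Ck_on_real_SucI)
    show "(inverse has_real_derivative - (inverse x * inverse x)) (at x)" if "x \<in> {0<..}" for x :: real
      using that by (auto intro!: derivative_eq_intros)
    show "Ck_on k (\<lambda>x::real. - (inverse x * inverse x)) {0<..}"
      by (intro Ck_on_minus Ck_on_mult Suc) auto
  qed auto
qed

lemma frechet_derivative_scaleR_at:
  fixes \<zeta> :: "'a::euclidean_space \<Rightarrow> real"
  assumes "\<zeta> differentiable at x" "f differentiable at x"
  shows "frechet_derivative (\<lambda>x. \<zeta> x *\<^sub>R f x) (at x) h
    = \<zeta> x *\<^sub>R frechet_derivative f (at x) h + frechet_derivative \<zeta> (at x) h *\<^sub>R f x"
proof -
  have "((\<lambda>x. \<zeta> x *\<^sub>R f x) has_derivative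
     (\<lambda>h. \<zeta> x *\<^sub>R frechet_derivative f (at x) h + frechet_derivative \<zeta> (at x) h *\<^sub>R f x)) (at x)"
    using assms by (intro has_derivative_scaleR) (simp_all add: frechet_derivative_works)
  from fun_cong[OF frechet_derivative_at[OF this], of h] show ?thesis by (rule sym)
qed

lemma Ck_on_1_differentiable: "Ck_on (Suc k) f UNIV \<Longrightarrow> f differentiable at x"
  by (simp add: differentiable_on_eq_differentiable_at)

lemma frechet_derivative_zero_open:
  assumes "open S" "x \<in> S" "\<And>y. y \<in> S \<Longrightarrow> f y = c"
  shows "frechet_derivative f (at x) h = 0"
proof -
  have "(f has_derivative (\<lambda>h. 0)) (at x)"
    by (rule has_derivative_transform_within_open[OF has_derivative_const assms(1,2)]) (use assms(3) in auto)
  from fun_cong[OF frechet_derivative_at[OF this], of h] show ?thesis by (rule sym)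
qed

section \<open>Smooth cutoff functions\<close>

text \<open>The flat function exp(-1/t) with a polynomial in 1/t as prefactor. This family, unlike
  the single function, is closed under differentiation, which gives smoothness of all orders by
  induction.\<close>

definition flat_exp :: "real poly \<Rightarrow> real \<Rightarrow> real" where
  "flat_exp P t = (if t \<le> 0 then 0 else poly P (inverse t) * exp (- inverse t))"

lemma poly_times_exp_minus_tendsto_0: "((\<lambda>x::real. poly P x * exp (- x)) \<longlongrightarrow> 0) at_top"
proof -
  have "((\<lambda>x. \<Sum>i\<le>degree P. coeff P i * (x ^ i / exp x)) \<longlongrightarrow> (\<Sum>i\<le>degree P. coeff P i * 0)) at_top"
    by (intro tendsto_sum tendsto_mult tendsto_const tendsto_power_div_exp_0)
  then show ?thesis
    by (simp add: poly_altdef exp_minus sum_distrib_right divide_inverse mult.assoc)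
qed

lemma flat_exp_tendsto_0: "((\<lambda>t. flat_exp P t) \<longlongrightarrow> 0) (at_right 0)"
proof -
  have "((\<lambda>t. poly P (inverse t) * exp (- inverse t)) \<longlongrightarrow> 0) (at_right (0::real))"
    by (rule filterlim_compose[OF poly_times_exp_minus_tendsto_0 filterlim_inverse_at_top_right])
  then show ?thesis
    by (rule Lim_transform_eventually) (auto simp: flat_exp_def eventually_at_filter)
qed

text \<open>In the variable 1/t differentiation turns the prefactor P into (1/t)^2 (P - P'), and
  \<open>monom 1 2\<close> is that square. At 0 both one-sided difference quotients tend to
  0.\<close>

lemma flat_exp_has_derivative:
  "(flat_exp P has_real_derivative flat_exp (monom 1 2 * (P - pderiv P)) t) (at t)"
proof -
  consider "t < 0" | "t = 0" | "t > 0" by linarith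
  then show ?thesis
  proof cases
    case 1
    have "((\<lambda>t. 0) has_real_derivative 0) (at t)" by simp
    then have "(flat_exp P has_real_derivative 0) (at t)"
      by (rule has_field_derivative_transform_within_open[of _ _ _ "{..<0}"])
        (use 1 in \<open>auto simp: flat_exp_def\<close>)
    then show ?thesis using 1 by (simp add: flat_exp_def)
  next
    case 3
    have "((\<lambda>t. poly P (inverse t) * exp (- inverse t)) has_real_derivative
        flat_exp (monom 1 2 * (P - pderiv P)) t) (at t)"
      using 3 by (auto intro!: derivative_eq_intros DERIV_chain'[of inverse] poly_DERIV
        simp: flat_exp_def poly_monom field_simps power2_eq_square)
    then show ?thesis
      by (rule has_field_derivative_transform_within_open[of _ _ _ "{0<..}"])
        (use 3 in \<open>auto simp: flat_exp_def\<close>)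
  next
    case 2
    have L: "((\<lambda>y. flat_exp P y / y) \<longlongrightarrow> 0) (at_left 0)"
      by (rule Lim_transform_eventually[of "\<lambda>_. 0"]) (auto simp: flat_exp_def eventually_at_filter)
    \<comment> \<open>For y > 0 the quotient by y is the flat function with prefactor
      \<open>pCons 0 P\<close>, that is, P times the variable 1/y.\<close>
    have R: "((\<lambda>y. flat_exp P y / y) \<longlongrightarrow> 0) (at_right 0)"
      by (rule Lim_transform_eventually[OF flat_exp_tendsto_0[of "pCons 0 P"]])
        (auto simp: flat_exp_def eventually_at_filter divide_simps)
    from filterlim_split_at[OF L R] show ?thesis
      using 2 by (simp add: has_field_derivative_iff flat_exp_def)
  qed
qed

lemma Ck_on_flat_exp: "Ck_on k (flat_exp P) UNIV"
proof (induction k arbitrary: P)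
  case 0
  then show ?case
    by (auto intro: DERIV_continuous_on has_field_derivative_at_within flat_exp_has_derivative)
next
  case (Suc k)
  show ?case by (rule Ck_on_real_SucI[OF _ flat_exp_has_derivative Suc]) simp
qed

lemma flat_exp_1_pos: "0 < t \<Longrightarrow> 0 < flat_exp 1 t"
  and flat_exp_1_nonneg: "0 \<le> flat_exp 1 t"
  and flat_exp_1_nonpos: "t \<le> 0 \<Longrightarrow> flat_exp 1 t = 0"
  by (auto simp: flat_exp_def)

lemma flat_exp_1_mono: "s \<le> t \<Longrightarrow> flat_exp 1 s \<le> flat_exp 1 t"
  by (auto simp: flat_exp_def field_simps)

definition smoothstep :: "real \<Rightarrow> real" where
  "smoothstep t = flat_exp 1 t * inverse (flat_exp 1 t + flat_exp 1 (1 - t))"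

text \<open>At least one of t and 1 - t is positive, so the two flat functions never vanish
  together.\<close>

lemma smoothstep_denom_pos: "0 < flat_exp 1 t + flat_exp 1 (1 - t)"
  using flat_exp_1_pos[of t] flat_exp_1_pos[of "1 - t"] flat_exp_1_nonneg[of t] flat_exp_1_nonneg[of "1 - t"]
  by (cases "t > 0") auto

lemma smoothstep_le_0 [simp]: "t \<le> 0 \<Longrightarrow> smoothstep t = 0"
  by (simp add: smoothstep_def flat_exp_1_nonpos)

lemma smoothstep_ge_1 [simp]: "1 \<le> t \<Longrightarrow> smoothstep t = 1"
  using smoothstep_denom_pos[of t] by (simp add: smoothstep_def flat_exp_1_nonpos)

lemma smoothstep_nonneg: "0 \<le> smoothstep t"
  using smoothstep_denom_pos[of t] by (simp add: smoothstep_def flat_exp_1_nonneg)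

lemma smoothstep_le_1: "smoothstep t \<le> 1"
  using smoothstep_denom_pos[of t] flat_exp_1_nonneg[of "1 - t"] by (simp add: smoothstep_def field_simps)

text \<open>With f = \<open>flat_exp 1\<close>, cross-multiplication cancels f(s) f(t) and leaves
  the product of f(s) <= f(t) and f(1 - t) <= f(1 - s).\<close>

lemma smoothstep_mono: "s \<le> t \<Longrightarrow> smoothstep s \<le> smoothstep t"
proof -
  assume "s \<le> t"
  then have "flat_exp 1 s * flat_exp 1 (1 - t) \<le> flat_exp 1 t * flat_exp 1 (1 - s)"
    by (intro mult_mono flat_exp_1_mono flat_exp_1_nonneg) auto
  then show ?thesis
    using smoothstep_denom_pos[of t] smoothstep_denom_pos[of s] by (simp add: smoothstep_def field_simps)
qed

lemma Ck_on_smoothstep: "Ck_on k smoothstep UNIV"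
proof -
  have "Ck_on k (\<lambda>t. flat_exp 1 (1 - t)) UNIV"
    by (rule Ck_on_compose_real[of UNIV UNIV, OF _ _ _ _ Ck_on_flat_exp]) (auto intro: Ck_on_diff)
  then have "Ck_on k (\<lambda>t. inverse (flat_exp 1 t + flat_exp 1 (1 - t))) UNIV"
    by (intro Ck_on_compose_real[of UNIV "{0<..}", OF _ _ _ _ Ck_on_inverse] Ck_on_add Ck_on_flat_exp)
      (auto simp: smoothstep_denom_pos)
  then show ?thesis
    unfolding smoothstep_def[abs_def] by (intro Ck_on_mult Ck_on_flat_exp) auto
qed

lemma Ck_on_smoothstep_compose: "open S \<Longrightarrow> Ck_on k f S \<Longrightarrow> Ck_on k (\<lambda>x. smoothstep (f x)) S"
  by (rule Ck_on_compose_real[OF _ open_UNIV _ _ Ck_on_smoothstep]) auto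

text \<open>The squared distance keeps the function smooth at the centre p. For 0 <= r < s it is 1
  up to radius r and 0 from radius s on.\<close>

definition ball_cutoff :: "'a::euclidean_space \<Rightarrow> real \<Rightarrow> real \<Rightarrow> 'a \<Rightarrow> real" where
  "ball_cutoff p r s x = smoothstep ((s\<^sup>2 - (x - p) \<bullet> (x - p)) * inverse (s\<^sup>2 - r\<^sup>2))"

lemma Ck_on_ball_cutoff: "Ck_on k (ball_cutoff p r s) UNIV"
  unfolding ball_cutoff_def[abs_def]
  by (intro Ck_on_smoothstep_compose Ck_on_mult Ck_on_diff Ck_on_inner) auto

lemma ball_cutoff_bounds: "0 \<le> ball_cutoff p r s x" "ball_cutoff p r s x \<le> 1"
  by (auto simp: ball_cutoff_def smoothstep_nonneg smoothstep_le_1)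

lemma inner_diff_self_eq_dist: "(x - p) \<bullet> (x - p) = (dist p x)\<^sup>2"
  by (metis dist_commute dist_norm power2_norm_eq_inner)

lemma ball_cutoff_eq_1:
  assumes "0 \<le> r" "r < s" "dist p x \<le> r"
  shows "ball_cutoff p r s x = 1"
proof -
  have "(dist p x)\<^sup>2 \<le> r\<^sup>2" "r\<^sup>2 < s\<^sup>2" using assms by (auto intro!: power_mono power_strict_mono)
  then show ?thesis
    unfolding ball_cutoff_def
    by (intro smoothstep_ge_1) (simp add: inner_diff_self_eq_dist field_simps)
qed

lemma ball_cutoff_eq_0:
  assumes "0 \<le> r" "r < s" "s \<le> dist p x"
  shows "ball_cutoff p r s x = 0"
proof -
  have "s\<^sup>2 \<le> (dist p x)\<^sup>2" "r\<^sup>2 < s\<^sup>2" using assms by (auto intro!: power_mono power_strict_mono)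
  then show ?thesis
    unfolding ball_cutoff_def
    by (intro smoothstep_le_0 mult_nonpos_nonneg) (auto simp: inner_diff_self_eq_dist)
qed

text \<open>A smooth approximation from below of the indicator of the open box, exact in the limit
  of large k; it vanishes outside the box for every k.\<close>

definition box_cutoff :: "'a::euclidean_space \<Rightarrow> 'a \<Rightarrow> nat \<Rightarrow> 'a \<Rightarrow> real" where
  "box_cutoff a b k x = (\<Prod>i\<in>Basis. smoothstep (real k * ((x - a) \<bullet> i)) * smoothstep (real k * ((b - x) \<bullet> i)))"

lemma Ck_on_box_cutoff: "Ck_on m (box_cutoff a b k) UNIV"
  unfolding box_cutoff_def[abs_def]
  by (intro Ck_on_prod Ck_on_mult Ck_on_smoothstep_compose Ck_on_inner Ck_on_diff) auto

lemma box_cutoff_bounds: "0 \<le> box_cutoff a b k x" "box_cutoff a b k x \<le> 1"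
  by (auto simp: box_cutoff_def smoothstep_nonneg smoothstep_le_1 intro!: prod_nonneg prod_le_1 mult_le_one)

lemma box_cutoff_outside: "x \<notin> box a b \<Longrightarrow> box_cutoff a b k x = 0"
proof -
  assume "x \<notin> box a b"
  then obtain i where i: "i \<in> Basis" "x \<bullet> i \<le> a \<bullet> i \<or> b \<bullet> i \<le> x \<bullet> i"
    by (auto simp: mem_box not_less)
  then have "smoothstep (real k * ((x - a) \<bullet> i)) * smoothstep (real k * ((b - x) \<bullet> i)) = 0"
    by (auto simp: inner_diff_left mult_nonneg_nonpos)
  then show ?thesis using i(1) unfolding box_cutoff_def by (intro prod_zero) auto
qed

lemma test_function_box_cutoff:
  assumes "cbox a b \<subseteq> \<Omega>"
  shows "test_function \<Omega> (box_cutoff a b k)"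
proof -
  have "closure {x. box_cutoff a b k x \<noteq> 0} \<subseteq> cbox a b"
    using box_cutoff_outside[of _ a b k] box_subset_cbox by (intro closure_minimal) auto
  moreover from this have "bounded (closure {x. box_cutoff a b k x \<noteq> 0})"
    by (rule bounded_subset[OF bounded_cbox])
  ultimately show ?thesis
    using assms by (auto simp: test_function_def smooth_on_def Ck_on_box_cutoff compact_eq_bounded_closed)
qed

lemma eventually_smoothstep_mult: "t > 0 \<Longrightarrow> \<forall>\<^sub>F k in sequentially. smoothstep (real k * t) = 1"
proof -
  assume t: "t > 0"
  obtain N where "real N > 1 / t" using reals_Archimedean2 by blast
  with t have N: "1 \<le> real N * t" by (simp add: field_simps)
  have "real k * t \<ge> 1" if "k \<ge> N" for k
    by (rule order_trans[OF N]) (use t that in simp)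
  then show ?thesis by (auto simp: eventually_sequentially intro!: exI[of _ N])
qed

lemma box_cutoff_tendsto: "(\<lambda>k. box_cutoff a b k x) \<longlonglongrightarrow> indicator (box a b) x"
proof (cases "x \<in> box a b")
  case True
  then have "\<forall>\<^sub>F k in sequentially. \<forall>i\<in>Basis. smoothstep (real k * ((x - a) \<bullet> i)) = 1 \<and> smoothstep (real k * ((b - x) \<bullet> i)) = 1"
    by (intro eventually_ball_finite ballI eventually_conj eventually_smoothstep_mult)
      (auto simp: mem_box inner_diff_left)
  then have "\<forall>\<^sub>F k in sequentially. box_cutoff a b k x = 1"
    by eventually_elim (auto simp: box_cutoff_def)
  then show ?thesis using True by (simp add: tendsto_eventually)
qed (simp add: box_cutoff_outside)

section \<open>Difference quotients and integration by parts\<close>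

declare Ck_on.simps(2) [simp del]

text \<open>\<open>Ck_on\<close> records continuity only in basis directions; linearity of the
  derivative carries it to an arbitrary direction e.\<close>

lemma C1_continuous_derivative:
  assumes "Ck_on (Suc 0) f S" "open S"
  shows "continuous_on S (\<lambda>x. frechet_derivative f (at x) e)"
proof -
  have "frechet_derivative f (at x) e = (\<Sum>i\<in>Basis. (e \<bullet> i) *\<^sub>R frechet_derivative f (at x) i)" if "x \<in> S" for x
  proof -
    have lin: "linear (frechet_derivative f (at x))"
      using Ck_on_Suc_has_derivative[OF assms that] by (rule has_derivative_linear)
    show ?thesis
      by (subst euclidean_representation[of e, symmetric])
        (simp only: linear_sum[OF lin] linear_scale[OF lin])
  qed
  then show ?thesis
    using assms(1) by (subst continuous_on_cong[OF refl]) (auto intro!: continuous_intros simp: Ck_on.simps)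
qed

lemma integrable_continuous_compact_support:
  fixes f :: "'a::euclidean_space \<Rightarrow> 'b::euclidean_space"
  assumes "continuous_on UNIV f" "\<And>x. x \<notin> cball 0 R \<Longrightarrow> f x = 0"
  shows "integrable lborel f"
proof -
  have "integrable lborel (\<lambda>x. indicator (cball 0 R) x *\<^sub>R f x)"
    by (rule borel_integrable_compact) (use assms(1) in \<open>auto intro: continuous_on_subset\<close>)
  also have "(\<lambda>x. indicator (cball 0 R) x *\<^sub>R f x) = f"
    using assms(2) by (auto simp: indicator_def fun_eq_iff)
  finally show ?thesis .
qed

lemma bounded_continuous_compact_support:
  fixes f :: "'a::euclidean_space \<Rightarrow> 'b::real_normed_vector"
  assumes "continuous_on UNIV f" "\<And>x. x \<notin> cball 0 R \<Longrightarrow> f x = 0"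
  obtains B where "B > 0" "\<And>x. norm (f x) \<le> B"
proof -
  have "compact (f ` cball 0 R)"
    by (intro compact_continuous_image) (use assms(1) in \<open>auto intro: continuous_on_subset\<close>)
  then obtain B where B: "B > 0" "\<forall>y\<in>f ` cball 0 R. norm y \<le> B"
    using compact_imp_bounded bounded_pos by metis
  have "norm (f x) \<le> B" for x
    using B assms(2)[of x] by (cases "x \<in> cball 0 R") auto
  with B that show ?thesis by blast
qed

lemma frechet_derivative_zero_outside:
  assumes "\<And>x. x \<notin> cball 0 R \<Longrightarrow> f x = 0" "x \<notin> cball 0 R"
  shows "frechet_derivative f (at x) h = 0"
  using assms frechet_derivative_zero_open[of "- cball 0 R" x f 0 h] by (auto simp: open_Compl)

lemma lborel_integral_translate:
  fixes f :: "'a::euclidean_space \<Rightarrow> 'b::euclidean_space"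
  assumes "f \<in> borel_measurable borel"
  shows "(LINT x|lborel. f (x + c)) = (LINT x|lborel. f x)"
proof -
  have "(LINT x|lborel. f x) = (LINT x|distr lborel borel ((+) c). f x)"
    by (simp add: lborel_distr_plus)
  also have "\<dots> = (LINT x|lborel. f (x + c))"
    using assms by (subst integral_distr) (auto simp: add.commute)
  finally show ?thesis by simp
qed

lemma lborel_integrable_translate:
  fixes f :: "'a::euclidean_space \<Rightarrow> 'b::euclidean_space"
  assumes "integrable lborel f"
  shows "integrable lborel (\<lambda>x. f (x + c))"
proof -
  have "integrable (distr lborel borel ((+) c)) f"
    using assms by (simp add: lborel_distr_plus)
  then show ?thesis
    by (subst (asm) integrable_distr_eq) (use assms in \<open>auto simp: add.commute\<close>)
qed

text \<open>Difference quotients of a compactly supported \<open>C\<^sup>1\<close> function converge pointwise and are dominated;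
  this replaces the chain rule for functions that are merely Lipschitz.\<close>

abbreviation diffquot :: "('a::real_normed_vector \<Rightarrow> 'b::real_normed_vector) \<Rightarrow> 'a \<Rightarrow> nat \<Rightarrow> 'a \<Rightarrow> 'b" where
  "diffquot f e k x \<equiv> real (Suc k) *\<^sub>R (f (x + inverse (real (Suc k)) *\<^sub>R e) - f x)"

lemma diffquot_tendsto:
  assumes "Ck_on (Suc 0) f UNIV"
  shows "(\<lambda>k. diffquot f e k x) \<longlonglongrightarrow> frechet_derivative f (at x) e"
proof -
  let ?D = "frechet_derivative f (at x)"
  have D: "(f has_derivative ?D) (at x)"
    using Ck_on_Suc_has_derivative[OF assms] by simp
  have "((\<lambda>t. x + t *\<^sub>R e) has_derivative (\<lambda>t. t *\<^sub>R e)) (at 0)"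
    by (auto intro!: derivative_eq_intros)
  then have "((\<lambda>t. f (x + t *\<^sub>R e)) has_derivative (\<lambda>t. ?D (t *\<^sub>R e))) (at 0)"
    by (rule has_derivative_compose) (use D in simp)
  then have "((\<lambda>t. f (x + t *\<^sub>R e)) has_vector_derivative ?D e) (at 0)"
    using linear_scale[OF has_derivative_linear[OF D]] by (simp add: has_vector_derivative_def)
  then have "((\<lambda>t. (f (x + t *\<^sub>R e) - f x) /\<^sub>R t) \<longlongrightarrow> ?D e) (at 0)"
  proof -
    assume "((\<lambda>t. f (x + t *\<^sub>R e)) has_vector_derivative ?D e) (at 0)"
    then have "((\<lambda>t. norm (f (x + t *\<^sub>R e) - f x - t *\<^sub>R ?D e) / norm t) \<longlongrightarrow> 0) (at 0)"
      by (simp add: has_vector_derivative_def has_derivative_at)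
    then have "((\<lambda>t. norm ((f (x + t *\<^sub>R e) - f x) /\<^sub>R t - ?D e)) \<longlongrightarrow> 0) (at 0)"
    proof (rule Lim_transform_eventually)
      have "norm (f (x + t *\<^sub>R e) - f x - t *\<^sub>R ?D e) / norm t = norm ((f (x + t *\<^sub>R e) - f x) /\<^sub>R t - ?D e)"
        if "t \<noteq> 0" for t
      proof -
        have "(f (x + t *\<^sub>R e) - f x) /\<^sub>R t - ?D e = (f (x + t *\<^sub>R e) - f x - t *\<^sub>R ?D e) /\<^sub>R t"
          using that by (simp add: scaleR_diff_right)
        then show ?thesis by (simp only: norm_scaleR) (simp add: divide_inverse_commute)
      qed
      then show "\<forall>\<^sub>F t in at 0. norm (f (x + t *\<^sub>R e) - f x - t *\<^sub>R ?D e) / norm t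
          = norm ((f (x + t *\<^sub>R e) - f x) /\<^sub>R t - ?D e)"
        by (auto simp: eventually_at_filter)
    qed
    then show ?thesis by (simp add: LIM_zero_iff tendsto_norm_zero_iff)
  qed
  moreover have "filterlim (\<lambda>k. inverse (real (Suc k))) (at 0) sequentially"
    using LIMSEQ_inverse_real_of_nat by (auto simp: filterlim_at)
  ultimately have "(\<lambda>k. (f (x + inverse (real (Suc k)) *\<^sub>R e) - f x) /\<^sub>R inverse (real (Suc k))) \<longlonglongrightarrow> ?D e"
    by (rule filterlim_compose)
  then show ?thesis by simp
qed

text \<open>The mean value inequality bounds the quotient. The steps have length at most 1, so it
  vanishes beyond radius R + 1, and the bound is an integrable majorant independent of k.\<close>

lemma diffquot_bound:
  fixes f :: "'a::euclidean_space \<Rightarrow> 'b::euclidean_space"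
  assumes "Ck_on (Suc 0) f UNIV" "\<And>x. x \<notin> cball 0 R \<Longrightarrow> f x = 0" "norm e \<le> 1"
  obtains B where "B > 0" "\<And>k x. norm (diffquot f e k x) \<le> B * indicator (cball 0 (R + 1)) x"
proof -
  obtain B where B: "B > 0" "\<And>x. norm (frechet_derivative f (at x) e) \<le> B"
    by (rule bounded_continuous_compact_support[OF C1_continuous_derivative[OF assms(1) open_UNIV],
          where R=R]) (use frechet_derivative_zero_outside[OF assms(2)] in auto)
  have "norm (diffquot f e k x) \<le> B * indicator (cball 0 (R + 1)) x" for k x
  proof (cases "x \<in> cball 0 (R + 1)")
    case True
    define h where "h = inverse (real (Suc k))"
    have h: "h > 0" by (simp add: h_def)
    have D: "((\<lambda>t. f (x + t *\<^sub>R e)) has_derivative (\<lambda>s. frechet_derivative f (at (x + t *\<^sub>R e)) (s *\<^sub>R e))) (at t)" for t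
    proof -
      have "((\<lambda>t. x + t *\<^sub>R e) has_derivative (\<lambda>t. t *\<^sub>R e)) (at t)"
        by (auto intro!: derivative_eq_intros)
      then show ?thesis
        by (rule has_derivative_compose) (use Ck_on_Suc_has_derivative[OF assms(1)] in simp)
    qed
    have "continuous_on {0..h} (\<lambda>t. f (x + t *\<^sub>R e))"
      by (rule has_derivative_continuous_on[OF has_derivative_at_withinI[OF D]])
    from mvt_general[OF h this D] obtain t where
      t: "norm (f (x + h *\<^sub>R e) - f x) \<le> norm (frechet_derivative f (at (x + t *\<^sub>R e)) (h *\<^sub>R e))"
      by auto
    also have "\<dots> = h * norm (frechet_derivative f (at (x + t *\<^sub>R e)) e)"
      using h linear_scale[OF has_derivative_linear[OF Ck_on_Suc_has_derivative[OF assms(1) open_UNIV UNIV_I]]]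
      by simp
    also have "\<dots> \<le> h * B" using B h by simp
    finally have "norm (f (x + h *\<^sub>R e) - f x) / h \<le> B" using h by (simp add: field_simps)
    then show ?thesis using True by (simp add: h_def divide_inverse mult.commute)
  next
    case False
    have "norm (inverse (real (Suc k)) *\<^sub>R e) \<le> 1"
      using assms(3) by (simp add: inverse_eq_divide divide_simps)
    then have "x + inverse (real (Suc k)) *\<^sub>R e \<notin> cball 0 R" "x \<notin> cball 0 R"
      using False norm_diff_ineq[of x "inverse (real (Suc k)) *\<^sub>R e"] by auto
    then have "f x = 0" "f (x + inverse (real (Suc k)) *\<^sub>R e) = 0" using assms(2) by blast+
    then show ?thesis using False by simp
  qed
  with B that show ?thesis by blast
qed

lemma C1_borel_measurable:
  fixes f :: "'a::euclidean_space \<Rightarrow> 'b::euclidean_space"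
  assumes "Ck_on (Suc 0) f UNIV"
  shows "f \<in> borel_measurable borel" "(\<lambda>x. frechet_derivative f (at x) e) \<in> borel_measurable borel"
  using Ck_on_imp_continuous_on[OF assms] C1_continuous_derivative[OF assms]
  by (auto intro: borel_measurable_continuous_onI)

lemma integrable_cball: "integrable lborel (\<lambda>x. B * indicator (cball (0::'a::euclidean_space) R) x :: real)"
  by (intro integrable_mult_right integrable_real_indicator) (use emeasure_bounded_finite[OF bounded_cball] in auto)

text \<open>By translation invariance every difference quotient has integral zero, and dominated
  convergence passes this to the derivative.\<close>

lemma integral_derivative_compact_support:
  fixes f :: "'a::euclidean_space \<Rightarrow> 'b::euclidean_space"
  assumes f: "Ck_on (Suc 0) f UNIV" "\<And>x. x \<notin> cball 0 R \<Longrightarrow> f x = 0" and e: "norm e \<le> 1"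
  shows "(LINT x|lborel. frechet_derivative f (at x) e) = 0"
proof -
  obtain B where B: "B > 0" "\<And>k x. norm (diffquot f e k x) \<le> B * indicator (cball 0 (R + 1)) x"
    using diffquot_bound[OF f e] by blast
  note [measurable] = C1_borel_measurable[OF f(1)]
  have int: "integrable lborel f"
    by (rule integrable_continuous_compact_support[OF Ck_on_imp_continuous_on[OF f(1)] f(2)])
  have "(\<lambda>k. LINT x|lborel. diffquot f e k x) \<longlonglongrightarrow> (LINT x|lborel. frechet_derivative f (at x) e)"
    by (rule integral_dominated_convergence[OF _ _ integrable_cball[of B "R + 1"]])
      (use B diffquot_tendsto[OF f(1)] in auto)
  moreover have "(LINT x|lborel. diffquot f e k x) = 0" for k
    using lborel_integrable_translate[OF int] int lborel_integral_translate[of f]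
    by (simp del: of_nat_Suc)
  ultimately show ?thesis by (simp add: LIMSEQ_const_iff)
qed

text \<open>The difference quotient is moved from X onto the Lipschitz function first, its
  increments are bounded through \<open>loc\<close> by increments of \<phi>, and only then does k
  tend to infinity. Hence no derivative of F is ever formed. S plays the role of a pointwise bound
  on |grad F|.\<close>

lemma integral_by_parts_Lipschitz:
  fixes \<phi> :: "'a::euclidean_space \<Rightarrow> 'b::euclidean_space" and X :: "'a \<Rightarrow> real" and F S :: "'b \<Rightarrow> real"
  assumes \<phi>: "Ck_on (Suc 0) \<phi> UNIV" "\<And>x. x \<notin> cball 0 R \<Longrightarrow> \<phi> x = 0"
    and X: "Ck_on (Suc 0) X UNIV" "\<And>x. x \<notin> cball 0 R \<Longrightarrow> X x = 0" and e: "norm e \<le> 1"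
    and S: "continuous_on UNIV S" "\<And>p. S p \<ge> 0" and F: "continuous_on UNIV F"
    and loc: "\<And>\<tau>. \<tau> > 0 \<Longrightarrow> \<exists>\<delta>>0. \<forall>p q. norm (p - q) < \<delta> \<longrightarrow> \<bar>F p - F q\<bar> \<le> (S p + \<tau>) * norm (p - q)"
  shows "\<bar>LINT x|lborel. (F z - F (z + \<phi> x)) * frechet_derivative X (at x) e\<bar>
     \<le> (LINT x|lborel. \<bar>X x\<bar> * S (z + \<phi> x) * norm (frechet_derivative \<phi> (at x) e))"
proof -
  define f where "f x = F z - F (z + \<phi> x)" for x
  define L where "L = (LINT x|lborel. f x * frechet_derivative X (at x) e)"
  have c\<phi>: "continuous_on UNIV \<phi>" and cX: "continuous_on UNIV X"
    using Ck_on_imp_continuous_on[OF \<phi>(1)] Ck_on_imp_continuous_on[OF X(1)] by auto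
  have cf: "continuous_on UNIV f"
    unfolding f_def by (intro continuous_intros continuous_on_compose2[OF F] c\<phi>) auto
  have cS: "continuous_on UNIV (\<lambda>x. S (z + \<phi> x))"
    by (intro continuous_intros continuous_on_compose2[OF S(1)] c\<phi>) auto
  have f0: "x \<notin> cball 0 R \<Longrightarrow> f x = 0" for x by (simp add: f_def \<phi>(2))
  note [measurable] = borel_measurable_continuous_onI[OF cf] borel_measurable_continuous_onI[OF cS]
    C1_borel_measurable[OF \<phi>(1)] C1_borel_measurable[OF X(1)]
  obtain Bf where Bf: "Bf > 0" "\<And>x. norm (f x) \<le> Bf"
    using bounded_continuous_compact_support[OF cf f0] by blast
  obtain BX where BX: "BX > 0" "\<And>x. norm (X x) \<le> BX"
    using bounded_continuous_compact_support[OF cX X(2)] by blast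
  obtain B where B: "B > 0" "\<And>k x. norm (diffquot X e k x) \<le> B * indicator (cball 0 (R + 1)) x"
    using diffquot_bound[OF X e] by blast
  obtain D where D: "D > 0" "\<And>k x. norm (diffquot \<phi> (- e) k x) \<le> D * indicator (cball 0 (R + 1)) x"
    using diffquot_bound[OF \<phi>, where e="- e"] e by auto
  have lim1: "(\<lambda>k. LINT x|lborel. f x * diffquot X e k x) \<longlonglongrightarrow> L"
    unfolding L_def
  proof (rule integral_dominated_convergence[OF _ _ integrable_cball[of "Bf * B" "R + 1"]])
    show "AE x in lborel. norm (f x * diffquot X e k x) \<le> Bf * B * indicator (cball 0 (R + 1)) x" for k
    proof (rule AE_I2)
      fix x :: 'a
      show "norm (f x * diffquot X e k x) \<le> Bf * B * indicator (cball 0 (R + 1)) x"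
        using mult_mono[OF Bf(2)[of x] B(2)[of k x]] Bf(1) by (simp only: norm_mult mult.assoc) auto
    qed
    show "AE x in lborel. (\<lambda>k. f x * diffquot X e k x) \<longlonglongrightarrow> f x * frechet_derivative X (at x) e"
      by (intro AE_I2 tendsto_mult tendsto_const diffquot_tendsto X)
  qed auto
  \<comment> \<open>Discrete integration by parts: translating the shifted term moves the difference
    from X to f and reverses its direction to -e.\<close>
  have shift: "(LINT x|lborel. f x * diffquot X e k x) = (LINT x|lborel. X x * diffquot f (- e) k x)" for k
  proof -
    define c where "c = inverse (real (Suc k)) *\<^sub>R e"
    have i1: "integrable lborel (\<lambda>x. f x * X (x + c))"
      by (rule integrable_continuous_compact_support[where R=R])
        (auto intro!: continuous_intros cf continuous_on_compose2[OF cX] simp: f0)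
    have i2: "integrable lborel (\<lambda>x. f (x - c) * X x)"
      by (rule integrable_continuous_compact_support[where R=R])
        (auto intro!: continuous_intros cX continuous_on_compose2[OF cf] simp: X)
    have i3: "integrable lborel (\<lambda>x. f x * X x)"
      by (rule integrable_continuous_compact_support[where R=R])
        (auto intro!: continuous_intros cX cf simp: X)
    have "(LINT x|lborel. f x * X (x + c)) = (LINT x|lborel. f (x - c) * X x)"
      using lborel_integral_translate[of "\<lambda>x. f x * X (x + c)" "- c"] by simp
    then have "real (Suc k) * ((LINT x|lborel. f x * X (x + c)) - (LINT x|lborel. f x * X x))
       = real (Suc k) * ((LINT x|lborel. f (x - c) * X x) - (LINT x|lborel. f x * X x))" by simp
    then have "(LINT x|lborel. real (Suc k) * (f x * X (x + c) - f x * X x))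
      = (LINT x|lborel. real (Suc k) * (f (x - c) * X x - f x * X x))"
      using i1 i2 i3 by (simp del: of_nat_Suc)
    then show ?thesis by (simp add: c_def algebra_simps del: of_nat_Suc)
  qed
  have le: "\<bar>L\<bar> \<le> (LINT x|lborel. \<bar>X x\<bar> * (S (z + \<phi> x) + \<tau>) * norm (frechet_derivative \<phi> (at x) e))" if \<tau>: "\<tau> > 0" for \<tau>
  proof -
    obtain \<delta> where \<delta>: "\<delta> > 0" "\<And>p q. norm (p - q) < \<delta> \<Longrightarrow> \<bar>F p - F q\<bar> \<le> (S p + \<tau>) * norm (p - q)"
      using loc[OF \<tau>] by blast
    define w where "w x = \<bar>X x\<bar> * (S (z + \<phi> x) + \<tau>)" for x
    have cw: "continuous_on UNIV w" unfolding w_def by (intro continuous_intros cX cS)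
    have w0: "x \<notin> cball 0 R \<Longrightarrow> w x = 0" for x by (simp add: w_def X)
    have wpos: "w x \<ge> 0" for x using S(2) \<tau> by (simp add: w_def)
    note [measurable] = borel_measurable_continuous_onI[OF cw]
    obtain Bw where Bw: "Bw > 0" "\<And>x. norm (w x) \<le> Bw"
      using bounded_continuous_compact_support[OF cw w0] by blast
    have dom: "norm (w x * norm (diffquot \<phi> (- e) k x)) \<le> Bw * D * indicator (cball 0 (R + 1)) x" for k x
      using mult_mono[OF Bw(2)[of x] D(2)[of k x]] Bw(1) by (simp add: abs_mult mult.assoc del: of_nat_Suc)
    have lim2: "(\<lambda>k. LINT x|lborel. w x * norm (diffquot \<phi> (- e) k x)) \<longlonglongrightarrow>
        (LINT x|lborel. w x * norm (frechet_derivative \<phi> (at x) (- e)))"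
    proof (rule integral_dominated_convergence[OF _ _ integrable_cball[of "Bw * D" "R + 1"]])
      show "AE x in lborel. (\<lambda>k. w x * norm (diffquot \<phi> (- e) k x)) \<longlonglongrightarrow> w x * norm (frechet_derivative \<phi> (at x) (- e))"
        by (intro AE_I2 tendsto_mult tendsto_const tendsto_norm diffquot_tendsto \<phi>)
    qed (use dom in auto)
    have "\<forall>\<^sub>F k in sequentially. \<bar>LINT x|lborel. f x * diffquot X e k x\<bar> \<le> (LINT x|lborel. w x * norm (diffquot \<phi> (- e) k x))"
    proof -
      \<comment> \<open>For k >= N the increment of \<phi> is at most D / (k + 1) < \<delta>,
        uniformly in x, so the local estimate for F applies at every point at once.\<close>
      obtain N where "real N > D / \<delta>" using reals_Archimedean2 by blast
      then have N: "D < \<delta> * real N" using \<delta>(1) by (simp add: field_simps)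
      have "\<bar>LINT x|lborel. f x * diffquot X e k x\<bar> \<le> (LINT x|lborel. w x * norm (diffquot \<phi> (- e) k x))" if "k \<ge> N" for k
      proof -
        define c where "c = inverse (real (Suc k)) *\<^sub>R - e"
        have pt: "norm (X x * diffquot f (- e) k x) \<le> w x * norm (diffquot \<phi> (- e) k x)" for x
        proof -
          have "real (Suc k) * norm (\<phi> (x + c) - \<phi> x) \<le> D"
            using D(1) order_trans[OF D(2)[of k x], of D] by (simp add: c_def indicator_def)
          also have "D < \<delta> * real (Suc k)"
            by (rule less_le_trans[OF N]) (use that \<delta> in simp)
          finally have "norm (\<phi> (x + c) - \<phi> x) < \<delta>" by (simp add: mult.commute)
          then have "\<bar>F (z + \<phi> x) - F (z + \<phi> (x + c))\<bar> \<le> (S (z + \<phi> x) + \<tau>) * norm (\<phi> (x + c) - \<phi> x)"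
            using \<delta>(2)[of "z + \<phi> x" "z + \<phi> (x + c)"] by (simp add: norm_minus_commute)
          then have "\<bar>f (x + c) - f x\<bar> \<le> (S (z + \<phi> x) + \<tau>) * norm (\<phi> (x + c) - \<phi> x)" by (simp add: f_def)
          then have "\<bar>X x\<bar> * (real (Suc k) * \<bar>f (x + c) - f x\<bar>)
             \<le> \<bar>X x\<bar> * (real (Suc k) * ((S (z + \<phi> x) + \<tau>) * norm (\<phi> (x + c) - \<phi> x)))"
            by (intro mult_left_mono) auto
          moreover have "norm (X x * diffquot f (- e) k x) = \<bar>X x\<bar> * (real (Suc k) * \<bar>f (x + c) - f x\<bar>)"
            by (simp add: abs_mult c_def del: of_nat_Suc)
          moreover have "w x * norm (diffquot \<phi> (- e) k x)
             = \<bar>X x\<bar> * (real (Suc k) * ((S (z + \<phi> x) + \<tau>) * norm (\<phi> (x + c) - \<phi> x)))"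
            by (simp add: w_def c_def mult_ac del: of_nat_Suc)
          ultimately show ?thesis by (simp only:)
        qed
        have "\<bar>LINT x|lborel. X x * diffquot f (- e) k x\<bar> \<le> (LINT x|lborel. w x * norm (diffquot \<phi> (- e) k x))"
          unfolding real_norm_def[symmetric]
        proof (rule order_trans[OF integral_norm_bound integral_mono])
          show i: "integrable lborel (\<lambda>x. w x * norm (diffquot \<phi> (- e) k x))"
            by (rule Bochner_Integration.integrable_bound[OF integrable_cball[of "Bw * D" "R + 1"]])
              (measurable, rule AE_I2, rule order_trans[OF dom], rule order_trans[OF abs_ge_self], simp)
          show "integrable lborel (\<lambda>x. norm (X x * diffquot f (- e) k x))"
          proof (rule Bochner_Integration.integrable_bound[OF i])
            show "AE x in lborel. norm (norm (X x * diffquot f (- e) k x)) \<le> norm (w x * norm (diffquot \<phi> (- e) k x))"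
              using order_trans[OF pt abs_ge_self] by (intro AE_I2) (simp only: real_norm_def abs_idempotent)
          qed measurable
          show "norm (X x * diffquot f (- e) k x) \<le> w x * norm (diffquot \<phi> (- e) k x)" for x
            by (rule pt)
        qed
        then show ?thesis by (simp only: shift)
      qed
      then show ?thesis by (auto simp: eventually_sequentially)
    qed
    then have "\<bar>L\<bar> \<le> (LINT x|lborel. w x * norm (frechet_derivative \<phi> (at x) (- e)))"
      by (intro tendsto_le[OF _ lim2 tendsto_rabs[OF lim1]]) auto
    moreover have "frechet_derivative \<phi> (at x) (- e) = - frechet_derivative \<phi> (at x) e" for x
      using linear_neg[OF has_derivative_linear[OF Ck_on_Suc_has_derivative[OF \<phi>(1) open_UNIV UNIV_I]]] .
    ultimately show ?thesis by (simp add: w_def)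
  qed
  define G where "G x = norm (frechet_derivative \<phi> (at x) e)" for x
  have cG: "continuous_on UNIV G" unfolding G_def by (intro continuous_intros C1_continuous_derivative \<phi>) auto
  have i1: "integrable lborel (\<lambda>x. \<bar>X x\<bar> * S (z + \<phi> x) * G x)" and i2: "integrable lborel (\<lambda>x. \<bar>X x\<bar> * G x)"
    by (rule integrable_continuous_compact_support[where R=R];
        auto intro!: continuous_intros cX cS cG simp: X)+
  define I where "I = (LINT x|lborel. \<bar>X x\<bar> * S (z + \<phi> x) * G x)"
  define I' where "I' = (LINT x|lborel. \<bar>X x\<bar> * G x)"
  have *: "\<bar>L\<bar> \<le> I + \<tau> * I'" if "\<tau> > 0" for \<tau>
  proof -
    have "(LINT x|lborel. \<bar>X x\<bar> * (S (z + \<phi> x) + \<tau>) * G x) = (LINT x|lborel. \<bar>X x\<bar> * S (z + \<phi> x) * G x + \<tau> * (\<bar>X x\<bar> * G x))"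
      by (simp add: algebra_simps)
    also have "\<dots> = I + \<tau> * I'" using i1 i2 by (simp add: I_def I'_def)
    finally show ?thesis using le[OF that] by (simp add: G_def)
  qed
  \<comment> \<open>The error is \<tau> times a fixed integral, hence disappears as \<tau> tends to
    0.\<close>
  have "\<bar>L\<bar> \<le> I"
  proof (rule tendsto_lowerbound)
    show "((\<lambda>\<tau>. I + \<tau> * I') \<longlongrightarrow> I) (at_right 0)" by (auto intro!: tendsto_eq_intros)
    show "\<forall>\<^sub>F \<tau> in at_right 0. \<bar>L\<bar> \<le> I + \<tau> * I'" using * by (auto simp: eventually_at_filter)
  qed simp
  then show ?thesis by (simp add: L_def I_def f_def G_def)
qed

section \<open>Uniqueness of weak derivatives\<close>

lemma open_sets_lebesgue: "open S \<Longrightarrow> S \<in> sets lebesgue"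
  by (simp add: sets_completionI_sets)

lemma continuous_measurable_lebesgue:
  fixes f :: "'a::euclidean_space \<Rightarrow> 'b::euclidean_space"
  shows "continuous_on UNIV f \<Longrightarrow> f \<in> borel_measurable lebesgue"
  by (intro measurable_completion) (simp add: borel_measurable_continuous_onI)

lemma sigma_finite_lebesgue: "sigma_finite_measure (lebesgue :: 'a::euclidean_space measure)"
proof
  let ?A = "range (\<lambda>n::nat. cball (0::'a) (real n))"
  have "\<Union>?A = UNIV" using real_arch_simple by auto
  moreover have "emeasure lebesgue (cball (0::'a) r) \<noteq> \<infinity>" for r
    using emeasure_bounded_finite[OF bounded_cball, of "0::'a" r] by simp
  ultimately show "\<exists>A::'a set set. countable A \<and> A \<subseteq> sets lebesgue \<and> \<Union>A = space lebesgue \<and> (\<forall>a\<in>A. emeasure lebesgue a \<noteq> \<infinity>)"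
    by (intro exI[of _ ?A]) auto
qed

text \<open>Boxes are stable under intersection and generate the Borel sets, so a Dynkin argument
  extends the vanishing to Borel sets. Complements need the total integral to vanish, which the
  support in a box supplies; Lebesgue sets differ from Borel sets by null sets.\<close>

lemma AE_zero_if_box_integrals_zero:
  fixes g :: "'a::euclidean_space \<Rightarrow> 'b::euclidean_space"
  assumes g: "integrable lebesgue g" and zero: "\<And>x. x \<notin> box c d \<Longrightarrow> g x = 0"
    and box: "\<And>a b. (LINT x:box a b|lebesgue. g x) = 0"
  shows "AE x in lebesgue. g x = 0"
proof (rule sigma_finite_measure.density_zero[OF sigma_finite_lebesgue g])
  note si = integrable_mult_indicator[OF _ g, folded set_integrable_def]
  have tot: "(LINT x|lebesgue. g x) = 0"
  proof -
    have "(LINT x:box c d|lebesgue. g x) = (LINT x|lebesgue. g x)"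
      unfolding set_lebesgue_integral_def
      by (rule Bochner_Integration.integral_cong) (auto simp: zero indicator_def)
    then show ?thesis using box by simp
  qed
  have borel: "(LINT x:S|lebesgue. g x) = 0" if "S \<in> sets borel" for S
  proof -
    let ?E = "range (\<lambda>(a, b). box a b :: 'a set)"
    have "Int_stable ?E" by (auto simp: Int_stable_def box_Int_box)
    moreover have "?E \<subseteq> Pow UNIV" by auto
    moreover have "S \<in> sigma_sets UNIV ?E"
      using that by (simp add: borel_eq_box)
    ultimately show ?thesis
    proof (induction rule: sigma_sets_induct_disjoint)
      case (basic A)
      then show ?case using box by auto
    next
      case empty
      then show ?case by (simp add: set_lebesgue_integral_def)
    next
      case (compl A)
      then have A: "A \<in> sets lebesgue" by (simp add: borel_eq_box sets_completionI_sets)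
      have "(LINT x:UNIV - A|lebesgue. g x) = (LINT x|lebesgue. g x) - (LINT x:A|lebesgue. g x)"
      proof -
        have "(LINT x|lebesgue. g x - indicat_real A x *\<^sub>R g x) = (LINT x|lebesgue. g x) - (LINT x|lebesgue. indicat_real A x *\<^sub>R g x)"
          by (rule Bochner_Integration.integral_diff) (use g si[OF A] in \<open>auto simp: set_integrable_def\<close>)
        moreover have "(\<lambda>x. g x - indicat_real A x *\<^sub>R g x) = (\<lambda>x. indicat_real (UNIV - A) x *\<^sub>R g x)"
          by (auto simp: indicator_def fun_eq_iff)
        ultimately show ?thesis by (simp only: set_lebesgue_integral_def)
      qed
      then show ?case using compl tot by simp
    next
      case (union A)
      then have A: "range A \<subseteq> sets lebesgue" by (auto simp: borel_eq_box sets_completionI_sets)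
      then have "(LINT x:(\<Union>i. A i)|lebesgue. g x) = (\<Sum>i. (LINT x:A i|lebesgue. g x))"
        using union by (intro lebesgue_integral_countable_add si) (auto simp: disjoint_family_on_def)
      then show ?case using union by simp
    qed
  qed
  fix A :: "'a set" assume A: "A \<in> sets lebesgue"
  then obtain S N N' where S: "A = S \<union> N" "N \<subseteq> N'" "N' \<in> null_sets lborel" "S \<in> sets lborel"
    by (rule sets_completionE)
  have N': "AE x in lebesgue. x \<notin> N'"
    using S(3) by (intro AE_not_in null_sets_completionI)
  have Sl: "S \<in> sets lebesgue" using S(4) by (simp add: sets_completionI_sets)
  have "(LINT x:A|lebesgue. g x) = (LINT x:S|lebesgue. g x)"
    unfolding set_lebesgue_integral_def
  proof (rule integral_cong_AE)
    show "AE x in lebesgue. indicat_real A x *\<^sub>R g x = indicat_real S x *\<^sub>R g x"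
      using N' by eventually_elim (use S in \<open>auto simp: indicator_def\<close>)
  qed (use si[OF A] si[OF Sl] in \<open>auto simp: set_integrable_def\<close>)
  then show "(LINT x:A|lebesgue. g x) = 0" using borel S(4) by simp
qed

lemma test_function_support:
  assumes "test_function \<Omega> \<phi>"
  obtains K R where "compact K" "K \<subseteq> \<Omega>" "K \<subseteq> cball 0 R" "Ck_on (Suc 0) \<phi> UNIV"
    "\<And>x. x \<notin> K \<Longrightarrow> \<phi> x = 0" "\<And>x h. x \<notin> K \<Longrightarrow> frechet_derivative \<phi> (at x) h = 0"
proof -
  define K where "K = closure {x. \<phi> x \<noteq> 0}"
  have K: "compact K" "K \<subseteq> \<Omega>" "Ck_on (Suc 0) \<phi> UNIV"
    using assms by (auto simp: test_function_def K_def smooth_on_def)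
  have 0: "\<phi> x = 0" if "x \<notin> K" for x
  proof (rule ccontr)
    assume "\<phi> x \<noteq> 0"
    then have "x \<in> K" unfolding K_def by (intro subsetD[OF closure_subset]) simp
    with that show False by simp
  qed
  have "open (- K)" using compact_imp_closed[OF K(1)] by (simp add: open_Compl)
  then have d: "frechet_derivative \<phi> (at x) h = 0" if "x \<notin> K" for x h
    by (rule frechet_derivative_zero_open[where c=0]) (use that 0 in simp_all)
  obtain R where "\<forall>x\<in>K. norm x \<le> R"
    using compact_imp_bounded[OF K(1)] bounded_iff by blast
  then have "K \<subseteq> cball 0 R" by auto
  then show ?thesis by (rule that[OF K(1,2) _ K(3) 0 d])
qed

lemma set_integrable_scaleR_locally_integrable:
  fixes q :: "'a::euclidean_space \<Rightarrow> real" and g :: "'a \<Rightarrow> 'b::euclidean_space"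
  assumes q: "continuous_on UNIV q" "\<And>x. x \<notin> K \<Longrightarrow> q x = 0" and K: "compact K" "K \<subseteq> \<Omega>"
    and g: "locally_integrable_on \<Omega> g"
  shows "set_integrable lebesgue \<Omega> (\<lambda>x. q x *\<^sub>R g x)"
proof -
  have gK: "integrable lebesgue (\<lambda>x. indicator K x *\<^sub>R g x)"
    using g K by (auto simp: locally_integrable_on_def set_integrable_def)
  have "compact (q ` K)"
    using q(1) K(1) by (intro compact_continuous_image) (auto intro: continuous_on_subset)
  then obtain B where B: "\<forall>y\<in>q ` K. norm y \<le> B" "B > 0"
    using compact_imp_bounded bounded_pos by metis
  have "integrable lebesgue (\<lambda>x. q x *\<^sub>R (indicator K x *\<^sub>R g x))"
  proof (rule Bochner_Integration.integrable_bound)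
    show "integrable lebesgue (\<lambda>x. B * norm (indicator K x *\<^sub>R g x))"
      using gK by (intro integrable_mult_right integrable_norm)
    show "(\<lambda>x. q x *\<^sub>R (indicator K x *\<^sub>R g x)) \<in> borel_measurable lebesgue"
      using borel_measurable_integrable[OF gK] continuous_measurable_lebesgue[OF q(1)]
      by (rule borel_measurable_scaleR[rotated])
    show "AE x in lebesgue. norm (q x *\<^sub>R (indicator K x *\<^sub>R g x)) \<le> norm (B * norm (indicator K x *\<^sub>R g x))"
      using B by (auto intro!: AE_I2 mult_right_mono simp: indicator_def)
  qed
  also have "(\<lambda>x. q x *\<^sub>R (indicator K x *\<^sub>R g x)) = (\<lambda>x. indicator \<Omega> x *\<^sub>R (q x *\<^sub>R g x))"
    using q(2) K(2) by (auto simp: indicator_def fun_eq_iff)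
  finally show ?thesis by (simp add: set_integrable_def)
qed

lemma set_integrable_test_scaleR:
  fixes \<phi> :: "'a::euclidean_space \<Rightarrow> real"
  assumes "test_function \<Omega> \<phi>" "locally_integrable_on \<Omega> g"
  shows "set_integrable lebesgue \<Omega> (\<lambda>x. \<phi> x *\<^sub>R g x)"
    "set_integrable lebesgue \<Omega> (\<lambda>x. frechet_derivative \<phi> (at x) e *\<^sub>R g x)"
proof -
  obtain K R where K: "compact K" "K \<subseteq> \<Omega>" "Ck_on (Suc 0) \<phi> UNIV"
    "\<And>x. x \<notin> K \<Longrightarrow> \<phi> x = 0" "\<And>x h. x \<notin> K \<Longrightarrow> frechet_derivative \<phi> (at x) h = 0"
    using test_function_support[OF assms(1)] by metis
  show "set_integrable lebesgue \<Omega> (\<lambda>x. \<phi> x *\<^sub>R g x)"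
    using K assms(2) Ck_on_imp_continuous_on by (intro set_integrable_scaleR_locally_integrable) auto
  show "set_integrable lebesgue \<Omega> (\<lambda>x. frechet_derivative \<phi> (at x) e *\<^sub>R g x)"
    using K assms(2) C1_continuous_derivative[OF K(3) open_UNIV] by (intro set_integrable_scaleR_locally_integrable[where K=K]) auto
qed

text \<open>The fundamental lemma of the calculus of variations. Box cutoffs are test functions
  converging boundedly to indicators, so the integrals over all boxes inside a closed box in
  \<Omega> vanish; countably many closed boxes exhaust \<Omega>.\<close>

lemma AE_zero_if_test_integrals_zero:
  fixes g :: "'a::euclidean_space \<Rightarrow> 'b::euclidean_space"
  assumes \<Omega>: "open \<Omega>" and g: "locally_integrable_on \<Omega> g"
    and test: "\<And>\<phi> :: 'a \<Rightarrow> real. test_function \<Omega> \<phi> \<Longrightarrow> (LINT x:\<Omega>|lebesgue. \<phi> x *\<^sub>R g x) = 0"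
  shows "AE x in lebesgue. x \<in> \<Omega> \<longrightarrow> g x = 0"
proof -
  have box: "AE x in lebesgue. x \<in> box c d \<longrightarrow> g x = 0" if cd: "cbox c d \<subseteq> \<Omega>" for c d
  proof -
    have gc: "integrable lebesgue (\<lambda>x. indicator (cbox c d) x *\<^sub>R g x)"
      using g cd by (auto simp: locally_integrable_on_def set_integrable_def)
    have go: "integrable lebesgue (\<lambda>x. indicator (box c d) x *\<^sub>R g x)"
    proof -
      have "integrable lebesgue (\<lambda>x. indicator (box c d) x *\<^sub>R (indicator (cbox c d) x *\<^sub>R g x))"
        by (intro integrable_mult_indicator gc) simp
      also have "(\<lambda>x. indicator (box c d) x *\<^sub>R (indicator (cbox c d) x *\<^sub>R g x)) = (\<lambda>x. indicator (box c d) x *\<^sub>R g x)"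
        using box_subset_cbox by (auto simp: indicator_def fun_eq_iff)
      finally show ?thesis .
    qed
    have "AE x in lebesgue. indicator (box c d) x *\<^sub>R g x = 0"
    proof (rule AE_zero_if_box_integrals_zero[OF go, of c d])
      fix a b :: 'a
      obtain a' b' where ab: "box a b \<inter> box c d = box a' b'" using box_Int_box by blast
      show "(LINT x:box a b|lebesgue. indicat_real (box c d) x *\<^sub>R g x) = 0"
      proof (cases "box a' b' = {}")
        case True
        then have "(\<lambda>x. indicat_real (box a b) x *\<^sub>R indicat_real (box c d) x *\<^sub>R g x) = (\<lambda>x. 0)"
          using ab by (auto simp: indicator_def fun_eq_iff)
        then show ?thesis by (simp only: set_lebesgue_integral_def integral_zero)
      next
        case False
        \<comment> \<open>The closure of a nonempty open box is the closed box, so the inclusion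
          passes to closed boxes; the empty case had to be separated for this.\<close>
        have "closure (box a' b') \<subseteq> closure (box c d)"
          using ab by (intro closure_mono) auto
        with False have sub: "cbox a' b' \<subseteq> cbox c d"
          using ab by (cases "box c d = {}") auto
        let ?\<phi> = "box_cutoff a' b'"
        have "(\<lambda>k. LINT x|lebesgue. ?\<phi> k x *\<^sub>R (indicator (cbox c d) x *\<^sub>R g x))
          \<longlonglongrightarrow> (LINT x|lebesgue. indicator (box a' b') x *\<^sub>R (indicator (cbox c d) x *\<^sub>R g x))"
        proof (rule integral_dominated_convergence[OF _ _ integrable_norm[OF gc]])
          show "(\<lambda>x. ?\<phi> k x *\<^sub>R (indicator (cbox c d) x *\<^sub>R g x)) \<in> borel_measurable lebesgue" for k
            using borel_measurable_integrable[OF gc]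
              continuous_measurable_lebesgue[OF Ck_on_imp_continuous_on[OF Ck_on_box_cutoff]]
            by (rule borel_measurable_scaleR[rotated])
          show "(\<lambda>x. indicator (box a' b') x *\<^sub>R (indicator (cbox c d) x *\<^sub>R g x)) \<in> borel_measurable lebesgue"
            by (intro borel_measurable_integrable integrable_mult_indicator gc) simp
          show "AE x in lebesgue. (\<lambda>k. ?\<phi> k x *\<^sub>R (indicat_real (cbox c d) x *\<^sub>R g x))
              \<longlonglongrightarrow> indicator (box a' b') x *\<^sub>R (indicator (cbox c d) x *\<^sub>R g x)"
            by (intro AE_I2 tendsto_scaleR box_cutoff_tendsto tendsto_const)
          show "AE x in lebesgue. norm (?\<phi> k x *\<^sub>R (indicat_real (cbox c d) x *\<^sub>R g x))
              \<le> norm (indicator (cbox c d) x *\<^sub>R g x)" for k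
            using box_cutoff_bounds[of a' b' k]
            by (intro AE_I2) (auto simp: indicator_def mult_left_le_one_le)
        qed
        moreover have "(LINT x|lebesgue. ?\<phi> k x *\<^sub>R (indicator (cbox c d) x *\<^sub>R g x)) = 0" for k
        proof -
          have "(LINT x|lebesgue. ?\<phi> k x *\<^sub>R (indicator (cbox c d) x *\<^sub>R g x)) = (LINT x:\<Omega>|lebesgue. ?\<phi> k x *\<^sub>R g x)"
            unfolding set_lebesgue_integral_def
          proof (rule Bochner_Integration.integral_cong)
            fix x show "?\<phi> k x *\<^sub>R (indicator (cbox c d) x *\<^sub>R g x) = indicator \<Omega> x *\<^sub>R (?\<phi> k x *\<^sub>R g x)"
              using box_cutoff_outside[of x a' b' k] sub cd box_subset_cbox[of a' b']
              by (cases "x \<in> box a' b'") (auto simp: indicator_def)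
          qed simp
          also have "\<dots> = 0"
            by (intro test test_function_box_cutoff) (use sub cd in auto)
          finally show ?thesis .
        qed
        ultimately have "(LINT x|lebesgue. indicator (box a' b') x *\<^sub>R (indicator (cbox c d) x *\<^sub>R g x)) = 0"
          by (simp add: LIMSEQ_const_iff)
        moreover have "(\<lambda>x. indicator (box a' b') x *\<^sub>R (indicator (cbox c d) x *\<^sub>R g x))
            = (\<lambda>x. indicat_real (box a b) x *\<^sub>R (indicat_real (box c d) x *\<^sub>R g x))"
          using ab box_subset_cbox[of c d] by (auto simp: indicator_def fun_eq_iff)
        ultimately show ?thesis by (simp only: set_lebesgue_integral_def)
      qed
    qed (auto simp: indicator_def)
    then show ?thesis by eventually_elim (auto simp: indicator_def)
  qed
  have cbox: "AE x in lebesgue. x \<in> cbox c d \<longrightarrow> g x = 0" if cd: "cbox c d \<subseteq> \<Omega>" for c d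
  proof -
    have "AE x in lebesgue. x \<notin> cbox c d - box c d"
      using negligible_frontier_interval[of c d] by (intro AE_not_in) (simp add: negligible_iff_null_sets)
    with box[OF cd] show ?thesis by eventually_elim auto
  qed
  obtain D where D: "countable D" "D \<subseteq> Pow \<Omega>" "\<And>X. X \<in> D \<Longrightarrow> \<exists>a b. X = cbox a b" "\<Union>D = \<Omega>"
    using open_countable_Union_open_cbox[OF \<Omega>] by metis
  have "AE x in lebesgue. \<forall>X\<in>D. x \<in> X \<longrightarrow> g x = 0"
      proof (subst AE_ball_countable[OF D(1)], rule ballI)
    fix X assume "X \<in> D"
    then obtain a b where "X = cbox a b" "cbox a b \<subseteq> \<Omega>" using D(2,3) by blast
    then show "AE x in lebesgue. x \<in> X \<longrightarrow> g x = 0" using cbox by simp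
  qed
  then show ?thesis by eventually_elim (use D(4) in auto)
qed

lemma locally_integrable_on_diff:
  assumes "locally_integrable_on \<Omega> f" "locally_integrable_on \<Omega> g"
  shows "locally_integrable_on \<Omega> (\<lambda>x. f x - g x)"
  using assms by (auto simp: locally_integrable_on_def intro: set_integral_diff(1))

lemma has_weak_partial_unique:
  assumes "open \<Omega>" "has_weak_partial \<Omega> i u g" "has_weak_partial \<Omega> i u h"
  shows "AE x in lebesgue. x \<in> \<Omega> \<longrightarrow> g x = h x"
proof -
  have gh: "locally_integrable_on \<Omega> g" "locally_integrable_on \<Omega> h"
    using assms by (auto simp: has_weak_partial_def)
  have "AE x in lebesgue. x \<in> \<Omega> \<longrightarrow> g x - h x = 0"
  proof (rule AE_zero_if_test_integrals_zero[OF assms(1)])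
    fix \<phi> :: "'a \<Rightarrow> real" assume t: "test_function \<Omega> \<phi>"
    have "(LINT x:\<Omega>|lebesgue. \<phi> x *\<^sub>R (g x - h x)) = (LINT x:\<Omega>|lebesgue. \<phi> x *\<^sub>R g x) - (LINT x:\<Omega>|lebesgue. \<phi> x *\<^sub>R h x)"
      by (simp add: scaleR_diff_right set_integral_diff(2) set_integrable_test_scaleR[OF t] gh)
    then show "(LINT x:\<Omega>|lebesgue. \<phi> x *\<^sub>R (g x - h x)) = 0"
      using assms t by (auto simp: has_weak_partial_def)
  qed (rule locally_integrable_on_diff[OF gh])
  then show ?thesis by eventually_elim auto
qed

lemma weak_partial_works: "has_weak_partial \<Omega> i u g \<Longrightarrow> has_weak_partial \<Omega> i u (weak_partial \<Omega> i u)"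
  unfolding weak_partial_def by (rule someI[where P="has_weak_partial \<Omega> i u"])

lemma weak_partial_AE_eq:
  assumes "open \<Omega>" "has_weak_partial \<Omega> i u g"
  shows "AE x in lebesgue. x \<in> \<Omega> \<longrightarrow> weak_partial \<Omega> i u x = g x"
  by (rule has_weak_partial_unique[OF assms(1) weak_partial_works[OF assms(2)] assms(2)])

lemma has_weak_partial_diff:
  assumes "has_weak_partial \<Omega> i u g" "has_weak_partial \<Omega> i v h"
  shows "has_weak_partial \<Omega> i (\<lambda>x. u x - v x) (\<lambda>x. g x - h x)"
  unfolding has_weak_partial_def
proof (intro conjI allI impI)
  have loc: "locally_integrable_on \<Omega> u" "locally_integrable_on \<Omega> v" "locally_integrable_on \<Omega> g" "locally_integrable_on \<Omega> h"
    using assms by (auto simp: has_weak_partial_def)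
  then show "locally_integrable_on \<Omega> (\<lambda>x. u x - v x)" "locally_integrable_on \<Omega> (\<lambda>x. g x - h x)"
    by (auto intro: locally_integrable_on_diff)
  fix \<phi> :: "'a \<Rightarrow> real" assume t: "test_function \<Omega> \<phi>"
  show "(LINT x:\<Omega>|lebesgue. frechet_derivative \<phi> (at x) i *\<^sub>R (u x - v x)) = - (LINT x:\<Omega>|lebesgue. \<phi> x *\<^sub>R (g x - h x))"
    using assms t
    by (simp add: scaleR_diff_right set_integral_diff(2) set_integrable_test_scaleR[OF t] loc has_weak_partial_def)
qed

lemma locally_integrable_on_continuous:
  "continuous_on UNIV f \<Longrightarrow> locally_integrable_on \<Omega> f"
proof -
  assume f: "continuous_on UNIV f"
  have "integrable lebesgue (\<lambda>x. indicator K x *\<^sub>R f x)" if "compact K" for K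
  proof -
    have "integrable lborel (\<lambda>x. indicator K x *\<^sub>R f x)"
      using that f by (intro borel_integrable_compact) (auto intro: continuous_on_subset)
    then show ?thesis by (subst integrable_completion) auto
  qed
  then show ?thesis by (simp add: locally_integrable_on_def set_integrable_def)
qed

text \<open>The product of the test function with f has compact support, so its derivative
  integrates to zero over the whole space; both terms vanish outside K, which lies in
  \<Omega>.\<close>

lemma has_weak_partial_C1:
  fixes f :: "'a::euclidean_space \<Rightarrow> 'b::euclidean_space"
  assumes f: "Ck_on (Suc 0) f UNIV" and i: "norm i \<le> 1"
  shows "has_weak_partial \<Omega> i f (\<lambda>x. frechet_derivative f (at x) i)"
  unfolding has_weak_partial_def
proof (intro conjI allI impI)
  note cf = Ck_on_imp_continuous_on[OF f] and cf' = C1_continuous_derivative[OF f open_UNIV, of i]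
  show l: "locally_integrable_on \<Omega> f" "locally_integrable_on \<Omega> (\<lambda>x. frechet_derivative f (at x) i)"
    using cf cf' by (auto intro: locally_integrable_on_continuous)
  fix \<phi> :: "'a \<Rightarrow> real" assume t: "test_function \<Omega> \<phi>"
  obtain K R where K: "K \<subseteq> \<Omega>" "K \<subseteq> cball 0 R" "Ck_on (Suc 0) \<phi> UNIV"
    "\<And>x. x \<notin> K \<Longrightarrow> \<phi> x = 0" "\<And>x h. x \<notin> K \<Longrightarrow> frechet_derivative \<phi> (at x) h = 0"
    using test_function_support[OF t] by metis
  note c\<phi> = Ck_on_imp_continuous_on[OF K(3)] and c\<phi>' = C1_continuous_derivative[OF K(3) open_UNIV, of i]
  have out: "x \<notin> K" if "\<not> norm x \<le> R" for x
    using that K(2) by auto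
  have conv: "(LINT x:\<Omega>|lebesgue. q x *\<^sub>R w x) = (LINT x|lborel. q x *\<^sub>R w x)"
    if "continuous_on UNIV q" "continuous_on UNIV w" "\<And>x. x \<notin> K \<Longrightarrow> q x = 0" for q :: "'a \<Rightarrow> real" and w :: "'a \<Rightarrow> 'b"
  proof -
    have "(LINT x:\<Omega>|lebesgue. q x *\<^sub>R w x) = (LINT x|lebesgue. q x *\<^sub>R w x)"
      unfolding set_lebesgue_integral_def using that K(1)
      by (intro Bochner_Integration.integral_cong) (auto simp: indicator_def)
    also have "\<dots> = (LINT x|lborel. q x *\<^sub>R w x)"
      using that by (intro integral_completion) (auto intro!: borel_measurable_continuous_onI continuous_intros)
    finally show ?thesis .
  qed
  have "(LINT x|lborel. frechet_derivative (\<lambda>x. \<phi> x *\<^sub>R f x) (at x) i) = 0"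
    using K out by (intro integral_derivative_compact_support[where R=R] Ck_on_scaleR f i) auto
  also have "(\<lambda>x. frechet_derivative (\<lambda>x. \<phi> x *\<^sub>R f x) (at x) i)
     = (\<lambda>x. \<phi> x *\<^sub>R frechet_derivative f (at x) i + frechet_derivative \<phi> (at x) i *\<^sub>R f x)"
    by (intro ext frechet_derivative_scaleR_at Ck_on_1_differentiable[OF K(3)] Ck_on_1_differentiable[OF f])
  also have "(LINT x|lborel. \<phi> x *\<^sub>R frechet_derivative f (at x) i + frechet_derivative \<phi> (at x) i *\<^sub>R f x)
      = (LINT x|lborel. \<phi> x *\<^sub>R frechet_derivative f (at x) i) + (LINT x|lborel. frechet_derivative \<phi> (at x) i *\<^sub>R f x)"
    using K out c\<phi> c\<phi>' cf cf'
    by (intro Bochner_Integration.integral_add integrable_continuous_compact_support[where R=R] continuous_intros) auto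
  finally have *: "(LINT x|lborel. frechet_derivative \<phi> (at x) i *\<^sub>R f x) = - (LINT x|lborel. \<phi> x *\<^sub>R frechet_derivative f (at x) i)"
    by (simp add: add_eq_0_iff2)
  then show "(LINT x:\<Omega>|lebesgue. frechet_derivative \<phi> (at x) i *\<^sub>R f x) = - (LINT x:\<Omega>|lebesgue. \<phi> x *\<^sub>R frechet_derivative f (at x) i)"
    using conv[OF c\<phi>' cf K(5)] conv[OF c\<phi> cf' K(4)] by simp
qed

section \<open>Upper bounds for Hausdorff measure\<close>

lemma hausdorff_weight_cball:
  fixes p :: "'a::euclidean_space"
  assumes "0 \<le> r"
  shows "hausdorff_weight k (cball p r) = ennreal (unit_ball_vol (real k) * r ^ k)"
  using assms by (simp add: hausdorff_weight_def)

text \<open>In a disjoint Vitali subfamily the balls outside a large finite part have small total weight, so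
  covering by the finite part and the fivefold enlargements of the rest loses nothing in the limit.\<close>

lemma hausdorff_measure_le_packing:
  fixes S :: "'a::euclidean_space set"
  assumes r0: "\<And>p. p \<in> S \<Longrightarrow> 0 < r0 p"
    and packing: "\<And>C. finite C \<Longrightarrow> (\<And>p r. (p, r) \<in> C \<Longrightarrow> p \<in> S \<and> 0 < r \<and> r < r0 p)
       \<Longrightarrow> pairwise (\<lambda>c d. disjnt (cball (fst c) (snd c)) (cball (fst d) (snd d))) C
       \<Longrightarrow> (\<Sum>c\<in>C. unit_ball_vol (real k) * snd c ^ k) \<le> P"
  shows "hausdorff_measure k S \<le> ennreal P"
  unfolding hausdorff_measure_def
proof (rule SUP_least)
  fix \<delta> :: real assume "\<delta> \<in> {0<..}"
  then have \<delta>: "\<delta> > 0" by simp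
  \<comment> \<open>Radii below \<delta> / 10 keep the fivefold enlargements at diameter at most
    \<delta>, and \<open>r0\<close> restricts to the scales at which the packing bound is
    available.\<close>
  define K where "K = {(p, r). p \<in> S \<and> 0 < r \<and> r < min (r0 p) (\<delta> / 10)}"
  let ?B = "\<lambda>c::'a \<times> real. cball (fst c) (snd c)"
  obtain C where C: "countable C" "C \<subseteq> K" "pairwise (\<lambda>c d. disjnt (?B c) (?B d)) C"
    and vit: "\<And>c. c \<in> K \<Longrightarrow> \<exists>d. d \<in> C \<and> \<not> disjnt (?B c) (?B d) \<and> ?B c \<subseteq> ball (fst d) (5 * snd d)"
  proof (rule Vitali_covering_lemma_cballs_balls[of K snd "\<delta> / 10" fst])
    show "0 < snd c \<and> snd c \<le> \<delta> / 10" if "c \<in> K" for c using that by (auto simp: K_def)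
  qed (rule that)
  define w where "w c = unit_ball_vol (real k) * snd c ^ k" for c :: "'a \<times> real"
  have pos: "0 < snd c" "snd c < \<delta> / 10" if "c \<in> C" for c
    using that C(2) by (auto simp: K_def)
  have w0: "0 \<le> w c" if "c \<in> C" for c using pos[OF that] by (simp add: w_def)
  have le_P: "sum w D \<le> P" if "finite D" "D \<subseteq> C" for D
    unfolding w_def
    by (rule packing[OF that(1)]) (use that C in \<open>auto simp: K_def intro: pairwise_subset\<close>)
  have "hausdorff_premeasure k \<delta> S \<le> ennreal P + ennreal e" if e: "e > 0" for e :: real
  proof -
    define T where "T = {sum w D | D. finite D \<and> D \<subseteq> C}"
    have T: "T \<noteq> {}" "bdd_above T" using le_P by (auto simp: T_def bdd_above_def)
    \<comment> \<open>Enlarging a ball five times multiplies its weight by 5^k, so a tail of this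
      size costs at most e.\<close>
    define \<eta> where "\<eta> = e / 5 ^ k"
    have \<eta>: "\<eta> > 0" using e by (simp add: \<eta>_def)
    then obtain t where "t \<in> T" "Sup T - \<eta> < t" using less_cSupE[of "Sup T - \<eta>" T] T by auto
    then obtain C0 where C0: "finite C0" "C0 \<subseteq> C" "Sup T - \<eta> < sum w C0" by (auto simp: T_def)
    have tail: "sum w D \<le> \<eta>" if "finite D" "D \<subseteq> C - C0" for D
    proof -
      have "sum w (C0 \<union> D) \<le> Sup T"
        using that C0 T by (intro cSup_upper) (auto simp: T_def)
      then show ?thesis using that C0 by (subst (asm) sum.union_disjoint) auto
    qed
    define m where "m c = (if c \<in> C0 then 1 else 5::real)" for c
    define v where "v c = (if c \<in> C0 then w c else 5 ^ k * w c)" for c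
    have v: "sum v D \<le> P + e" if "finite D" "D \<subseteq> C" for D
    proof -
      have "sum v D = sum v (D \<inter> C0) + sum v (D - C0)"
        by (metis sum.Int_Diff that(1))
      also have "sum v (D \<inter> C0) = sum w (D \<inter> C0)" by (auto simp: v_def intro!: sum.cong)
      also have "\<dots> \<le> P" using that by (intro le_P) auto
      also have "sum v (D - C0) = 5 ^ k * sum w (D - C0)"
        by (auto simp: v_def sum_distrib_left intro!: sum.cong)
      also have "\<dots> \<le> 5 ^ k * \<eta>" using that by (intro mult_left_mono tail) auto
      also have "\<dots> = e" by (simp add: \<eta>_def)
      finally show ?thesis by simp
    qed
    let ?i = "to_nat_on C"
    define L where "L j = (if j \<in> ?i ` C then (let c = inv_into C ?i j in cball (fst c) (m c * snd c)) else {})" for j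
    have inj: "inj_on ?i C" using C(1) by (rule inj_on_to_nat_on)
    have L_i: "L (?i c) = cball (fst c) (m c * snd c)" if "c \<in> C" for c
      using that inj by (simp add: L_def inv_into_f_f)
    have sub: "S \<subseteq> (\<Union>j. L j)"
    proof
      fix x assume x: "x \<in> S"
      show "x \<in> (\<Union>j. L j)"
      proof (cases "x \<in> (\<Union>c\<in>C0. ?B c)")
        case True
        then obtain c where "c \<in> C0" "x \<in> ?B c" by auto
        then have "x \<in> L (?i c)" using C0(2) by (subst L_i) (auto simp: m_def)
        then show ?thesis by blast
      next
        case False
        define V where "V = - (\<Union>c\<in>C0. ?B c)"
        have "open V" using C0(1) unfolding V_def by (intro open_Compl closed_UN) auto
        moreover have "x \<in> V" using False by (simp add: V_def)
        ultimately obtain r where r: "r > 0" "cball x r \<subseteq> V"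
          using open_contains_cball by blast
        \<comment> \<open>The ball of radius s around x misses all balls of \<open>C0\<close>, so
          the member of C that it meets lies outside \<open>C0\<close> and covers x by its fivefold
          enlargement.\<close>
        define s where "s = min r (min (r0 x) (\<delta> / 10)) / 2"
        have s: "s > 0" "s \<le> r" "s < min (r0 x) (\<delta> / 10)"
          using r(1) r0[OF x] \<delta> by (auto simp: s_def)
        have "(x, s) \<in> K" using x s by (simp add: K_def)
        from vit[OF this] obtain d where d: "d \<in> C" "\<not> disjnt (cball x s) (?B d)" "cball x s \<subseteq> ball (fst d) (5 * snd d)"
          by auto
        have "d \<notin> C0"
        proof
          assume "d \<in> C0"
          then have "cball x r \<inter> ?B d = {}" using r(2) unfolding V_def by blast
          then show False using d(2) subset_cball[OF s(2), of x] unfolding disjnt_def by blast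
        qed
        moreover have "x \<in> cball (fst d) (5 * snd d)" using d(3) s(1) by (auto dest!: subsetD[of _ _ x])
        ultimately have "x \<in> L (?i d)" using d(1) by (subst L_i) (auto simp: m_def)
        then show ?thesis by blast
      qed
    qed
    have diam: "bounded (L j) \<and> diameter (L j) \<le> \<delta>" for j
    proof (cases "j \<in> ?i ` C")
      case True
      then obtain c where c: "c \<in> C" "j = ?i c" by auto
      have "0 \<le> m c * snd c" "2 * (m c * snd c) \<le> \<delta>" using pos[OF c(1)] by (auto simp: m_def)
      then show ?thesis using c by (simp add: L_i)
    qed (use \<delta> in \<open>simp add: L_def diameter_empty\<close>)
    have wt: "hausdorff_weight k (L j) = ennreal (if j \<in> ?i ` C then v (inv_into C ?i j) else 0)" for j
    proof (cases "j \<in> ?i ` C")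
      case True
      then obtain c where c: "c \<in> C" "j = ?i c" by auto
      then show ?thesis
        using pos[OF c(1)] inj by (simp add: L_i hausdorff_weight_cball m_def v_def w_def power_mult_distrib mult_ac)
    qed (simp add: L_def hausdorff_weight_def)
    have sum_le: "(\<Sum>j. hausdorff_weight k (L j)) \<le> ennreal (P + e)"
      unfolding suminf_eq_SUP
    proof (rule SUP_least)
      fix n :: nat
      let ?J = "{..<n} \<inter> ?i ` C"
      have v0: "0 \<le> v c" if "c \<in> C" for c using w0[OF that] by (simp add: v_def)
      have "(\<Sum>j<n. hausdorff_weight k (L j)) = ennreal (\<Sum>j<n. if j \<in> ?i ` C then v (inv_into C ?i j) else 0)"
        unfolding wt by (intro sum_ennreal) (auto intro!: v0 inv_into_into)
      also have "(\<Sum>j<n. if j \<in> ?i ` C then v (inv_into C ?i j) else 0) = (\<Sum>j\<in>?J. v (inv_into C ?i j))"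
        by (subst sum.inter_restrict) auto
      also have "\<dots> = sum v (inv_into C ?i ` ?J)"
        by (subst sum.reindex) (auto intro: inj_on_inv_into inj_on_subset)
      also have "\<dots> \<le> P + e" proof (rule v)
        show "inv_into C ?i ` ?J \<subseteq> C" by (intro image_subsetI inv_into_into) simp
      qed simp
      finally show "(\<Sum>j<n. hausdorff_weight k (L j)) \<le> ennreal (P + e)" by (simp add: ennreal_leI)
    qed
    have "hausdorff_premeasure k \<delta> S \<le> (\<Sum>j. hausdorff_weight k (L j))"
      unfolding hausdorff_premeasure_def by (rule INF_lower) (use sub diam in blast)
    also have "\<dots> \<le> ennreal (P + e)" by (rule sum_le)
    finally have "hausdorff_premeasure k \<delta> S \<le> ennreal (P + e)" .
    moreover have "P \<ge> 0" using le_P[of "{}"] by simp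
    ultimately show ?thesis using e by (simp only: ennreal_plus less_imp_le)
  qed
  then show "hausdorff_premeasure k \<delta> S \<le> ennreal P"
    by (rule ennreal_le_epsilon)
qed

text \<open>Rotation invariance of Lebesgue measure: an isometry preserves the measure of balls, hence by the
  Vitali covering theorem the measure of open sets.\<close>

lemma emeasure_lborel_involutive_isometry_open:
  fixes T :: "'a::euclidean_space \<Rightarrow> 'a"
  assumes T: "linear T" "\<And>x. T (T x) = x" "\<And>x. norm (T x) = norm x" and U: "open U"
  shows "emeasure lborel (T -` U) = emeasure lborel U"
proof -
  have cT: "continuous_on UNIV T" using T(1) by (simp add: linear_continuous_on linear_conv_bounded_linear)
  have op: "open (T -` V)" if "open V" for V
    using cT that by (simp add: open_vimage)
  \<comment> \<open>Since T is its own inverse, one inequality for all open sets is enough: it is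
    used for U and for the preimage of U.\<close>
  have ge: "emeasure lborel V \<le> emeasure lborel (T -` V)" if V: "open V" for V
  proof -
    define K where "K = {(p, r). ball p r \<subseteq> V \<and> 0 < r}"
    let ?B = "\<lambda>c::'a \<times> real. ball (fst c) (snd c)"
    obtain C where C: "countable C" "C \<subseteq> K" "pairwise (\<lambda>c d. disjnt (?B c) (?B d)) C"
      "negligible (V - (\<Union>c\<in>C. ?B c))"
    proof (rule Vitali_covering_theorem_balls[of V K fst snd])
      fix x d assume x: "x \<in> V" and d: "0 < (d::real)"
      obtain e where e: "e > 0" "ball x e \<subseteq> V" using V x open_contains_ball by blast
      show "\<exists>i. i \<in> K \<and> x \<in> ball (fst i) (snd i) \<and> snd i < d"
        by (rule exI[of _ "(x, min e (d / 2))"]) (use e d in \<open>auto simp: K_def\<close>)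
    qed
    have TB: "T -` ball p r = ball (T p) r" for p r
    proof -
      have "dist p (T x) = dist (T p) x" for x
        using T by (metis dist_norm linear_diff)
      then show ?thesis by auto
    qed
    have CV: "?B c \<subseteq> V" "0 < snd c" if "c \<in> C" for c
      using subsetD[OF C(2) that] by (auto simp: K_def)
    have dB: "disjoint_family_on ?B C"
      using C(3) by (simp add: disjoint_family_on_def pairwise_def disjnt_def)
    then have dTB: "disjoint_family_on (\<lambda>c. T -` ?B c) C"
      by (simp add: disjoint_family_on_def vimage_Int[symmetric])
    have "emeasure lborel V = emeasure lebesgue V" using V by simp
    also have "\<dots> = emeasure lebesgue (\<Union>c\<in>C. ?B c)"
    proof (rule emeasure_eq_AE)
      have "AE x in lebesgue. x \<notin> V - (\<Union>c\<in>C. ?B c)"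
        using C(4) by (intro AE_not_in) (simp add: negligible_iff_null_sets)
      then show "AE x in lebesgue. x \<in> V \<longleftrightarrow> x \<in> (\<Union>c\<in>C. ?B c)"
        by eventually_elim (use CV in blast)
    qed (use V in \<open>auto intro!: open_sets_lebesgue\<close>)
    also have "\<dots> = emeasure lborel (\<Union>c\<in>C. ?B c)"
      by (simp add: borel_open open_UN)
    also have "\<dots> = (\<integral>\<^sup>+c. emeasure lborel (?B c) \<partial>count_space C)"
      using C dB by (intro emeasure_UN_countable) auto
    also have "\<dots> = (\<integral>\<^sup>+c. emeasure lborel (T -` ?B c) \<partial>count_space C)"
      using CV(2) by (intro nn_integral_cong) (auto simp: TB emeasure_ball less_imp_le)
    also have "\<dots> = emeasure lborel (\<Union>c\<in>C. T -` ?B c)"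
      using C(1) dTB by (intro emeasure_UN_countable[symmetric]) (auto simp: TB)
    also have "\<dots> \<le> emeasure lborel (T -` V)"
      by (intro emeasure_mono UN_least vimage_mono CV(1)) (auto simp: op V)
    finally show ?thesis .
  qed
  have "T -` T -` U = U" using T(2) by auto
  with ge[OF U] ge[OF op[OF U]] show ?thesis by simp
qed

lemma lborel_distr_involutive_isometry:
  fixes T :: "'a::euclidean_space \<Rightarrow> 'a"
  assumes T: "linear T" "\<And>x. T (T x) = x" "\<And>x. norm (T x) = norm x"
  shows "distr lborel borel T = lborel"
proof (rule lborel_eqI[symmetric])
  have [measurable]: "T \<in> borel_measurable borel"
    using T(1) by (intro borel_measurable_continuous_onI) (simp add: linear_continuous_on linear_conv_bounded_linear)
  fix l u :: 'a assume lu: "\<And>b. b \<in> Basis \<Longrightarrow> l \<bullet> b \<le> u \<bullet> b"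
  have "emeasure (distr lborel borel T) (box l u) = emeasure lborel (box l u)"
    using emeasure_lborel_involutive_isometry_open[OF T open_box] by (subst emeasure_distr) auto
  then show "emeasure (distr lborel borel T) (box l u) = (\<Prod>b\<in>Basis. (u - l) \<bullet> b)"
    using lu by simp
qed simp

section \<open>Volume of solid cylinders in an arbitrary direction\<close>

text \<open>For a unit vector e the difference in the last condition is the squared norm of the
  component of y orthogonal to e. The set is a cylinder over a disc of radius R, half-open in the
  axis direction, so that it is contained in the difference of the half-spaces y \<bullet> e < h and
  y \<bullet> e < 0.\<close>

definition cylinder :: "'a::euclidean_space \<Rightarrow> real \<Rightarrow> real \<Rightarrow> 'a set" where
  "cylinder e h R = {y. 0 \<le> y \<bullet> e \<and> y \<bullet> e < h \<and> y \<bullet> y - (y \<bullet> e)\<^sup>2 \<le> R\<^sup>2}"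

lemma sets_cylinder [measurable]: "cylinder e h R \<in> sets borel"
  unfolding cylinder_def by measurable

text \<open>Fubini splits off the coordinate b. The remaining slice is a ball in the coordinates
  \<open>Basis - {b}\<close>, whose volume \<open>emeasure_cball_aux\<close> gives for an index set
  of coordinates, so that no type of dimension one less is involved.\<close>

lemma emeasure_cylinder_Basis:
  fixes b :: "'a::euclidean_space"
  assumes b: "b \<in> Basis" and h: "h > 0" and R: "R > 0"
  shows "emeasure lborel (cylinder b h R) = ennreal (h * (unit_ball_vol (real (DIM('a) - 1)) * R ^ (DIM('a) - 1)))"
proof -
  interpret product_sigma_finite "\<lambda>_::'a. lborel :: real measure" by standard
  let ?I = "Basis - {b}"
  let ?M = "Pi\<^sub>M ?I (\<lambda>_. lborel :: real measure)"
  let ?f = "\<lambda>f. \<Sum>c\<in>Basis. f c *\<^sub>R c :: 'a"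
  let ?D = "{f. sqrt (\<Sum>i\<in>?I. (f i)\<^sup>2) \<le> R} \<inter> space ?M"
  have ins: "insert b ?I = Basis" using b by auto
  have fb: "?f f \<bullet> i = f i" if "i \<in> Basis" for f i
    using that by (simp add: inner_sum_left inner_Basis if_distrib sum.delta cong: if_cong)
  have mem: "?f f \<in> cylinder b h R \<longleftrightarrow> f b \<in> {0..<h} \<and> sqrt (\<Sum>i\<in>?I. (f i)\<^sup>2) \<le> R" for f
  proof -
    have "?f f \<bullet> ?f f = (\<Sum>i\<in>Basis. (f i)\<^sup>2)"
      by (subst euclidean_inner) (auto simp: fb power2_eq_square intro!: sum.cong)
    also have "\<dots> = (f b)\<^sup>2 + (\<Sum>i\<in>?I. (f i)\<^sup>2)" using b by (simp add: sum.remove)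
    finally show ?thesis
      using R b by (simp add: cylinder_def fb real_sqrt_le_iff' real_le_lsqrt sum_nonneg sqrt_le_D)
  qed
  have [measurable]: "?f \<in> borel_measurable (Pi\<^sub>M Basis (\<lambda>_. lborel))" by measurable
  have "emeasure lborel (cylinder b h R)
      = emeasure (distr (Pi\<^sub>M Basis (\<lambda>_. lborel)) borel ?f) (cylinder b h R)"
    by (simp add: lborel_eq[symmetric])
  also have "\<dots> = emeasure (Pi\<^sub>M (insert b ?I) (\<lambda>_. lborel)) (?f -` cylinder b h R \<inter> space (Pi\<^sub>M (insert b ?I) (\<lambda>_. lborel)))"
    by (subst emeasure_distr) (auto simp: insert_absorb[OF b])
  also have "\<dots> = (\<integral>\<^sup>+x. indicator (?f -` cylinder b h R \<inter> space (Pi\<^sub>M (insert b ?I) (\<lambda>_. lborel))) x \<partial>Pi\<^sub>M (insert b ?I) (\<lambda>_. lborel))"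
    by (subst nn_integral_indicator) (auto simp: insert_absorb[OF b])
  also have "\<dots> = (\<integral>\<^sup>+y. \<integral>\<^sup>+x. indicator (?f -` cylinder b h R \<inter> space (Pi\<^sub>M (insert b ?I) (\<lambda>_. lborel))) (x(b := y)) \<partial>?M \<partial>lborel)"
    by (subst product_nn_integral_insert_rev) (auto simp: insert_absorb[OF b])
  also have "\<dots> = (\<integral>\<^sup>+y. \<integral>\<^sup>+x. indicator {0..<h} y * indicator ?D x \<partial>?M \<partial>lborel)"
  proof (intro nn_integral_cong)
    fix y :: real and x assume x: "x \<in> space ?M"
    have "(\<Sum>i\<in>?I. ((x(b := y)) i)\<^sup>2) = (\<Sum>i\<in>?I. (x i)\<^sup>2)" by (intro sum.cong) auto
    moreover have "x(b := y) \<in> space (Pi\<^sub>M (insert b ?I) (\<lambda>_. lborel))"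
      using x by (auto simp: space_PiM PiE_def extensional_def)
    ultimately show "indicator (?f -` cylinder b h R \<inter> space (Pi\<^sub>M (insert b ?I) (\<lambda>_. lborel))) (x(b := y))
        = (indicator {0..<h} y * indicator ?D x :: ennreal)"
      using x by (simp add: indicator_def mem)
  qed
  also have "\<dots> = (\<integral>\<^sup>+y. indicator {0..<h} y * emeasure ?M ?D \<partial>lborel)"
    by (intro nn_integral_cong) (simp add: nn_integral_cmult)
  also have "\<dots> = ennreal h * emeasure ?M ?D"
    using h by (simp add: nn_integral_multc)
  also have "emeasure ?M ?D = ennreal (unit_ball_vol (real (card ?I)) * R ^ card ?I)"
    using R by (intro emeasure_cball_aux) auto
  also have "card ?I = DIM('a) - 1" using b by simp
  finally show ?thesis using h R by (simp add: ennreal_mult)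
qed

text \<open>The Householder reflection exchanging \<open>e\<close> and a basis vector reduces to the previous case.\<close>

lemma emeasure_cylinder:
  fixes e :: "'a::euclidean_space"
  assumes e: "norm e = 1" and h: "h > 0" and R: "R > 0"
  shows "emeasure lborel (cylinder e h R) = ennreal (h * (unit_ball_vol (real (DIM('a) - 1)) * R ^ (DIM('a) - 1)))"
proof -
  obtain b :: 'a where b: "b \<in> Basis" using nonempty_Basis by blast
  show ?thesis
  proof (cases "e = b")
    case True
    then show ?thesis using emeasure_cylinder_Basis[OF b h R] by simp
  next
    case False
    define w where "w = e - b"
    have ww: "w \<bullet> w > 0" using False by (simp add: w_def)
    have ee: "e \<bullet> e = 1" and bb: "b \<bullet> b = 1"
      using e b by (auto simp: norm_eq_1)
    define T where "T y = y - (2 * (y \<bullet> w) / (w \<bullet> w)) *\<^sub>R w" for y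
    have lin: "linear T"
      unfolding T_def by (intro linearI) (auto simp: inner_add_left algebra_simps add_divide_distrib)
    have Tw: "T y \<bullet> w = - (y \<bullet> w)" for y using ww by (simp add: T_def inner_diff_left)
    have TT: "T (T y) = y" for y
      using Tw[of y] by (subst T_def) (simp add: T_def)
    have inn: "T y \<bullet> T y = y \<bullet> y" for y
    proof -
      have "T y \<bullet> T y = T y \<bullet> y - (2 * (y \<bullet> w) / (w \<bullet> w)) * (T y \<bullet> w)"
        by (subst (2) T_def) (simp add: inner_diff_right)
      also have "\<dots> = y \<bullet> y - (2 * (y \<bullet> w) / (w \<bullet> w)) * (w \<bullet> y) - (2 * (y \<bullet> w) / (w \<bullet> w)) * (- (y \<bullet> w))"
        unfolding Tw by (simp add: T_def inner_diff_left)
      finally show ?thesis by (simp add: inner_commute)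
    qed
    have norm: "norm (T y) = norm y" for y by (simp add: norm_eq_sqrt_inner inn)
    have Te: "T e = b"
    proof -
      \<comment> \<open>As e and b are unit vectors, the coefficient of w in the reflection of e is
        exactly 1, and e - w = b.\<close>
      have "w \<bullet> w = 2 * (e \<bullet> w)" using ee bb by (simp add: w_def inner_diff inner_commute)
      then show ?thesis using ww by (simp add: T_def) (simp add: w_def)
    qed
    have "T y \<bullet> b = y \<bullet> e" for y
    proof -
      have sym: "T y \<bullet> x = y \<bullet> T x" for x y
        by (simp add: T_def inner_diff inner_commute)
      show ?thesis using sym[of y b] Te TT[of e] by simp
    qed
    then have "T -` cylinder b h R = cylinder e h R"
      by (auto simp: cylinder_def inn)
    moreover have [measurable]: "T \<in> borel_measurable borel"
      using lin by (intro borel_measurable_continuous_onI) (simp add: linear_continuous_on linear_conv_bounded_linear)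
    have "emeasure (distr lborel borel T) (cylinder b h R) = emeasure lborel (T -` cylinder b h R)"
      by (subst emeasure_distr) auto
    ultimately show ?thesis
      using emeasure_cylinder_Basis[OF b h R] lborel_distr_involutive_isometry[OF lin TT norm] by simp
  qed
qed

section \<open>Flux of a vector field through the boundary\<close>

text \<open>U and the complement of K are open, cover the space, and carry compatible definitions.
  This makes global functions out of objects known only in a chart, once they are multiplied by a
  cutoff.\<close>

lemma Ck_on_extend_zero:
  assumes "open U" "closed K" "K \<subseteq> U" "Ck_on k f U" "\<And>x. x \<in> U - K \<Longrightarrow> f x = 0"
  shows "Ck_on k (\<lambda>x. if x \<in> U then f x else 0) UNIV"
proof -
  have "Ck_on k (\<lambda>x. if x \<in> U then f x else 0) (U \<union> - K)"
  proof (rule Ck_on_open_Un)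
    show "Ck_on k (\<lambda>x. if x \<in> U then f x else 0) U"
      by (rule Ck_on_cong[OF assms(1) _ assms(4)]) simp
    show "Ck_on k (\<lambda>x. if x \<in> U then f x else 0) (- K)"
      by (rule Ck_on_cong[OF _ _ Ck_on_const[of _ k 0]]) (use assms in auto)
  qed (use assms in auto)
  moreover have "U \<union> - K = UNIV" using assms(3) by auto
  ultimately show ?thesis by simp
qed

lemma frechet_derivative_eq_gradient:
  assumes "f differentiable at x"
  shows "frechet_derivative f (at x) v = gradient f x \<bullet> v"
proof -
  have lin: "linear (frechet_derivative f (at x))"
    using assms by (simp add: linear_frechet_derivative)
  have "frechet_derivative f (at x) v = (\<Sum>i\<in>Basis. (v \<bullet> i) *\<^sub>R frechet_derivative f (at x) i)"
    by (subst euclidean_representation[of v, symmetric])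
      (simp only: linear_sum[OF lin] linear_scale[OF lin])
  also have "\<dots> = gradient f x \<bullet> v"
    by (simp add: gradient_def inner_sum_left inner_commute[of v] mult.commute)
  finally show ?thesis .
qed

section \<open>Divergence, and flux as a volume integral\<close>

definition divergence :: "('a::euclidean_space \<Rightarrow> 'a) \<Rightarrow> 'a \<Rightarrow> real" where
  "divergence X x = (\<Sum>i\<in>Basis. frechet_derivative X (at x) i \<bullet> i)"

definition C1_field :: "('a::euclidean_space \<Rightarrow> 'a) \<Rightarrow> real \<Rightarrow> bool" where
  "C1_field X R \<longleftrightarrow> Ck_on (Suc 0) X UNIV \<and> (\<forall>x. x \<notin> cball 0 R \<longrightarrow> X x = 0)"

lemma C1_fieldD:
  assumes "C1_field X R"
  shows "Ck_on (Suc 0) X UNIV" "\<And>x. x \<notin> cball 0 R \<Longrightarrow> X x = 0"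
  using assms by (auto simp: C1_field_def)

lemma C1_field_scaleR: "Ck_on (Suc 0) \<zeta> UNIV \<Longrightarrow> C1_field X R \<Longrightarrow> C1_field (\<lambda>x. \<zeta> x *\<^sub>R X x) R"
  by (auto simp: C1_field_def intro!: Ck_on_scaleR)

lemma divergence_scaleR:
  assumes "Ck_on (Suc 0) \<zeta> UNIV" "Ck_on (Suc 0) X UNIV"
  shows "divergence (\<lambda>x. \<zeta> x *\<^sub>R X x) x = \<zeta> x * divergence X x + frechet_derivative \<zeta> (at x) (X x)"
proof -
  note d = Ck_on_1_differentiable[OF assms(1)] Ck_on_1_differentiable[OF assms(2)]
  have "divergence (\<lambda>x. \<zeta> x *\<^sub>R X x) x
      = \<zeta> x * divergence X x + (\<Sum>i\<in>Basis. frechet_derivative \<zeta> (at x) i * (X x \<bullet> i))"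
    by (simp add: divergence_def frechet_derivative_scaleR_at d inner_add_left sum.distrib sum_distrib_left)
  also have "(\<Sum>i\<in>Basis. frechet_derivative \<zeta> (at x) i * (X x \<bullet> i)) = frechet_derivative \<zeta> (at x) (X x)"
    by (simp add: frechet_derivative_eq_gradient[OF d(1), where v="X x"] gradient_def inner_sum_left inner_commute[of "X x"])
  finally show ?thesis .
qed

lemma continuous_on_divergence: "C1_field X R \<Longrightarrow> continuous_on UNIV (divergence X)"
  unfolding divergence_def[abs_def]
  by (intro continuous_intros C1_continuous_derivative) (auto dest: C1_fieldD)

lemma divergence_outside: "C1_field X R \<Longrightarrow> x \<notin> cball 0 R \<Longrightarrow> divergence X x = 0"
  unfolding divergence_def C1_field_def
  by (intro sum.neutral ballI) (metis frechet_derivative_zero_outside inner_zero_left)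

lemma divergence_zero_open:
  assumes "open S" "x \<in> S" "\<And>y. y \<in> S \<Longrightarrow> X y = 0"
  shows "divergence X x = 0"
  unfolding divergence_def using frechet_derivative_zero_open[OF assms] by simp

lemma integrable_divergence: "C1_field X R \<Longrightarrow> integrable lborel (divergence X)"
  by (rule integrable_continuous_compact_support[OF continuous_on_divergence divergence_outside])

lemma integral_divergence_zero:
  assumes X: "C1_field X R"
  shows "(LINT x|lborel. divergence X x) = 0"
proof -
  have int: "integrable lborel (\<lambda>x. frechet_derivative X (at x) i)" for i
    by (rule integrable_continuous_compact_support[OF C1_continuous_derivative[OF C1_fieldD(1)[OF X] open_UNIV]
        frechet_derivative_zero_outside[OF C1_fieldD(2)[OF X]]])
  have "(LINT x|lborel. divergence X x) = (\<Sum>i\<in>Basis. (LINT x|lborel. frechet_derivative X (at x) i) \<bullet> i)"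
    unfolding divergence_def using int by (subst Bochner_Integration.integral_sum) auto
  also have "\<dots> = 0"
    using integral_derivative_compact_support[OF C1_fieldD[OF X]] by simp
  finally show ?thesis .
qed

text \<open>By the divergence theorem this is the boundary integral of \<zeta> times the normal
  component of X; for X equal to the outer normal on the boundary it acts as integration of \<zeta>
  against surface area. The volume form is taken as the definition.\<close>

definition flux :: "'a::euclidean_space set \<Rightarrow> ('a \<Rightarrow> 'a) \<Rightarrow> ('a \<Rightarrow> real) \<Rightarrow> real" where
  "flux \<Omega> X \<zeta> = (LINT x|lborel. indicator \<Omega> x * divergence (\<lambda>x. \<zeta> x *\<^sub>R X x) x)"

lemma integrable_flux:
  assumes "C1_field X R" "open \<Omega>" "Ck_on (Suc 0) \<zeta> UNIV"
  shows "integrable lborel (\<lambda>x. indicator \<Omega> x * divergence (\<lambda>x. \<zeta> x *\<^sub>R X x) x)"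
  using integrable_mult_indicator[OF _ integrable_divergence[OF C1_field_scaleR[OF assms(3,1)]], of \<Omega>] assms(2)
  by simp

lemma flux_add:
  assumes X: "C1_field X R" "open \<Omega>" and \<zeta>: "Ck_on (Suc 0) \<zeta> UNIV" "Ck_on (Suc 0) \<xi> UNIV"
  shows "flux \<Omega> X (\<lambda>x. \<zeta> x + \<xi> x) = flux \<Omega> X \<zeta> + flux \<Omega> X \<xi>"
proof -
  have *: "divergence (\<lambda>x. (\<zeta> x + \<xi> x) *\<^sub>R X x) x = divergence (\<lambda>x. \<zeta> x *\<^sub>R X x) x + divergence (\<lambda>x. \<xi> x *\<^sub>R X x) x" for x
  proof -
    have d: "\<zeta> differentiable at x" "\<xi> differentiable at x" "\<And>x. (\<lambda>x. \<zeta> x *\<^sub>R X x) differentiable at x"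
        "\<And>x. (\<lambda>x. \<xi> x *\<^sub>R X x) differentiable at x"
      using \<zeta> Ck_on_scaleR[OF open_UNIV _ C1_fieldD(1)[OF X(1)]] by (auto intro: Ck_on_1_differentiable)
    have "((\<lambda>x. \<zeta> x *\<^sub>R X x + \<xi> x *\<^sub>R X x) has_derivative (\<lambda>h. frechet_derivative (\<lambda>x. \<zeta> x *\<^sub>R X x) (at x) h
         + frechet_derivative (\<lambda>x. \<xi> x *\<^sub>R X x) (at x) h)) (at x)"
      by (intro has_derivative_add) (use d in \<open>simp_all add: frechet_derivative_works[symmetric]\<close>)
    from fun_cong[OF frechet_derivative_at[OF this, symmetric]] show ?thesis
      by (simp add: divergence_def scaleR_add_left inner_add_left sum.distrib)
  qed
  show ?thesis
    unfolding flux_def * by (simp add: distrib_left integrable_flux[OF X] \<zeta>)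
qed

lemma flux_zero: "flux \<Omega> (X :: 'a::euclidean_space \<Rightarrow> 'a) (\<lambda>x. 0) = 0"
proof -
  have "divergence (\<lambda>x. 0) x = 0" for x :: 'a
    by (rule divergence_zero_open[of UNIV]) auto
  then show ?thesis by (simp add: flux_def)
qed

lemma flux_sum:
  assumes X: "C1_field X R" "open \<Omega>" and "finite I" "\<And>i. i \<in> I \<Longrightarrow> Ck_on (Suc 0) (\<zeta> i) UNIV"
  shows "flux \<Omega> X (\<lambda>x. \<Sum>i\<in>I. \<zeta> i x) = (\<Sum>i\<in>I. flux \<Omega> X (\<zeta> i))"
  using assms(3,4)
  by (induction I) (simp_all add: flux_zero flux_add[OF X] Ck_on_sum)

lemma smoothstep_derivative_nonneg: "0 \<le> frechet_derivative smoothstep (at t) 1"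
  and smoothstep_has_derivative: "(smoothstep has_derivative (\<lambda>h. h * frechet_derivative smoothstep (at t) 1)) (at t)"
proof -
  let ?D = "frechet_derivative smoothstep (at t)"
  have D: "(smoothstep has_derivative ?D) (at t)"
    using Ck_on_Suc_has_derivative[OF Ck_on_smoothstep[of "Suc 0"]] by simp
  have "?D h = h * ?D 1" for h
    using linear_scale[OF has_derivative_linear[OF D], of h 1] by simp
  then have "?D = (\<lambda>h. h * ?D 1)" by blast
  with D show D': "(smoothstep has_derivative (\<lambda>h. h * ?D 1)) (at t)" by metis
  then have "(smoothstep has_real_derivative ?D 1) (at t)"
    by (simp add: has_field_derivative_def mult_commute_abs)
  then show "0 \<le> ?D 1"
    by (rule mono_on_imp_deriv_nonneg[rotated, where A=UNIV]) (auto intro: mono_onI smoothstep_mono)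
qed

text \<open>The indicator of \<Omega> is approximated by \<open>smoothstep\<close> of -k \<rho>. The
  divergence of the resulting compactly supported field integrates to zero, and the term in which
  the approximation is differentiated is nonpositive because X does not point inwards. What remains
  is therefore nonnegative and converges to the flux.\<close>

lemma flux_nonneg_chart:
  fixes \<rho> :: "'a::euclidean_space \<Rightarrow> real"
  assumes X: "C1_field X R" and \<Omega>: "open \<Omega>" "open U" "\<Omega> \<inter> U = {x\<in>U. \<rho> x < 0}"
    and \<rho>: "Ck_on (Suc 0) \<rho> U" "\<And>x. x \<in> cball p r \<Longrightarrow> 0 \<le> frechet_derivative \<rho> (at x) (X x)"
    and p: "cball p r \<subseteq> U"
    and \<zeta>: "Ck_on (Suc 0) \<zeta> UNIV" "\<And>x. 0 \<le> \<zeta> x" "\<And>x. x \<notin> cball p r \<Longrightarrow> \<zeta> x = 0"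
  shows "0 \<le> flux \<Omega> X \<zeta>"
proof -
  let ?s = "\<lambda>k x. smoothstep (- real k * \<rho> x)"
  let ?Z = "divergence (\<lambda>x. \<zeta> x *\<^sub>R X x)"
  define \<psi> where "\<psi> k x = (if x \<in> U then ?s k x * \<zeta> x else 0)" for k x
  have s1: "Ck_on (Suc 0) (?s k) U" for k
    by (intro Ck_on_smoothstep_compose Ck_on_mult \<Omega> \<rho> Ck_on_const)
  have \<psi>1: "Ck_on (Suc 0) (\<psi> k) UNIV" for k
    unfolding \<psi>_def
    by (rule Ck_on_extend_zero[OF \<Omega>(2) closed_cball p])
      (use s1 \<zeta> \<Omega> in \<open>auto intro!: Ck_on_mult intro: Ck_on_subset\<close>)
  note ZF = C1_field_scaleR[OF \<zeta>(1) X]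
  have out: "?Z x = 0" "divergence (\<lambda>x. \<psi> k x *\<^sub>R X x) x = 0" if "x \<notin> cball p r" for x k
    using that by (auto intro!: divergence_zero_open[of "- cball p r"] simp: open_Compl \<psi>_def \<zeta>(3))
  have le: "divergence (\<lambda>x. \<psi> k x *\<^sub>R X x) x \<le> indicator U x * ?s k x * ?Z x" for k x
  proof (cases "x \<in> cball p r")
    case True
    then have xU: "x \<in> U" using p by auto
    then have \<psi>x: "\<psi> k x = ?s k x * \<zeta> x" by (simp add: \<psi>_def)
    let ?r = "frechet_derivative \<rho> (at x) (X x)" and ?t = "frechet_derivative smoothstep (at (- real k * \<rho> x)) 1"
    have D\<rho>: "(\<rho> has_derivative frechet_derivative \<rho> (at x)) (at x)"
      using Ck_on_Suc_has_derivative[OF \<rho>(1) \<Omega>(2) xU] .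
    have "((\<lambda>x. - real k * \<rho> x) has_derivative (\<lambda>h. - real k * frechet_derivative \<rho> (at x) h)) (at x)"
      by (intro has_derivative_mult_right D\<rho>)
    from has_derivative_compose[OF this smoothstep_has_derivative]
    have Ds: "(?s k has_derivative (\<lambda>h. - real k * frechet_derivative \<rho> (at x) h * ?t)) (at x)" .
    have D\<zeta>: "(\<zeta> has_derivative frechet_derivative \<zeta> (at x)) (at x)"
      using Ck_on_Suc_has_derivative[OF \<zeta>(1)] by simp
    have "((\<lambda>x. ?s k x * \<zeta> x) has_derivative
        (\<lambda>h. ?s k x * frechet_derivative \<zeta> (at x) h + - real k * frechet_derivative \<rho> (at x) h * ?t * \<zeta> x)) (at x)"
      by (rule has_derivative_mult[OF Ds D\<zeta>])
    then have "(\<psi> k has_derivative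
        (\<lambda>h. ?s k x * frechet_derivative \<zeta> (at x) h + - real k * frechet_derivative \<rho> (at x) h * ?t * \<zeta> x)) (at x)"
      by (rule has_derivative_transform_within_open[OF _ \<Omega>(2) xU]) (simp add: \<psi>_def)
    from fun_cong[OF frechet_derivative_at[OF this], of "X x"]
    have "divergence (\<lambda>x. \<psi> k x *\<^sub>R X x) x = ?s k x * ?Z x - real k * ?r * ?t * \<zeta> x"
      using \<psi>x by (simp add: divergence_scaleR[OF \<psi>1 C1_fieldD(1)[OF X]] divergence_scaleR[OF \<zeta>(1) C1_fieldD(1)[OF X]]
          algebra_simps)
    moreover have "0 \<le> real k * ?r * ?t * \<zeta> x"
      using \<rho>(2)[OF True] smoothstep_derivative_nonneg \<zeta>(2) by (intro mult_nonneg_nonneg) auto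
    ultimately show ?thesis using xU by simp
  qed (simp add: out)
  have lim: "(\<lambda>k. LINT x|lborel. indicator U x * ?s k x * ?Z x) \<longlonglongrightarrow> flux \<Omega> X \<zeta>"
    unfolding flux_def
  proof (rule integral_dominated_convergence[OF _ _ integrable_norm[OF integrable_divergence[OF ZF]]])
    note [measurable] = borel_measurable_integrable[OF integrable_divergence[OF ZF]]
    have [measurable]: "(\<lambda>x. indicator U x * ?s k x) \<in> borel_measurable borel" for k
      using borel_measurable_continuous_on_indicator[OF _ Ck_on_imp_continuous_on[OF s1[of k]]] \<Omega>(2) by simp
    show "(\<lambda>x. indicator U x * ?s k x * ?Z x) \<in> borel_measurable lborel" for k by measurable
    have [measurable]: "\<Omega> \<in> sets borel" using \<Omega>(1) by simp
    show "(\<lambda>x. indicator \<Omega> x * ?Z x) \<in> borel_measurable lborel" by measurable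
    show "AE x in lborel. (\<lambda>k. indicator U x * ?s k x * ?Z x) \<longlonglongrightarrow> indicator \<Omega> x * ?Z x"
    proof (rule AE_I2)
      fix x
      show "(\<lambda>k. indicator U x * ?s k x * ?Z x) \<longlonglongrightarrow> indicator \<Omega> x * ?Z x"
      proof (cases "x \<in> U")
        case True
        then have xO: "x \<in> \<Omega> \<longleftrightarrow> \<rho> x < 0" using \<Omega>(3) by auto
        show ?thesis
        proof (cases "\<rho> x < 0")
          case True
          then have "\<forall>\<^sub>F k in sequentially. ?s k x = 1"
            using eventually_smoothstep_mult[of "- \<rho> x"] by simp
          then have "(\<lambda>k. ?s k x) \<longlonglongrightarrow> 1" by (rule tendsto_eventually)
          then show ?thesis using \<open>x \<in> U\<close> True xO by (auto intro!: tendsto_eq_intros)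
        next
          case False
          \<comment> \<open>This includes \<rho> x = 0: \<open>smoothstep\<close> vanishes at 0,
            matching the strict inequality that describes \<Omega>.\<close>
          then have "?s k x = 0" for k by (intro smoothstep_le_0) (simp add: mult_nonneg_nonneg)
          then show ?thesis using False xO by simp
        qed
      next
        case False
        then have "x \<notin> cball p r" using p by blast
        then show ?thesis using out(1)[of x] by simp
      qed
    qed
    show "AE x in lborel. norm (indicator U x * ?s k x * ?Z x) \<le> norm (?Z x)" for k
      by (intro AE_I2) (auto simp: indicator_def abs_mult smoothstep_nonneg smoothstep_le_1 intro!: mult_left_le_one_le)
  qed
  have "0 \<le> (LINT x|lborel. indicator U x * ?s k x * ?Z x)" for k
  proof -
    have "0 = (LINT x|lborel. divergence (\<lambda>x. \<psi> k x *\<^sub>R X x) x)"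
      using integral_divergence_zero[OF C1_field_scaleR[OF \<psi>1 X]] by simp
    also have "\<dots> \<le> (LINT x|lborel. indicator U x * ?s k x * ?Z x)"
    proof (rule integral_mono[OF integrable_divergence[OF C1_field_scaleR[OF \<psi>1 X]] _ le])
      show "integrable lborel (\<lambda>x. indicator U x * ?s k x * ?Z x)"
      proof (rule Bochner_Integration.integrable_bound[OF integrable_divergence[OF ZF]])
        note [measurable] = borel_measurable_integrable[OF integrable_divergence[OF ZF]]
        have [measurable]: "(\<lambda>x. indicator U x * ?s k x) \<in> borel_measurable borel"
          using borel_measurable_continuous_on_indicator[OF _ Ck_on_imp_continuous_on[OF s1[of k]]] \<Omega>(2) by simp
        show "(\<lambda>x. indicator U x * ?s k x * ?Z x) \<in> borel_measurable lborel" by measurable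
        show "AE x in lborel. norm (indicator U x * ?s k x * ?Z x) \<le> norm (?Z x)"
          by (intro AE_I2) (auto simp: indicator_def abs_mult smoothstep_nonneg smoothstep_le_1 intro!: mult_left_le_one_le)
      qed
    qed
    finally show ?thesis .
  qed
  then show ?thesis by (intro LIMSEQ_le_const[OF lim]) auto
qed

text \<open>A partition of unity taken one ball at a time: \<zeta> splits as \<zeta> \<beta> +
  \<zeta> (1 - \<beta>), the first part is local, and the second vanishes on one more ball of a
  finite cover. Once the cover is used up nothing is left on \<Omega>.\<close>

lemma flux_nonneg:
  assumes X: "C1_field X R" and \<Omega>: "open \<Omega>" "bounded \<Omega>"
    and loc: "\<And>p. p \<in> closure \<Omega> \<Longrightarrow> \<exists>r>0. \<forall>\<zeta>. Ck_on (Suc 0) \<zeta> UNIV \<and> (\<forall>x. 0 \<le> \<zeta> x) \<and> (\<forall>x. x \<notin> cball p r \<longrightarrow> \<zeta> x = 0)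
         \<longrightarrow> 0 \<le> flux \<Omega> X \<zeta>"
    and \<zeta>: "Ck_on (Suc 0) \<zeta> UNIV" "\<And>x. 0 \<le> \<zeta> x"
  shows "0 \<le> flux \<Omega> X \<zeta>"
proof -
  obtain r where r: "\<And>p. p \<in> closure \<Omega> \<Longrightarrow> r p > 0"
    "\<And>p \<zeta>. p \<in> closure \<Omega> \<Longrightarrow> Ck_on (Suc 0) \<zeta> UNIV \<Longrightarrow> (\<And>x. 0 \<le> \<zeta> x) \<Longrightarrow> (\<And>x. x \<notin> cball p (r p) \<Longrightarrow> \<zeta> x = 0) \<Longrightarrow> 0 \<le> flux \<Omega> X \<zeta>"
    using loc by metis
  have "compact (closure \<Omega>)" using \<Omega>(2) by (simp add: compact_closure)
  then obtain D where D: "finite D" "D \<subseteq> closure \<Omega>" "closure \<Omega> \<subseteq> (\<Union>p\<in>D. ball p (r p / 2))"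
  proof (rule compactE_image[of _ "closure \<Omega>" "\<lambda>p. ball p (r p / 2)"])
    show "closure \<Omega> \<subseteq> (\<Union>p\<in>closure \<Omega>. ball p (r p / 2))"
      using r(1) by force
  qed auto
  have "0 \<le> flux \<Omega> X \<zeta>"
    if "finite E" "E \<subseteq> D" "Ck_on (Suc 0) \<zeta> UNIV" "\<And>x. 0 \<le> \<zeta> x" "\<And>x. x \<in> \<Omega> \<Longrightarrow> x \<notin> (\<Union>p\<in>E. ball p (r p / 2)) \<Longrightarrow> \<zeta> x = 0"
    for E \<zeta>
    using that
  proof (induction E arbitrary: \<zeta>)
    case empty
    then have "divergence (\<lambda>x. \<zeta> x *\<^sub>R X x) x = 0" if "x \<in> \<Omega>" for x
      using that \<Omega>(1) by (intro divergence_zero_open[of \<Omega>]) auto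
    then have "(\<lambda>x. indicator \<Omega> x * divergence (\<lambda>x. \<zeta> x *\<^sub>R X x) x) = (\<lambda>x. 0)"
      by (auto simp: indicator_def fun_eq_iff)
    then show ?case by (simp add: flux_def)
  next
    case (insert p E)
    then have p: "p \<in> closure \<Omega>" using D(2) by auto
    define \<beta> where "\<beta> = ball_cutoff p (r p / 2) (r p)"
    have \<beta>1: "Ck_on (Suc 0) \<beta> UNIV" by (simp add: \<beta>_def Ck_on_ball_cutoff)
    have c1: "Ck_on (Suc 0) (\<lambda>x. \<zeta> x * \<beta> x) UNIV" and c2: "Ck_on (Suc 0) (\<lambda>x. \<zeta> x * (1 - \<beta> x)) UNIV"
      using insert.prems(2) \<beta>1 by (auto intro!: Ck_on_mult Ck_on_diff)
    have "flux \<Omega> X \<zeta> = flux \<Omega> X (\<lambda>x. \<zeta> x * \<beta> x + \<zeta> x * (1 - \<beta> x))"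
      by (simp add: algebra_simps)
    also have "\<dots> = flux \<Omega> X (\<lambda>x. \<zeta> x * \<beta> x) + flux \<Omega> X (\<lambda>x. \<zeta> x * (1 - \<beta> x))"
      by (rule flux_add[OF X \<Omega>(1) c1 c2])
    also have "0 \<le> flux \<Omega> X (\<lambda>x. \<zeta> x * \<beta> x)"
    proof (rule r(2)[OF p c1])
      show "0 \<le> \<zeta> x * \<beta> x" for x using insert.prems(3) by (simp add: \<beta>_def ball_cutoff_bounds)
      show "\<zeta> x * \<beta> x = 0" if "x \<notin> cball p (r p)" for x
        using that r(1)[OF p] by (simp add: \<beta>_def ball_cutoff_eq_0)
    qed
    then have "0 + flux \<Omega> X (\<lambda>x. \<zeta> x * (1 - \<beta> x)) \<le> flux \<Omega> X (\<lambda>x. \<zeta> x * \<beta> x) + flux \<Omega> X (\<lambda>x. \<zeta> x * (1 - \<beta> x))"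
      by (rule add_right_mono)
    moreover have "0 \<le> flux \<Omega> X (\<lambda>x. \<zeta> x * (1 - \<beta> x))"
    proof (rule insert.IH[OF _ c2])
      show "0 \<le> \<zeta> x * (1 - \<beta> x)" for x using insert.prems(3) by (simp add: \<beta>_def ball_cutoff_bounds)
      show "\<zeta> x * (1 - \<beta> x) = 0" if x: "x \<in> \<Omega>" "x \<notin> (\<Union>p\<in>E. ball p (r p / 2))" for x
      proof (cases "x \<in> ball p (r p / 2)")
        case True
        then have "\<beta> x = 1" using r(1)[OF p] by (simp add: \<beta>_def ball_cutoff_eq_1)
        then show ?thesis by simp
      next
        case False
        then show ?thesis using insert.prems(4)[OF x(1)] x(2) by simp
      qed
    qed (use insert.prems in auto)
    ultimately show ?case by linarith
  qed
  from this[OF D(1) subset_refl \<zeta>] show ?thesis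
    using D(3) closure_subset by blast
qed

section \<open>Blow-up of the flux at a boundary point\<close>

lemma lborel_integral_scale:
  fixes f :: "'a::euclidean_space \<Rightarrow> 'b::euclidean_space"
  assumes [measurable]: "f \<in> borel_measurable borel" and r: "r > 0"
  shows "(LINT x|lborel. f x) = r ^ DIM('a) *\<^sub>R (LINT y|lborel. f (p + r *\<^sub>R y))"
proof -
  have "(LINT x|lborel. f x) = (LINT x|density (distr lborel borel (\<lambda>x. p + r *\<^sub>R x)) (\<lambda>_. \<bar>r\<bar> ^ DIM('a)). f x)"
    using lborel_affine[of r p] r by simp
  also have "\<dots> = (LINT x|distr lborel borel (\<lambda>x. p + r *\<^sub>R x). r ^ DIM('a) *\<^sub>R f x)"
    using r by (subst integral_density) auto
  also have "\<dots> = (LINT y|lborel. r ^ DIM('a) *\<^sub>R f (p + r *\<^sub>R y))"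
    by (subst integral_distr) auto
  finally show ?thesis by simp
qed

text \<open>The left side is the area of a disc of radius R. The difference quotient over the
  half-space equals 1/h times the integral of the cutoff over the slab 0 <= y \<bullet> e < h. That
  slab contains a cylinder of height h on which the cutoff is 1, and h cancels.\<close>

lemma halfspace_cutoff_flux:
  fixes e :: "'a::euclidean_space"
  assumes e: "norm e = 1" and R: "0 < R" "R < R'" "R' < 1"
  shows "unit_ball_vol (real (DIM('a) - 1)) * R ^ (DIM('a) - 1)
    \<le> (LINT y|lborel. indicator {y. y \<bullet> e < 0} y * frechet_derivative (ball_cutoff 0 R' 1) (at y) e)"
proof -
  define \<zeta> :: "'a \<Rightarrow> real" where "\<zeta> = ball_cutoff 0 R' 1"
  have \<zeta>1: "Ck_on (Suc 0) \<zeta> UNIV" by (simp add: \<zeta>_def Ck_on_ball_cutoff)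
  have \<zeta>0: "\<zeta> x = 0" if "x \<notin> cball 0 1" for x
    using that R by (simp add: \<zeta>_def ball_cutoff_eq_0)
  note [measurable] = C1_borel_measurable[OF \<zeta>1]
  have ee: "e \<bullet> e = 1" using e by (simp add: norm_eq_1)
  let ?H = "{y. y \<bullet> e < 0}"
  have [measurable]: "{y. y \<bullet> e < c} \<in> sets borel" for c by measurable
  obtain B where B: "B > 0" "\<And>k x. norm (diffquot \<zeta> e k x) \<le> B * indicator (cball 0 (1 + 1)) x"
    by (rule diffquot_bound[OF \<zeta>1 \<zeta>0 eq_refl[OF e]]) (assumption, rule that)
  have lim: "(\<lambda>k. LINT y|lborel. indicator ?H y * diffquot \<zeta> e k y)
      \<longlonglongrightarrow> (LINT y|lborel. indicator ?H y * frechet_derivative \<zeta> (at y) e)"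
  proof (rule integral_dominated_convergence[OF _ _ integrable_cball[of B "1 + 1"]])
    show "AE y in lborel. (\<lambda>k. indicator ?H y * diffquot \<zeta> e k y) \<longlonglongrightarrow> indicator ?H y * frechet_derivative \<zeta> (at y) e"
      by (intro AE_I2 tendsto_mult tendsto_const diffquot_tendsto \<zeta>1)
    show "AE y in lborel. norm (indicator ?H y * diffquot \<zeta> e k y) \<le> B * indicator (cball 0 (1 + 1)) y" for k
    proof (rule AE_I2)
      fix y
      have "norm (indicator ?H y * diffquot \<zeta> e k y) \<le> norm (diffquot \<zeta> e k y)"
        by (auto simp: indicator_def)
      also have "\<dots> \<le> B * indicator (cball 0 (1 + 1)) y" by (rule B)
      finally show "norm (indicator ?H y * diffquot \<zeta> e k y) \<le> B * indicator (cball 0 (1 + 1)) y" .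
    qed
  qed auto
  \<comment> \<open>This makes h^2 + R^2 <= R'^2, so the cylinder of height h and radius R stays in
    the ball of radius R', where the cutoff is 1.\<close>
  obtain N where N: "inverse (real (Suc N)) < sqrt (R'\<^sup>2 - R\<^sup>2)"
    using reals_Archimedean[of "sqrt (R'\<^sup>2 - R\<^sup>2)"] R by (auto simp: power_strict_mono)
  have "unit_ball_vol (real (DIM('a) - 1)) * R ^ (DIM('a) - 1) \<le> (LINT y|lborel. indicator ?H y * diffquot \<zeta> e k y)"
    if "k \<ge> N" for k
  proof -
    define h where "h = inverse (real (Suc k))"
    have h: "h > 0" "real (Suc k) = 1 / h" by (auto simp: h_def divide_inverse)
    have "h \<le> inverse (real (Suc N))" unfolding h_def using that by (intro le_imp_inverse_le) auto
    then have "h < sqrt (R'\<^sup>2 - R\<^sup>2)" using N by linarith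
    then have "h\<^sup>2 \<le> (sqrt (R'\<^sup>2 - R\<^sup>2))\<^sup>2" using h(1) by (intro power_mono) auto
    moreover have "R\<^sup>2 \<le> R'\<^sup>2" using R by (intro power_mono) auto
    ultimately have hR: "h\<^sup>2 + R\<^sup>2 \<le> R'\<^sup>2" by simp
    have int: "integrable lborel (\<lambda>y. indicator {y. y \<bullet> e < c} y * \<zeta> y)" for c
      using integrable_mult_indicator[OF _ integrable_continuous_compact_support[OF Ck_on_imp_continuous_on[OF \<zeta>1] \<zeta>0],
          of "{y. y \<bullet> e < c}"] by simp
    have tr: "indicator ?H y * \<zeta> (y + h *\<^sub>R e) = indicator {y. y \<bullet> e < h} (y + h *\<^sub>R e) * \<zeta> (y + h *\<^sub>R e)" for y
      by (auto simp: indicator_def inner_add_left ee)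
    have "(LINT y|lborel. indicator ?H y * \<zeta> (y + h *\<^sub>R e)) = (LINT y|lborel. indicator {y. y \<bullet> e < h} y * \<zeta> y)"
      unfolding tr by (rule lborel_integral_translate) measurable
    moreover have "integrable lborel (\<lambda>y. indicator ?H y * \<zeta> (y + h *\<^sub>R e))"
      unfolding tr by (rule lborel_integrable_translate[OF int])
    ultimately have quot: "(LINT y|lborel. indicator ?H y * diffquot \<zeta> e k y)
        = real (Suc k) * ((LINT y|lborel. indicator {y. y \<bullet> e < h} y * \<zeta> y) - (LINT y|lborel. indicator ?H y * \<zeta> y))"
      using int[of 0] by (simp add: h_def[symmetric] right_diff_distrib mult.left_commute[of "indicator ?H _"] del: of_nat_Suc)
    have "(LINT y|lborel. indicator {y. y \<bullet> e < h} y * \<zeta> y) - (LINT y|lborel. indicator ?H y * \<zeta> y)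
        = (LINT y|lborel. indicator {y. y \<bullet> e < h} y * \<zeta> y - indicator ?H y * \<zeta> y)"
      by (rule Bochner_Integration.integral_diff[OF int int, symmetric])
    moreover have "(LINT y|lborel. indicator (cylinder e h R) y) \<le> (LINT y|lborel. indicator {y. y \<bullet> e < h} y * \<zeta> y - indicator ?H y * \<zeta> y)"
    proof (rule integral_mono)
      show "integrable lborel (indicat_real (cylinder e h R))"
        using emeasure_cylinder[OF e h(1) R(1)] by (intro integrable_real_indicator) auto
      show "integrable lborel (\<lambda>y. indicator {y. y \<bullet> e < h} y * \<zeta> y - indicator ?H y * \<zeta> y)"
        by (intro Bochner_Integration.integrable_diff int)
      show "indicator (cylinder e h R) y \<le> indicator {y. y \<bullet> e < h} y * \<zeta> y - indicator ?H y * \<zeta> y" for y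
      proof (cases "y \<in> cylinder e h R")
        case True
        then have y: "0 \<le> y \<bullet> e" "y \<bullet> e < h" "y \<bullet> y \<le> (y \<bullet> e)\<^sup>2 + R\<^sup>2" by (auto simp: cylinder_def)
        have "(y \<bullet> e)\<^sup>2 \<le> h\<^sup>2" using y by (intro power_mono) auto
        then have "(norm y)\<^sup>2 \<le> R'\<^sup>2" using y hR unfolding power2_norm_eq_inner by linarith
        then have "norm y \<le> R'" by (rule power2_le_imp_le) (use R in auto)
        then have "\<zeta> y = 1" using R by (simp add: \<zeta>_def ball_cutoff_eq_1)
        then show ?thesis using y True by simp
      next
        case False
        have "0 \<le> \<zeta> y" by (simp add: \<zeta>_def ball_cutoff_bounds)
        then show ?thesis using False h by (simp add: indicator_def)
      qed
    qed
    moreover have "(LINT y|lborel. indicator (cylinder e h R) y) = h * (unit_ball_vol (real (DIM('a) - 1)) * R ^ (DIM('a) - 1))"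
      using emeasure_cylinder[OF e h(1) R(1)] h R by (simp add: measure_def)
    ultimately have "real (Suc k) * (h * (unit_ball_vol (real (DIM('a) - 1)) * R ^ (DIM('a) - 1)))
        \<le> (LINT y|lborel. indicator ?H y * diffquot \<zeta> e k y)"
      unfolding quot by (intro mult_left_mono) auto
    moreover have "real (Suc k) * (h * (unit_ball_vol (real (DIM('a) - 1)) * R ^ (DIM('a) - 1)))
        = unit_ball_vol (real (DIM('a) - 1)) * R ^ (DIM('a) - 1)"
      unfolding h(2) using h(1) by simp
    ultimately show ?thesis by linarith
  qed
  then show ?thesis
    using lim by (intro LIMSEQ_le_const) (auto simp: \<zeta>_def)
qed

definition boundary_chart :: "'a::euclidean_space set \<Rightarrow> 'a set \<Rightarrow> ('a \<Rightarrow> real) \<Rightarrow> bool" where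
  "boundary_chart \<Omega> U \<rho> \<longleftrightarrow> open U \<and> smooth_on \<rho> U \<and> (\<forall>x\<in>U. gradient \<rho> x \<noteq> 0) \<and> \<Omega> \<inter> U = {x\<in>U. \<rho> x < 0}"

text \<open>At boundary points this is the outward direction, since \<Omega> is a sublevel set of
  \<rho>.\<close>

definition unit_normal :: "('a::euclidean_space \<Rightarrow> real) \<Rightarrow> 'a \<Rightarrow> 'a" where
  "unit_normal \<rho> x = inverse (norm (gradient \<rho> x)) *\<^sub>R gradient \<rho> x"

lemma boundary_chartD:
  assumes "boundary_chart \<Omega> U \<rho>"
  shows "open U" "\<And>k. Ck_on k \<rho> U" "\<And>x. x \<in> U \<Longrightarrow> gradient \<rho> x \<noteq> 0" "\<Omega> \<inter> U = {x\<in>U. \<rho> x < 0}"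
    "\<And>x. x \<in> U \<Longrightarrow> (\<rho> has_derivative (\<lambda>v. gradient \<rho> x \<bullet> v)) (at x)"
    "\<And>x v. x \<in> U \<Longrightarrow> frechet_derivative \<rho> (at x) v = gradient \<rho> x \<bullet> v"
    "\<And>x. x \<in> U \<Longrightarrow> norm (unit_normal \<rho> x) = 1"
proof -
  show c: "open U" "\<And>k. Ck_on k \<rho> U" "\<And>x. x \<in> U \<Longrightarrow> gradient \<rho> x \<noteq> 0" "\<Omega> \<inter> U = {x\<in>U. \<rho> x < 0}"
    using assms by (auto simp: boundary_chart_def smooth_on_def)
  show "norm (unit_normal \<rho> x) = 1" if "x \<in> U" for x using c(3)[OF that] by (simp add: unit_normal_def)
  fix x assume x: "x \<in> U"
  have D: "(\<rho> has_derivative frechet_derivative \<rho> (at x)) (at x)"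
    by (rule Ck_on_Suc_has_derivative[OF c(2) c(1) x])
  show *: "frechet_derivative \<rho> (at x) v = gradient \<rho> x \<bullet> v" for v
    using D by (intro frechet_derivative_eq_gradient) (auto simp: differentiable_def)
  then have "frechet_derivative \<rho> (at x) = (\<lambda>v. gradient \<rho> x \<bullet> v)" by blast
  with D show "(\<rho> has_derivative (\<lambda>v. gradient \<rho> x \<bullet> v)) (at x)" by simp
qed

lemma gradient_inner_unit_normal: "gradient \<rho> x = norm (gradient \<rho> x) *\<^sub>R unit_normal \<rho> x"
  by (cases "gradient \<rho> x = 0") (simp_all add: unit_normal_def)

lemma boundary_chart_mem:
  assumes "boundary_chart \<Omega> U \<rho>" "x \<in> U"
  shows "x \<in> \<Omega> \<longleftrightarrow> \<rho> x < 0"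
proof -
  have "x \<in> \<Omega> \<inter> U \<longleftrightarrow> \<rho> x < 0" unfolding boundary_chartD(4)[OF assms(1)] using assms(2) by simp
  then show ?thesis using assms(2) by simp
qed

text \<open>A negative value would put p into the open set \<Omega>; a positive one would persist
  near p and separate p from \<Omega>.\<close>

lemma boundary_chart_frontier_zero:
  assumes c: "boundary_chart \<Omega> U \<rho>" and "open \<Omega>" "p \<in> frontier \<Omega>" "p \<in> U"
  shows "\<rho> p = 0"
proof (rule antisym)
  have "p \<notin> \<Omega>" using assms by (simp add: frontier_def interior_open)
  then show "0 \<le> \<rho> p" using boundary_chart_mem[OF c assms(4)] by simp
  show "\<rho> p \<le> 0"
  proof (rule ccontr)
    assume "\<not> \<rho> p \<le> 0"
    have "continuous_on U \<rho>" using boundary_chartD(2)[OF c] by (rule Ck_on_imp_continuous_on)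
    then have "open (\<rho> -` {0<..} \<inter> U)"
      using boundary_chartD(1)[OF c] by (simp add: continuous_on_open_vimage)
    moreover have "p \<in> \<rho> -` {0<..} \<inter> U" using \<open>\<not> \<rho> p \<le> 0\<close> assms(4) by simp
    moreover have "p \<in> closure \<Omega>" using assms(3) by (simp add: frontier_def)
    ultimately have "(\<rho> -` {0<..} \<inter> U) \<inter> \<Omega> \<noteq> {}"
      using open_Int_closure_eq_empty[of "\<rho> -` {0<..} \<inter> U" \<Omega>] by blast
    then obtain x where "x \<in> U" "x \<in> \<Omega>" "0 < \<rho> x" by auto
    then show False using boundary_chart_mem[OF c] by fastforce
  qed
qed

text \<open>The quotient of \<rho> (p + r y) by r tends to the directional derivative, whose sign
  decides membership for small r. In other words, the domain rescaled about p converges, off a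
  hyperplane, to the half-space opposite the normal.\<close>

lemma boundary_chart_sign:
  assumes c: "boundary_chart \<Omega> U \<rho>" and p: "p \<in> U" "\<rho> p = 0" and y: "gradient \<rho> p \<bullet> y \<noteq> 0"
    and r: "r \<longlonglongrightarrow> 0" "\<And>k. r k > 0"
  shows "\<forall>\<^sub>F k in sequentially. p + r k *\<^sub>R y \<in> \<Omega> \<longleftrightarrow> gradient \<rho> p \<bullet> y < 0"
proof -
  let ?s = "gradient \<rho> p \<bullet> y"
  have "((\<lambda>t. p + t *\<^sub>R y) has_derivative (\<lambda>t. t *\<^sub>R y)) (at 0)"
    by (auto intro!: derivative_eq_intros)
  then have "((\<lambda>t. \<rho> (p + t *\<^sub>R y)) has_derivative (\<lambda>t. gradient \<rho> p \<bullet> (t *\<^sub>R y))) (at 0)"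
    by (rule has_derivative_compose) (use boundary_chartD(5)[OF c p(1)] in simp)
  then have "((\<lambda>t. \<rho> (p + t *\<^sub>R y)) has_real_derivative ?s) (at 0)"
    by (simp add: has_field_derivative_def mult_commute_abs)
  then have "((\<lambda>t. \<rho> (p + t *\<^sub>R y) / t) \<longlongrightarrow> ?s) (at 0)"
    by (simp add: has_field_derivative_iff p)
  moreover have "filterlim r (at 0) sequentially"
    using r by (auto simp: filterlim_at less_imp_neq[symmetric])
  ultimately have lim: "(\<lambda>k. \<rho> (p + r k *\<^sub>R y) / r k) \<longlonglongrightarrow> ?s"
    by (rule filterlim_compose)
  have "(\<lambda>k. p + r k *\<^sub>R y) \<longlonglongrightarrow> p + 0 *\<^sub>R y" by (intro tendsto_intros r)
  then have inU: "\<forall>\<^sub>F k in sequentially. p + r k *\<^sub>R y \<in> U"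
    using boundary_chartD(1)[OF c] p(1) by (auto intro: topological_tendstoD)
  have mem: "p + r k *\<^sub>R y \<in> \<Omega> \<longleftrightarrow> \<rho> (p + r k *\<^sub>R y) / r k < 0" if "p + r k *\<^sub>R y \<in> U" for k
    using boundary_chart_mem[OF c that] r(2)[of k] by (simp add: divide_less_0_iff)
  consider "?s < 0" | "?s > 0" using y by linarith
  then show ?thesis
  proof cases
    case 1
    then have "\<forall>\<^sub>F k in sequentially. \<rho> (p + r k *\<^sub>R y) / r k < 0" using lim by (simp add: order_tendstoD)
    with inU show ?thesis by eventually_elim (use mem 1 in auto)
  next
    case 2
    then have "\<forall>\<^sub>F k in sequentially. 0 < \<rho> (p + r k *\<^sub>R y) / r k" using lim by (simp add: order_tendstoD)
    with inU show ?thesis by eventually_elim (use mem 2 in auto)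
  qed
qed

text \<open>If two normals n and n' differed, w = n' - n would satisfy n \<bullet> w < 0 < n'
  \<bullet> w. By the sign criterion small steps from p along w would then lie both inside and
  outside \<Omega>.\<close>

lemma unit_normal_unique:
  assumes c: "boundary_chart \<Omega> U \<rho>" "p \<in> U" "\<rho> p = 0" and c': "boundary_chart \<Omega> U' \<rho>'" "p \<in> U'" "\<rho>' p = 0"
  shows "unit_normal \<rho> p = unit_normal \<rho>' p"
proof (rule ccontr)
  let ?n = "unit_normal \<rho> p" and ?n' = "unit_normal \<rho>' p"
  assume ne: "?n \<noteq> ?n'"
  define w where "w = ?n' - ?n"
  have n: "?n \<bullet> ?n = 1" "?n' \<bullet> ?n' = 1"
    using boundary_chartD(7)[OF c(1,2)] boundary_chartD(7)[OF c'(1,2)] by (simp_all add: norm_eq_1)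
  have "0 < w \<bullet> w" using ne by (simp add: w_def)
  then have lt: "?n \<bullet> ?n' < 1" using n by (simp add: w_def inner_diff inner_commute)
  have g: "gradient \<rho> p \<bullet> w < 0"
    using lt n boundary_chartD(3)[OF c(1,2)]
    by (subst gradient_inner_unit_normal) (simp add: w_def inner_diff mult_pos_neg)
  have g': "gradient \<rho>' p \<bullet> w > 0"
    using lt n boundary_chartD(3)[OF c'(1,2)]
    by (subst gradient_inner_unit_normal) (simp add: w_def inner_diff inner_commute)
  let ?r = "\<lambda>k. inverse (real (Suc k))"
  have r: "?r \<longlonglongrightarrow> 0" "\<And>k. ?r k > 0" by (rule LIMSEQ_inverse_real_of_nat) simp
  have "\<forall>\<^sub>F k in sequentially. p + ?r k *\<^sub>R w \<in> \<Omega> \<longleftrightarrow> gradient \<rho> p \<bullet> w < 0"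
    using g by (intro boundary_chart_sign[OF c _ r]) simp
  moreover have "\<forall>\<^sub>F k in sequentially. p + ?r k *\<^sub>R w \<in> \<Omega> \<longleftrightarrow> gradient \<rho>' p \<bullet> w < 0"
    using g' by (intro boundary_chart_sign[OF c' _ r]) simp
  ultimately have "\<forall>\<^sub>F k::nat in sequentially. False"
    by eventually_elim (use g g' in auto)
  then show False by simp
qed

text \<open>After the substitution x = p + r y the flux is r to the power n - 1 times an integral
  over the rescaled domain. As r tends to 0 the domain becomes a half-space and X becomes its
  normal, so dominated convergence gives the half-space integral.\<close>

lemma flux_blowup:
  fixes X :: "'a::euclidean_space \<Rightarrow> 'a"
  assumes X: "C1_field X R" "\<And>x. norm (X x) \<le> 1" and \<Omega>: "open \<Omega>"
    and c: "boundary_chart \<Omega> U \<rho>" and p: "p \<in> U" "\<rho> p = 0" "X p = unit_normal \<rho> p"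
    and \<zeta>: "Ck_on (Suc 0) \<zeta> UNIV" "\<And>x. x \<notin> cball 0 1 \<Longrightarrow> \<zeta> x = 0"
    and v: "v < (LINT y|lborel. indicator {y. y \<bullet> unit_normal \<rho> p < 0} y * frechet_derivative \<zeta> (at y) (unit_normal \<rho> p))"
  shows "\<exists>r0>0. \<forall>r. 0 < r \<and> r < r0 \<longrightarrow> v * r ^ (DIM('a) - 1) < flux \<Omega> X (\<lambda>x. \<zeta> ((x - p) /\<^sub>R r))"
proof -
  define e where "e = unit_normal \<rho> p"
  \<comment> \<open>The rescaled integrand multiplied by r. Differentiating the rescaled cutoff
    produces 1/r, so this term survives, while the divergence term keeps a factor r and vanishes in
    the limit.\<close>
  define G where "G r y = indicator \<Omega> (p + r *\<^sub>R y) * (r * \<zeta> y * divergence X (p + r *\<^sub>R y)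
      + frechet_derivative \<zeta> (at y) (X (p + r *\<^sub>R y)))" for r y
  note cX = Ck_on_imp_continuous_on[OF C1_fieldD(1)[OF X(1)]] and cd = continuous_on_divergence[OF X(1)]
  note c\<zeta> = Ck_on_imp_continuous_on[OF \<zeta>(1)] and c\<zeta>' = C1_continuous_derivative[OF \<zeta>(1) open_UNIV]
  have d\<zeta>: "frechet_derivative \<zeta> (at y) w = (\<Sum>i\<in>Basis. frechet_derivative \<zeta> (at y) i * (w \<bullet> i))" for y w
    using frechet_derivative_eq_gradient[OF Ck_on_1_differentiable[OF \<zeta>(1)], of y w]
    by (simp add: gradient_def inner_sum_left inner_commute[of w])
  have d\<zeta>X: "frechet_derivative \<zeta> (at y) (X q) = (\<Sum>i\<in>Basis. frechet_derivative \<zeta> (at y) i * (X q \<bullet> i))" for y q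
    by (rule d\<zeta>)
  have [measurable]: "\<Omega> \<in> sets borel" using \<Omega> by simp
  note [measurable] = borel_measurable_continuous_onI[OF cX] borel_measurable_continuous_onI[OF cd]
    borel_measurable_continuous_onI[OF c\<zeta>] borel_measurable_continuous_onI[OF c\<zeta>']
  have Gm [measurable]: "G r \<in> borel_measurable borel" for r
    unfolding G_def d\<zeta>X by measurable
  have scale: "flux \<Omega> X (\<lambda>x. \<zeta> ((x - p) /\<^sub>R r)) = r ^ (DIM('a) - 1) * (LINT y|lborel. G r y)" if r: "r > 0" for r
  proof -
    let ?z = "\<lambda>x. \<zeta> ((x - p) /\<^sub>R r)"
    have D: "(?z has_derivative (\<lambda>h. frechet_derivative \<zeta> (at ((x - p) /\<^sub>R r)) (h /\<^sub>R r))) (at x)" for x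
      by (rule has_derivative_compose[OF _ Ck_on_Suc_has_derivative[OF \<zeta>(1) open_UNIV UNIV_I]])
        (auto intro!: derivative_eq_intros)
    have z1: "Ck_on (Suc 0) ?z UNIV"
    proof (rule Ck_on_SucI[OF open_UNIV D])
      show "Ck_on 0 (\<lambda>x. frechet_derivative \<zeta> (at ((x - p) /\<^sub>R r)) (i /\<^sub>R r)) UNIV" for i
        unfolding Ck_on.simps by (rule continuous_on_compose2[OF c\<zeta>']) (auto intro!: continuous_intros)
    qed
    have zd: "frechet_derivative ?z (at x) w = frechet_derivative \<zeta> (at ((x - p) /\<^sub>R r)) w / r" for x w
    proof -
      have "frechet_derivative ?z (at x) w = frechet_derivative \<zeta> (at ((x - p) /\<^sub>R r)) (w /\<^sub>R r)"
        using fun_cong[OF frechet_derivative_at[OF D[of x]], of w] by (rule sym)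
      also have "\<dots> = frechet_derivative \<zeta> (at ((x - p) /\<^sub>R r)) w / r"
        using linear_scale[OF has_derivative_linear[OF Ck_on_Suc_has_derivative[OF \<zeta>(1) open_UNIV UNIV_I]]]
        by (simp add: divide_inverse mult.commute)
      finally show ?thesis .
    qed
    let ?F = "\<lambda>x. indicator \<Omega> x * (?z x * divergence X x + frechet_derivative \<zeta> (at ((x - p) /\<^sub>R r)) (X x) / r)"
    have "flux \<Omega> X ?z = (LINT x|lborel. ?F x)"
      by (simp add: flux_def divergence_scaleR[OF z1 C1_fieldD(1)[OF X(1)]] zd)
    also have "\<dots> = r ^ DIM('a) *\<^sub>R (LINT y|lborel. ?F (p + r *\<^sub>R y))"
      unfolding d\<zeta>X by (rule lborel_integral_scale[OF _ r]) measurable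
    also have "(\<lambda>y. ?F (p + r *\<^sub>R y)) = (\<lambda>y. G r y / r)"
      using r by (auto simp: G_def field_simps fun_eq_iff)
    also have "r ^ DIM('a) *\<^sub>R (LINT y|lborel. G r y / r) = (r ^ DIM('a) / r) * (LINT y|lborel. G r y)"
      by simp
    also have "r ^ DIM('a) / r = r ^ (DIM('a) - 1)"
      using r power_Suc[of r "DIM('a) - 1"] DIM_positive[where 'a='a] by (simp add: field_simps)
    finally show ?thesis .
  qed
  obtain Bd where Bd: "Bd > 0" "\<And>x. norm (divergence X x) \<le> Bd"
    using bounded_continuous_compact_support[OF cd divergence_outside[OF X(1)]] by blast
  obtain Bz where Bz: "Bz > 0" "\<And>x. norm (\<zeta> x) \<le> Bz"
    using bounded_continuous_compact_support[OF c\<zeta> \<zeta>(2)] by blast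
  have "\<exists>B. \<forall>x. norm (frechet_derivative \<zeta> (at x) i) \<le> B" for i
  proof -
    have "frechet_derivative \<zeta> (at x) i = 0" if "x \<notin> cball 0 1" for x
      using frechet_derivative_zero_outside[of 1 \<zeta>] \<zeta>(2) that by blast
    from bounded_continuous_compact_support[OF c\<zeta>' this] show ?thesis by blast
  qed
  then obtain Bi where Bi: "\<And>i x. norm (frechet_derivative \<zeta> (at x) i) \<le> Bi i" by metis
  define B where "B = Bz * Bd + (\<Sum>i\<in>Basis. Bi (i::'a))"
  have Gout: "G r y = 0" if "y \<notin> cball 0 1" for r y
    using \<zeta>(2)[OF that] frechet_derivative_zero_outside[OF \<zeta>(2) that] by (simp add: G_def)
  have Gbd: "norm (G r y) \<le> B * indicator (cball 0 1) y" if "0 < r" "r \<le> 1" for r y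
  proof (cases "y \<in> cball 0 1")
    case True
    have "\<bar>r * \<zeta> y * divergence X (p + r *\<^sub>R y)\<bar> \<le> 1 * Bz * Bd"
      unfolding abs_mult using that Bz Bd by (intro mult_mono) auto
    moreover have "\<bar>frechet_derivative \<zeta> (at y) (X (p + r *\<^sub>R y))\<bar> \<le> (\<Sum>i\<in>Basis. Bi i)"
      unfolding d\<zeta>X
    proof (rule order_trans[OF sum_abs sum_mono])
      fix i :: 'a assume "i \<in> Basis"
      then have "\<bar>X (p + r *\<^sub>R y) \<bullet> i\<bar> \<le> 1" using Basis_le_norm X(2) order_trans by blast
      then have "\<bar>frechet_derivative \<zeta> (at y) i * (X (p + r *\<^sub>R y) \<bullet> i)\<bar> \<le> Bi i * 1"
        unfolding abs_mult using Bi[of y i] order_trans[OF norm_ge_zero Bi] by (intro mult_mono) auto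
      then show "\<bar>frechet_derivative \<zeta> (at y) i * (X (p + r *\<^sub>R y) \<bullet> i)\<bar> \<le> Bi i" by simp
    qed
    ultimately show ?thesis using True by (auto simp: G_def B_def indicator_def)
  qed (simp add: Gout)
  let ?L = "LINT y|lborel. indicator {y. y \<bullet> e < 0} y * frechet_derivative \<zeta> (at y) e"
  have conv: "(\<lambda>k. LINT y|lborel. G (r k) y) \<longlonglongrightarrow> ?L" if r: "r \<longlonglongrightarrow> 0" "\<And>k. 0 < r k" "\<And>k. r k \<le> 1" for r
  proof (rule integral_dominated_convergence[OF _ _ integrable_cball[of B 1]])
    \<comment> \<open>On this hyperplane the first-order expansion of \<rho> does not decide
      membership in \<Omega>, but it is a null set.\<close>
    have "negligible {y. e \<bullet> y = 0}"
      using boundary_chartD(7)[OF c p(1)] by (intro negligible_hyperplane) (auto simp: e_def)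
    moreover have "{y. e \<bullet> y = 0} \<in> sets lborel" by measurable
    ultimately have "{y. e \<bullet> y = 0} \<in> null_sets lborel"
      by (simp add: negligible_iff_null_sets null_sets_completion_iff)
    then have "AE y in lborel. y \<notin> {y. e \<bullet> y = 0}" by (rule AE_not_in)
    then show "AE y in lborel. (\<lambda>k. G (r k) y) \<longlonglongrightarrow> indicator {y. y \<bullet> e < 0} y * frechet_derivative \<zeta> (at y) e"
    proof eventually_elim
      case (elim y)
      have g: "gradient \<rho> p \<bullet> y = norm (gradient \<rho> p) * (y \<bullet> e)"
        by (subst gradient_inner_unit_normal) (simp add: e_def inner_commute)
      have gp: "norm (gradient \<rho> p) > 0" using boundary_chartD(3)[OF c p(1)] by simp
      then have "gradient \<rho> p \<bullet> y \<noteq> 0" unfolding g using elim by (simp add: inner_commute)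
      from boundary_chart_sign[OF c p(1,2) this r(1,2)]
      have "\<forall>\<^sub>F k in sequentially. indicator \<Omega> (p + r k *\<^sub>R y) = indicat_real {y. y \<bullet> e < 0} y"
        by eventually_elim (use gp in \<open>auto simp: indicator_def g mult_less_0_iff\<close>)
      then have "(\<lambda>k. indicat_real \<Omega> (p + r k *\<^sub>R y)) \<longlonglongrightarrow> indicator {y. y \<bullet> e < 0} y"
        by (rule tendsto_eventually)
      moreover have q: "(\<lambda>k. p + r k *\<^sub>R y) \<longlonglongrightarrow> p"
        using tendsto_add[OF tendsto_const tendsto_scaleR[OF r(1) tendsto_const], of p y] by simp
      have "(\<lambda>k. divergence X (p + r k *\<^sub>R y)) \<longlonglongrightarrow> divergence X p"
        by (rule continuous_on_tendsto_compose[OF cd q]) auto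
      moreover have "(\<lambda>k. X (p + r k *\<^sub>R y)) \<longlonglongrightarrow> e"
        using continuous_on_tendsto_compose[OF cX q] p(3) by (simp add: e_def)
      then have "(\<lambda>k. frechet_derivative \<zeta> (at y) (X (p + r k *\<^sub>R y))) \<longlonglongrightarrow> frechet_derivative \<zeta> (at y) e"
        unfolding d\<zeta>X d\<zeta>[of _ e] by (intro tendsto_intros)
      ultimately have "(\<lambda>k. G (r k) y) \<longlonglongrightarrow> indicator {y. y \<bullet> e < 0} y * (0 * \<zeta> y * divergence X p + frechet_derivative \<zeta> (at y) e)"
        unfolding G_def by (intro tendsto_intros r)
      then show ?case by simp
    qed
    show "(\<lambda>y. indicator {y. y \<bullet> e < 0} y * frechet_derivative \<zeta> (at y) e) \<in> borel_measurable lborel"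
      by measurable
    show "AE y in lborel. norm (G (r k) y) \<le> B * indicator (cball 0 1) y" for k
      using Gbd r by auto
  qed measurable
  \<comment> \<open>Dominated convergence works along sequences, so the limit in r is tested
    sequentially; r <= 1 is what gives a majorant independent of r.\<close>
  have "\<forall>\<^sub>F r in at 0 within {0<..1}. v < (LINT y|lborel. G r y)"
  proof (rule sequentially_imp_eventually_within, intro allI impI)
    fix f :: "nat \<Rightarrow> real" assume f: "(\<forall>n. f n \<in> {0<..1} \<and> f n \<noteq> 0) \<and> f \<longlonglongrightarrow> 0"
    then have "(\<lambda>k. LINT y|lborel. G (f k) y) \<longlonglongrightarrow> ?L" by (intro conv) auto
    then show "\<forall>\<^sub>F n in sequentially. v < (LINT y|lborel. G (f n) y)"
      using v by (simp add: order_tendstoD e_def)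
  qed
  then obtain d where d: "d > 0" "\<And>r. r \<in> {0<..1} \<Longrightarrow> r \<noteq> 0 \<Longrightarrow> dist r 0 < d \<Longrightarrow> v < (LINT y|lborel. G r y)"
    unfolding eventually_at by blast
  show ?thesis
  proof (intro exI[of _ "min d 1"] conjI allI impI)
    fix r assume r: "0 < r \<and> r < min d 1"
    then have "v < (LINT y|lborel. G r y)" by (intro d) auto
    then show "v * r ^ (DIM('a) - 1) < flux \<Omega> X (\<lambda>x. \<zeta> ((x - p) /\<^sub>R r))"
      using r by (simp add: scale mult.commute)
  qed (use d in auto)
qed

section \<open>A global vector field extending the outer normal\<close>

lemma Ck_on_unit_normal:
  assumes "boundary_chart \<Omega> U \<rho>"
  shows "Ck_on (Suc 0) (unit_normal \<rho>) U"
proof -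
  note c = boundary_chartD[OF assms]
  have g: "Ck_on (Suc 0) (gradient \<rho>) U"
    unfolding gradient_def[abs_def]
  proof (intro Ck_on_sum c(1))
    fix i :: 'a assume "i \<in> Basis"
    then have "Ck_on (Suc 0) (\<lambda>x. frechet_derivative \<rho> (at x) i) U"
      using c(2)[of "Suc (Suc 0)"] by (simp add: Ck_on.simps(2)[of "Suc 0"])
    then show "Ck_on (Suc 0) (\<lambda>x. frechet_derivative \<rho> (at x) i *\<^sub>R i) U"
      by (rule Ck_on_bounded_linear[OF bounded_linear_scaleR_left c(1)])
  qed
  have h: "Ck_on (Suc 0) (\<lambda>t. inverse (sqrt t)) {0<..}"
  proof (rule Ck_on_real_SucI)
    show "((\<lambda>t. inverse (sqrt t)) has_real_derivative - (inverse (sqrt x) * (inverse (sqrt x) / 2) * inverse (sqrt x))) (at x)"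
      if "x \<in> {0<..}" for x
      using that by (intro DERIV_inverse' DERIV_real_sqrt) auto
  qed (auto intro!: continuous_intros)
  have "Ck_on (Suc 0) (\<lambda>x. inverse (sqrt (gradient \<rho> x \<bullet> gradient \<rho> x))) U"
    by (rule Ck_on_compose_real[OF c(1) _ _ Ck_on_inner[OF c(1) g g] h]) (use c(3) in auto)
  then show ?thesis
    unfolding unit_normal_def[abs_def] norm_eq_sqrt_inner by (intro Ck_on_scaleR c(1) g)
qed

text \<open>Quantifying over all charts makes the notion independent of the chart, so that fields
  built from different charts can be compared at a common boundary point.\<close>

definition is_normal_at :: "'a::euclidean_space set \<Rightarrow> 'a \<Rightarrow> 'a \<Rightarrow> bool" where
  "is_normal_at \<Omega> p v \<longleftrightarrow> (\<forall>U \<rho>. boundary_chart \<Omega> U \<rho> \<and> p \<in> U \<longrightarrow> v = unit_normal \<rho> p)"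

text \<open>Glueing the chart normals by convex combinations keeps the norm at most one, and does not change a
  value that is already the normal.\<close>

lemma ex_normal_field:
  fixes \<Omega> :: "'a::euclidean_space set"
  assumes \<Omega>: "smooth_bounded_domain \<Omega>"
  obtains X R where "C1_field X R" "\<And>x. norm (X x) \<le> 1" "\<And>p. p \<in> frontier \<Omega> \<Longrightarrow> is_normal_at \<Omega> p (X p)"
proof -
  have op: "open \<Omega>" and bd: "bounded \<Omega>" using \<Omega> by (auto simp: smooth_bounded_domain_def)
  have "\<exists>U \<rho> r. boundary_chart \<Omega> U \<rho> \<and> 0 < r \<and> cball p (2 * r) \<subseteq> U" if p: "p \<in> frontier \<Omega>" for p
  proof -
    obtain U \<rho> where c: "boundary_chart \<Omega> U \<rho>" "p \<in> U"
      using \<Omega> p unfolding smooth_bounded_domain_def boundary_chart_def by blast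
    then obtain s where s: "s > 0" "cball p s \<subseteq> U"
      using boundary_chartD(1)[OF c(1)] open_contains_cball by blast
    then show ?thesis using c(1) by (intro exI[of _ U] exI[of _ \<rho>] exI[of _ "s / 2"]) auto
  qed
  then obtain U \<rho> r where ch: "\<And>p. p \<in> frontier \<Omega> \<Longrightarrow> boundary_chart \<Omega> (U p) (\<rho> p)"
    "\<And>p. p \<in> frontier \<Omega> \<Longrightarrow> 0 < r p" "\<And>p. p \<in> frontier \<Omega> \<Longrightarrow> cball p (2 * r p) \<subseteq> U p"
    by metis
  have normal: "is_normal_at \<Omega> q (unit_normal (\<rho> p) q)" if "p \<in> frontier \<Omega>" "q \<in> frontier \<Omega>" "q \<in> U p" for p q
    unfolding is_normal_at_def
  proof (intro allI impI, elim conjE)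
    fix V \<rho>' assume V: "boundary_chart \<Omega> V \<rho>'" "q \<in> V"
    note c = ch(1)[OF that(1)]
    show "unit_normal (\<rho> p) q = unit_normal \<rho>' q"
      by (rule unit_normal_unique[OF c that(3) boundary_chart_frontier_zero[OF c op that(2,3)]
          V boundary_chart_frontier_zero[OF V(1) op that(2) V(2)]])
  qed
  have step: "\<exists>X R. C1_field X R \<and> (\<forall>x. norm (X x) \<le> 1) \<and> (\<forall>q\<in>frontier \<Omega> \<inter> (\<Union>p\<in>E. ball p (r p)). is_normal_at \<Omega> q (X q))"
    if "finite E" "E \<subseteq> frontier \<Omega>" for E
    using that
  proof (induction E)
    case empty
    show ?case by (intro exI[of _ "\<lambda>x. 0"] exI[of _ 0]) (auto simp: C1_field_def)
  next
    case (insert p E)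
    then obtain X R where X: "C1_field X R" "\<And>x. norm (X x) \<le> 1"
      "\<And>q. q \<in> frontier \<Omega> \<Longrightarrow> q \<in> (\<Union>p\<in>E. ball p (r p)) \<Longrightarrow> is_normal_at \<Omega> q (X q)"
      by auto
    have p: "p \<in> frontier \<Omega>" using insert.prems by simp
    note c = ch(1)[OF p] and rp = ch(2)[OF p] and sub = ch(3)[OF p]
    \<comment> \<open>Equal to 1 on the ball added in this step, so that Y is the chart normal
      there; its support stays in \<open>U p\<close>, so that the chart normal can be extended by
      zero.\<close>
    define \<beta> where "\<beta> = ball_cutoff p (r p) (2 * r p)"
    have \<beta>1: "Ck_on (Suc 0) \<beta> UNIV" and \<beta>01: "0 \<le> \<beta> x" "\<beta> x \<le> 1" for x
      by (simp_all add: \<beta>_def Ck_on_ball_cutoff ball_cutoff_bounds)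
    have \<beta>out: "\<beta> x = 0" if "x \<notin> cball p (2 * r p)" for x
      using that rp by (simp add: \<beta>_def ball_cutoff_eq_0)
    have \<beta>in: "\<beta> x = 1" if "x \<in> ball p (r p)" for x
      using that rp by (simp add: \<beta>_def ball_cutoff_eq_1)
    define N where "N x = (if x \<in> U p then \<beta> x *\<^sub>R unit_normal (\<rho> p) x else 0)" for x
    define Y where "Y x = (1 - \<beta> x) *\<^sub>R X x + N x" for x
    have "Ck_on (Suc 0) N UNIV"
      unfolding N_def
      by (rule Ck_on_extend_zero[OF boundary_chartD(1)[OF c] closed_cball sub])
        (auto intro!: Ck_on_scaleR Ck_on_unit_normal[OF c] Ck_on_subset[OF \<beta>1] boundary_chartD(1)[OF c] simp: \<beta>out)
    then have Y1: "Ck_on (Suc 0) Y UNIV"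
      unfolding Y_def by (intro Ck_on_add Ck_on_scaleR Ck_on_diff \<beta>1 C1_fieldD(1)[OF X(1)]) auto
    have YU: "Y x = (1 - \<beta> x) *\<^sub>R X x + \<beta> x *\<^sub>R unit_normal (\<rho> p) x" if "x \<in> U p" for x
      using that by (simp add: Y_def N_def)
    have Yn: "Y x = X x" if "x \<notin> U p" for x
    proof -
      have "x \<notin> cball p (2 * r p)" using that sub by blast
      from \<beta>out[OF this] show ?thesis using that by (simp add: Y_def N_def)
    qed
    have Y0: "Y x = 0" if "x \<notin> cball 0 (max R (norm p + 2 * r p))" for x
    proof -
      have "norm x - norm p \<le> dist p x" by (metis dist_norm dist_commute norm_triangle_ineq2)
      then have "x \<notin> cball 0 R" "x \<notin> cball p (2 * r p)" using that by auto
      with C1_fieldD(2)[OF X(1)] \<beta>out show ?thesis by (simp add: Y_def N_def)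
    qed
    have "norm (Y x) \<le> 1" for x
    proof (cases "x \<in> U p")
      case True
      have "norm (Y x) \<le> norm ((1 - \<beta> x) *\<^sub>R X x) + norm (\<beta> x *\<^sub>R unit_normal (\<rho> p) x)"
        unfolding YU[OF True] by (rule norm_triangle_ineq)
      also have "\<dots> \<le> (1 - \<beta> x) * 1 + \<beta> x * 1"
        using \<beta>01[of x] X(2)[of x] boundary_chartD(7)[OF c True]
          mult_left_mono[OF X(2)[of x], of "1 - \<beta> x"] by simp
      finally show ?thesis by simp
    qed (simp add: Yn X)
    moreover have "is_normal_at \<Omega> q (Y q)" if q: "q \<in> frontier \<Omega>" "q \<in> (\<Union>p\<in>insert p E. ball p (r p))" for q
    proof (cases "q \<in> U p")
      case True
      have n: "is_normal_at \<Omega> q (unit_normal (\<rho> p) q)" by (rule normal[OF p q(1) True])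
      show ?thesis
      proof (cases "q \<in> ball p (r p)")
        case True
        then show ?thesis using n \<beta>in[OF True] YU[OF \<open>q \<in> U p\<close>] by simp
      next
        case False
        then have "is_normal_at \<Omega> q (X q)" using q by (intro X(3)) auto
        then have "X q = unit_normal (\<rho> p) q"
          using c True unfolding is_normal_at_def by blast
        then have "Y q = unit_normal (\<rho> p) q"
          using YU[OF \<open>q \<in> U p\<close>] by (simp add: scaleR_left_distrib[symmetric])
        then show ?thesis using n by simp
      qed
    next
      case False
      then have "q \<notin> ball p (r p)" using sub rp by (auto dest!: subsetD[of _ _ q])
      then show ?thesis using q by (auto simp: Yn[OF False] intro!: X(3))
    qed
    ultimately show ?case using Y1 Y0 unfolding C1_field_def by blast
  qed
  have "compact (frontier \<Omega>)" using bd by (simp add: compact_frontier_bounded)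
  then obtain D where D: "finite D" "D \<subseteq> frontier \<Omega>" "frontier \<Omega> \<subseteq> (\<Union>p\<in>D. ball p (r p))"
    using compactE_image[of "frontier \<Omega>" "frontier \<Omega>" "\<lambda>p. ball p (r p)"] ch(2) by force
  obtain X R where "C1_field X R" "\<forall>x. norm (X x) \<le> 1"
    "\<forall>q\<in>frontier \<Omega> \<inter> (\<Union>p\<in>D. ball p (r p)). is_normal_at \<Omega> q (X q)"
    using step[OF D(1,2)] by blast
  then show thesis using D(3) by (intro that[of X R]) auto
qed

text \<open>Around an interior point the flux is zero, as \<zeta> X is compactly supported in
  \<Omega>. At a boundary point the derivative of \<rho> along X is |grad \<rho>| > 0, hence still
  positive on a small ball, where the chart version applies.\<close>

lemma flux_nonneg_normal_field:
  assumes \<Omega>: "smooth_bounded_domain \<Omega>" and X: "C1_field X R"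
    and n: "\<And>p. p \<in> frontier \<Omega> \<Longrightarrow> is_normal_at \<Omega> p (X p)"
    and \<zeta>: "Ck_on (Suc 0) \<zeta> UNIV" "\<And>x. 0 \<le> \<zeta> x"
  shows "0 \<le> flux \<Omega> X \<zeta>"
proof (rule flux_nonneg[OF X _ _ _ \<zeta>])
  show op: "open \<Omega>" and "bounded \<Omega>" using \<Omega> by (auto simp: smooth_bounded_domain_def)
  fix p assume "p \<in> closure \<Omega>"
  then consider "p \<in> \<Omega>" | "p \<in> frontier \<Omega>" using op by (auto simp: frontier_def interior_open)
  then show "\<exists>r>0. \<forall>\<zeta>. Ck_on (Suc 0) \<zeta> UNIV \<and> (\<forall>x. 0 \<le> \<zeta> x) \<and> (\<forall>x. x \<notin> cball p r \<longrightarrow> \<zeta> x = 0) \<longrightarrow> 0 \<le> flux \<Omega> X \<zeta>"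
  proof cases
    case 1
    then obtain r where r: "r > 0" "cball p r \<subseteq> \<Omega>" using op open_contains_cball by blast
    show ?thesis
    proof (intro exI[of _ r] conjI r allI impI; elim conjE)
      fix \<zeta> :: "'a \<Rightarrow> real" assume \<zeta>: "Ck_on (Suc 0) \<zeta> UNIV" "\<forall>x. 0 \<le> \<zeta> x" "\<forall>x. x \<notin> cball p r \<longrightarrow> \<zeta> x = 0"
      have "divergence (\<lambda>x. \<zeta> x *\<^sub>R X x) x = 0" if "x \<notin> \<Omega>" for x
        using that r \<zeta>(3) by (intro divergence_zero_open[of "- cball p r"]) (auto simp: open_Compl)
      then have "(\<lambda>x. indicator \<Omega> x * divergence (\<lambda>x. \<zeta> x *\<^sub>R X x) x) = divergence (\<lambda>x. \<zeta> x *\<^sub>R X x)"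
        by (auto simp: indicator_def fun_eq_iff)
      then show "0 \<le> flux \<Omega> X \<zeta>"
        using integral_divergence_zero[OF C1_field_scaleR[OF \<zeta>(1) X]] by (simp add: flux_def)
    qed
  next
    case 2
    then obtain U \<rho> where c: "boundary_chart \<Omega> U \<rho>" "p \<in> U"
      using \<Omega> unfolding smooth_bounded_domain_def boundary_chart_def by blast
    note cU = boundary_chartD[OF c(1)]
    have Xp: "X p = unit_normal \<rho> p" using n[OF 2] c unfolding is_normal_at_def by blast
    let ?f = "\<lambda>x. gradient \<rho> x \<bullet> X x"
    have "continuous_on U (\<lambda>x. frechet_derivative \<rho> (at x) i)" for i
      by (rule C1_continuous_derivative[OF cU(2) cU(1)])
    then have "continuous_on U ?f"
      using continuous_on_subset[OF Ck_on_imp_continuous_on[OF C1_fieldD(1)[OF X]], of U]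
      unfolding gradient_def by (intro continuous_intros) auto
    then have "open (?f -` {0<..} \<inter> U)" using cU(1) by (simp add: continuous_on_open_vimage)
    moreover have "0 < ?f p"
      unfolding Xp unit_normal_def using cU(3)[OF c(2)] by simp
    then have "p \<in> ?f -` {0<..} \<inter> U" using c(2) by simp
    ultimately obtain r where r: "r > 0" "cball p r \<subseteq> ?f -` {0<..} \<inter> U"
      using open_contains_cball by blast
    show ?thesis
    proof (intro exI[of _ r] conjI r allI impI; elim conjE)
      fix \<zeta> :: "'a \<Rightarrow> real" assume \<zeta>: "Ck_on (Suc 0) \<zeta> UNIV" "\<forall>x. 0 \<le> \<zeta> x" "\<forall>x. x \<notin> cball p r \<longrightarrow> \<zeta> x = 0"
      have "0 \<le> frechet_derivative \<rho> (at x) (X x)" if "x \<in> cball p r" for x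
        using subsetD[OF r(2) that] by (simp add: cU(6))
      then show "0 \<le> flux \<Omega> X \<zeta>"
        using r(2) \<zeta> by (intro flux_nonneg_chart[OF X op cU(1) cU(4) cU(2)]) auto
    qed
  qed
qed

section \<open>Area of the boundary against the total flux\<close>

text \<open>Rescaled cutoffs on disjoint boundary balls add up to at most 1, so by positivity of the
  flux on the remainder their fluxes add up to at most the total. Blow-up bounds each of them below
  by t^k times the weight of its ball, k being the boundary dimension. The packing criterion
  converts this into a measure bound, and t tends to 1.\<close>

theorem hausdorff_measure_frontier_le:
  fixes \<Omega> :: "'a::euclidean_space set"
  assumes \<Omega>: "smooth_bounded_domain \<Omega>" and dim: "DIM('a) \<ge> 2"
    and X: "C1_field X R" "\<And>x. norm (X x) \<le> 1" and n: "\<And>p. p \<in> frontier \<Omega> \<Longrightarrow> is_normal_at \<Omega> p (X p)"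
  shows "hausdorff_measure (DIM('a) - 1) (frontier \<Omega>) \<le> ennreal (LINT x|lborel. indicator \<Omega> x * divergence X x)"
proof -
  let ?k = "DIM('a) - 1"
  let ?w = "unit_ball_vol (real ?k)"
  define P where "P = (LINT x|lborel. indicator \<Omega> x * divergence X x)"
  have op: "open \<Omega>" using \<Omega> by (auto simp: smooth_bounded_domain_def)
  have P: "P = flux \<Omega> X (\<lambda>x. 1)" by (simp add: P_def flux_def)
  have pos: "0 \<le> flux \<Omega> X \<zeta>" if "Ck_on (Suc 0) \<zeta> UNIV" "\<And>x. 0 \<le> \<zeta> x" for \<zeta>
    by (rule flux_nonneg_normal_field[OF \<Omega> X(1) _ that(1)]) (use n that(2) in blast)+
  have P0: "0 \<le> P" unfolding P by (rule pos) auto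
  have w: "?w > 0" by simp
  have main: "hausdorff_measure ?k (frontier \<Omega>) \<le> ennreal (P / t ^ ?k)" if t: "0 < t" "t < 1" for t
  proof -
    \<comment> \<open>The gap between t and s gives the strict inequality that the blow-up requires;
      R' between s and 1 leaves room for the cutoff to be 1 up to radius R'.\<close>
    define s where "s = (1 + t) / 2"
    define R' where "R' = (1 + s) / 2"
    have s: "t < s" "0 < s" "s < R'" "R' < 1" "0 < R'" using t by (simp_all add: s_def R'_def field_simps)
    define \<zeta> :: "'a \<Rightarrow> real" where "\<zeta> = ball_cutoff 0 R' 1"
    have \<zeta>1: "Ck_on (Suc 0) \<zeta> UNIV" by (simp add: \<zeta>_def Ck_on_ball_cutoff)
    have \<zeta>0: "\<zeta> x = 0" if "x \<notin> cball 0 1" for x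
      using that s by (simp add: \<zeta>_def ball_cutoff_eq_0)
    have "\<exists>r0>0. \<forall>r. 0 < r \<and> r < r0 \<longrightarrow> ?w * t ^ ?k * r ^ ?k < flux \<Omega> X (\<lambda>x. \<zeta> ((x - p) /\<^sub>R r))"
      if p: "p \<in> frontier \<Omega>" for p
    proof -
      obtain U \<rho> where c: "boundary_chart \<Omega> U \<rho>" "p \<in> U"
        using \<Omega> p unfolding smooth_bounded_domain_def boundary_chart_def by blast
      have Xp: "X p = unit_normal \<rho> p" using n[OF p] c unfolding is_normal_at_def by blast
      have "t ^ ?k < s ^ ?k" using t s dim by (intro power_strict_mono) auto
      then have "?w * t ^ ?k < ?w * s ^ ?k" using w by simp
      also have "\<dots> \<le> (LINT y|lborel. indicator {y. y \<bullet> unit_normal \<rho> p < 0} y * frechet_derivative \<zeta> (at y) (unit_normal \<rho> p))"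
        unfolding \<zeta>_def by (rule halfspace_cutoff_flux[OF boundary_chartD(7)[OF c] s(2-4)])
      finally have lt: "?w * t ^ ?k < (LINT y|lborel. indicator {y. y \<bullet> unit_normal \<rho> p < 0} y * frechet_derivative \<zeta> (at y) (unit_normal \<rho> p))" .
      show ?thesis
        by (rule flux_blowup[OF X(1) _ op c(1,2) boundary_chart_frontier_zero[OF c(1) op p c(2)] Xp \<zeta>1 _ lt])
          (use X(2) \<zeta>0 in blast)+
    qed
    then obtain r0 where r0: "\<And>p. p \<in> frontier \<Omega> \<Longrightarrow> 0 < r0 p"
      "\<And>p r. p \<in> frontier \<Omega> \<Longrightarrow> 0 < r \<Longrightarrow> r < r0 p \<Longrightarrow> ?w * t ^ ?k * r ^ ?k < flux \<Omega> X (\<lambda>x. \<zeta> ((x - p) /\<^sub>R r))"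
      by metis
    show ?thesis
    proof (rule hausdorff_measure_le_packing[OF r0(1)])
      fix C :: "('a \<times> real) set"
      assume C: "finite C" "\<And>p r. (p, r) \<in> C \<Longrightarrow> p \<in> frontier \<Omega> \<and> 0 < r \<and> r < r0 p"
        "pairwise (\<lambda>c d. disjnt (cball (fst c) (snd c)) (cball (fst d) (snd d))) C"
      define Z where "Z c x = \<zeta> ((x - fst c) /\<^sub>R snd c)" for c x
      have Z1: "Ck_on (Suc 0) (Z c) UNIV" for c
      proof -
        have D: "(Z c has_derivative (\<lambda>h. frechet_derivative \<zeta> (at ((x - fst c) /\<^sub>R snd c)) (h /\<^sub>R snd c))) (at x)" for x
          unfolding Z_def
          by (rule has_derivative_compose[OF _ Ck_on_Suc_has_derivative[OF \<zeta>1 open_UNIV UNIV_I]])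
            (auto intro!: derivative_eq_intros)
        show ?thesis
        proof (rule Ck_on_SucI[OF open_UNIV D])
          show "Ck_on 0 (\<lambda>x. frechet_derivative \<zeta> (at ((x - fst c) /\<^sub>R snd c)) (i /\<^sub>R snd c)) UNIV" for i
            unfolding Ck_on.simps
            by (rule continuous_on_compose2[OF C1_continuous_derivative[OF \<zeta>1 open_UNIV]]) (auto intro!: continuous_intros)
        qed
      qed
      have Z01: "0 \<le> Z c x" "Z c x \<le> 1" for c x by (auto simp: Z_def \<zeta>_def ball_cutoff_bounds)
      have Zout: "Z c x = 0" if "c \<in> C" "x \<notin> cball (fst c) (snd c)" for c x
      proof -
        have c: "0 < snd c" using C(2)[of "fst c" "snd c"] that(1) by simp
        have "snd c < norm (x - fst c)" using that(2) by (simp add: dist_norm norm_minus_commute)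
        then have "1 < norm (x - fst c) / snd c" using c by simp
        also have "\<dots> = norm ((x - fst c) /\<^sub>R snd c)" using c by (simp add: divide_inverse mult.commute)
        finally have "norm ((x - fst c) /\<^sub>R snd c) > 1" .
        then show ?thesis unfolding Z_def by (intro \<zeta>0) simp
      qed
      have sum_le: "(\<Sum>c\<in>C. Z c x) \<le> 1" for x
      proof (cases "\<exists>c\<in>C. x \<in> cball (fst c) (snd c)")
        case True
        then obtain c where c: "c \<in> C" "x \<in> cball (fst c) (snd c)" by blast
        have "Z d x = 0" if "d \<in> C - {c}" for d
        proof (rule Zout)
          have "disjnt (cball (fst c) (snd c)) (cball (fst d) (snd d))"
            using C(3) c(1) that by (auto simp: pairwise_def)
          then show "x \<notin> cball (fst d) (snd d)" using c(2) unfolding disjnt_def by blast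
        qed (use that in simp)
        then have "(\<Sum>d\<in>C. Z d x) = Z c x" using C(1) c(1) by (simp add: sum.remove)
        then show ?thesis using Z01 by simp
      next
        case False
        then have "(\<Sum>c\<in>C. Z c x) = 0" using Zout by (intro sum.neutral) blast
        then show ?thesis by simp
      qed
      have S1: "Ck_on (Suc 0) (\<lambda>x. \<Sum>c\<in>C. Z c x) UNIV" by (intro Ck_on_sum Z1) auto
      have D1: "Ck_on (Suc 0) (\<lambda>x. 1 - (\<Sum>c\<in>C. Z c x)) UNIV" by (intro Ck_on_diff S1) auto
      have "P = flux \<Omega> X (\<lambda>x. (\<Sum>c\<in>C. Z c x) + (1 - (\<Sum>c\<in>C. Z c x)))" unfolding P by simp
      also have "\<dots> = flux \<Omega> X (\<lambda>x. \<Sum>c\<in>C. Z c x) + flux \<Omega> X (\<lambda>x. 1 - (\<Sum>c\<in>C. Z c x))"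
        by (rule flux_add[OF X(1) op S1 D1])
      also have "flux \<Omega> X (\<lambda>x. \<Sum>c\<in>C. Z c x) = (\<Sum>c\<in>C. flux \<Omega> X (Z c))"
        by (rule flux_sum[OF X(1) op C(1) Z1])
      finally have "(\<Sum>c\<in>C. flux \<Omega> X (Z c)) \<le> P"
        using pos[OF D1] sum_le by simp
      moreover have "(\<Sum>c\<in>C. ?w * t ^ ?k * snd c ^ ?k) \<le> (\<Sum>c\<in>C. flux \<Omega> X (Z c))"
      proof (rule sum_mono)
        fix c assume c: "c \<in> C"
        have "?w * t ^ ?k * snd c ^ ?k < flux \<Omega> X (\<lambda>x. \<zeta> ((x - fst c) /\<^sub>R snd c))"
          using C(2)[of "fst c" "snd c"] c by (intro r0(2)) auto
        also have "(\<lambda>x. \<zeta> ((x - fst c) /\<^sub>R snd c)) = Z c" by (auto simp: Z_def)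
        finally show "?w * t ^ ?k * snd c ^ ?k \<le> flux \<Omega> X (Z c)" by simp
      qed
      moreover have "(\<Sum>c\<in>C. ?w * t ^ ?k * snd c ^ ?k) = t ^ ?k * (\<Sum>c\<in>C. ?w * snd c ^ ?k)"
        by (simp add: sum_distrib_left mult_ac)
      ultimately have "t ^ ?k * (\<Sum>c\<in>C. ?w * snd c ^ ?k) \<le> P" by linarith
      then show "(\<Sum>c\<in>C. ?w * snd c ^ ?k) \<le> P / t ^ ?k"
        using t by (simp add: pos_le_divide_eq mult.commute)
    qed
  qed
  \<comment> \<open>Any fixed t shows finiteness, so that the limit t to 1 can be taken with a real
    number H.\<close>
  have "hausdorff_measure ?k (frontier \<Omega>) \<le> ennreal (P / (1 / 2) ^ ?k)" by (rule main) auto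
  then obtain H where H: "hausdorff_measure ?k (frontier \<Omega>) = ennreal H" "0 \<le> H"
    by (cases "hausdorff_measure ?k (frontier \<Omega>)") (auto simp: top_unique)
  have "H * t ^ ?k \<le> P" if t: "0 < t" "t < 1" for t
  proof -
    have "0 \<le> P / t ^ ?k" using P0 t by simp
    then have "H \<le> P / t ^ ?k" using main[OF t] H by (simp add: ennreal_le_iff)
    then show ?thesis using t by (simp add: pos_le_divide_eq)
  qed
  then have "\<forall>\<^sub>F t in at_left 1. H * t ^ ?k \<le> P"
    using eventually_at_left_real[of 0 1] by (auto elim!: eventually_mono)
  moreover have "((\<lambda>t. H * t ^ ?k) \<longlongrightarrow> H) (at_left 1)"
    by (auto intro!: tendsto_eq_intros)
  ultimately have "H \<le> P" by (intro tendsto_upperbound[of _ H "at_left 1"]) auto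
  then show ?thesis unfolding H(1) P_def[symmetric] by (rule ennreal_leI)
qed

section \<open>Polygonal curves on the half line\<close>

text \<open>Upper Riemann sums for the length of polygonal paths to \<open>A\<close> in the metric \<open>sqrt (2 W) |du|\<close>.\<close>

inductive chain_cost :: "('b::euclidean_space \<Rightarrow> real) \<Rightarrow> 'b set \<Rightarrow> 'b \<Rightarrow> real \<Rightarrow> bool" for W A where
  base: "a \<in> A \<Longrightarrow> chain_cost W A a 0"
| step: "chain_cost W A q c \<Longrightarrow> 0 < B \<Longrightarrow> (\<And>x. x \<in> closed_segment p q \<Longrightarrow> W x \<le> B)
     \<Longrightarrow> chain_cost W A p (c + norm (p - q) * sqrt (2 * B))"

text \<open>The curve rests at p for s <= 0, so prepending a segment amounts to shifting it in time.
  It reaches A in finite time, and g is its derivative off a finite set, given as an explicit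
  bounded function so that it can serve as weak derivative.\<close>

definition polygonal_curve :: "('b::euclidean_space \<Rightarrow> real) \<Rightarrow> 'b set \<Rightarrow> 'b \<Rightarrow> real \<Rightarrow> (real \<Rightarrow> 'b) \<Rightarrow> (real \<Rightarrow> 'b) \<Rightarrow> bool" where
  "polygonal_curve W A p c v g \<longleftrightarrow> continuous_on UNIV v \<and> (\<forall>s\<le>0. v s = p \<and> g s = 0) \<and>
     (\<exists>T. \<exists>a\<in>A. \<forall>s\<ge>T. v s = a) \<and>
     (\<exists>D. finite D \<and> (\<forall>s. s \<notin> D \<longrightarrow> (v has_vector_derivative g s) (at s))) \<and>
     g \<in> borel_measurable borel \<and> bounded (range g) \<and>
     (\<integral>\<^sup>+s. indicator {0<..} s * ennreal (1 / 2 * (norm (g s))\<^sup>2 + W (v s)) \<partial>lborel) \<le> ennreal c"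

text \<open>Each segment is run through at the constant speed \<open>sqrt (2 * B)\<close>. Kinetic
  and potential energy density are then both at most B, and the duration times 2 B is exactly the
  cost of the step; a unit speed would not give the cost as a product with a square root.\<close>

lemma ex_polygonal_curve:
  assumes W: "continuous_on UNIV W" "\<And>u. 0 \<le> W u" "\<And>a. a \<in> A \<Longrightarrow> W a = 0"
  shows "chain_cost W A p c \<Longrightarrow> 0 \<le> c \<and> (\<exists>v g. polygonal_curve W A p c v g)"
proof (induction rule: chain_cost.induct)
  case (base a)
  have "polygonal_curve W A a 0 (\<lambda>s. a) (\<lambda>s. 0)"
    using base W(3) by (auto simp: polygonal_curve_def intro!: exI[of _ "{}"])
  then show ?case by auto
next
  case (step q c B p)
  then obtain v g where vg: "polygonal_curve W A q c v g" and c: "0 \<le> c" by auto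
  have c': "0 \<le> c + norm (p - q) * sqrt (2 * B)" using c step.hyps(2) by simp
  show ?case
  proof (cases "p = q")
    case True
    then show ?thesis using vg c by auto
  next
    case False
    define \<tau> where "\<tau> = norm (p - q) / sqrt (2 * B)"
    have \<tau>: "\<tau> > 0" using False step.hyps(2) by (simp add: \<tau>_def)
    define e where "e = (q - p) /\<^sub>R \<tau>"
    \<comment> \<open>One formula for three regimes: the clamped time is 0 before the start, runs
      along the segment up to \<tau>, then stays at q - p; the last summand vanishes until \<tau>,
      because v rests at q for nonpositive times.\<close>
    define v' where "v' s = p + max 0 (min s \<tau>) *\<^sub>R e + (v (s - \<tau>) - q)" for s
    define g' where "g' s = indicator {0<..\<tau>} s *\<^sub>R e + g (s - \<tau>)" for s
    have cv: "continuous_on UNIV v" and v0: "\<And>s. s \<le> 0 \<Longrightarrow> v s = q" and g0: "\<And>s. s \<le> 0 \<Longrightarrow> g s = 0"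
      and gm [measurable]: "g \<in> borel_measurable borel" and gb: "bounded (range g)"
      and en: "(\<integral>\<^sup>+s. indicator {0<..} s * ennreal (1 / 2 * (norm (g s))\<^sup>2 + W (v s)) \<partial>lborel) \<le> ennreal c"
      using vg by (auto simp: polygonal_curve_def)
    obtain T a where T: "a \<in> A" "\<And>s. s \<ge> T \<Longrightarrow> v s = a" using vg by (auto simp: polygonal_curve_def)
    obtain D where D: "finite D" "\<And>s. s \<notin> D \<Longrightarrow> (v has_vector_derivative g s) (at s)"
      using vg by (auto simp: polygonal_curve_def)
    have pq: "p + \<tau> *\<^sub>R e = q" using \<tau> by (simp add: e_def)
    have v'1: "v' s = p" if "s \<le> 0" for s using that \<tau> v0[of "s - \<tau>"] by (simp add: v'_def)
    have v'2: "v' s = p + s *\<^sub>R e" if "0 \<le> s" "s \<le> \<tau>" for s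
      using that v0[of "s - \<tau>"] by (simp add: v'_def min_absorb1)
    have v'3: "v' s = v (s - \<tau>)" if "\<tau> \<le> s" for s
      using that \<tau> pq by (simp add: v'_def min_absorb2 algebra_simps)
    have cv': "continuous_on UNIV v'"
      unfolding v'_def by (intro continuous_intros continuous_on_compose2[OF cv]) auto
    have ne: "norm e = sqrt (2 * B)" using \<tau> False step.hyps(2) by (simp add: e_def \<tau>_def norm_minus_commute)
    have [measurable]: "g' \<in> borel_measurable borel" unfolding g'_def by measurable
    have Wv [measurable]: "(\<lambda>s. W (v s)) \<in> borel_measurable borel" "(\<lambda>s. W (v' s)) \<in> borel_measurable borel"
      by (auto intro!: borel_measurable_continuous_onI continuous_on_compose2[OF W(1)] cv cv')
    have "polygonal_curve W A p (c + norm (p - q) * sqrt (2 * B)) v' g'"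
      unfolding polygonal_curve_def
    proof (intro conjI)
      show "\<forall>s\<le>0. v' s = p \<and> g' s = 0" using v'1 g0 \<tau> by (auto simp: g'_def)
      show "\<exists>T. \<exists>a\<in>A. \<forall>s\<ge>T. v' s = a"
        using T by (intro exI[of _ "max T 0 + \<tau>"] bexI[of _ a]) (auto simp: v'3)
      show "\<exists>D. finite D \<and> (\<forall>s. s \<notin> D \<longrightarrow> (v' has_vector_derivative g' s) (at s))"
      proof (intro exI[of _ "{0, \<tau>} \<union> (\<lambda>s. s + \<tau>) ` D"] conjI allI impI)
        fix s assume s: "s \<notin> {0, \<tau>} \<union> (\<lambda>s. s + \<tau>) ` D"
        then have "s - \<tau> \<notin> D" by (metis UnI2 diff_add_cancel imageI)
        then have dv: "((\<lambda>s. v (s - \<tau>)) has_vector_derivative g (s - \<tau>)) (at s)"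
        proof -
          have "((\<lambda>s. s - \<tau>) has_vector_derivative 1 - 0) (at s)"
            by (intro has_vector_derivative_diff has_vector_derivative_id has_vector_derivative_const)
          from vector_diff_chain_at[OF this D(2)[OF \<open>s - \<tau> \<notin> D\<close>]] show ?thesis
            by (simp add: o_def)
        qed
        consider "s < 0" | "0 < s" "s < \<tau>" | "\<tau> < s" using s by force
        then show "(v' has_vector_derivative g' s) (at s)"
        proof cases
          case 1
          have "((\<lambda>s. p) has_vector_derivative 0) (at s)" by simp
          then have "(v' has_vector_derivative 0) (at s)"
            by (rule has_vector_derivative_transform_within_open[of _ _ _ "{..<0}"]) (use 1 v'1 in auto)
          then show ?thesis using 1 \<tau> g0 by (simp add: g'_def)
        next
          case 2
          have "((\<lambda>s. p + s *\<^sub>R e) has_vector_derivative e) (at s)"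
            by (auto intro!: derivative_eq_intros)
          then have "(v' has_vector_derivative e) (at s)"
            by (rule has_vector_derivative_transform_within_open[of _ _ _ "{0<..<\<tau>}"]) (use 2 v'2 in auto)
          then show ?thesis using 2 g0 by (simp add: g'_def)
        next
          case 3
          have "(v' has_vector_derivative g (s - \<tau>)) (at s)"
            by (rule has_vector_derivative_transform_within_open[OF dv, of "{\<tau><..}"]) (use 3 v'3 in auto)
          then show ?thesis using 3 by (simp add: g'_def)
        qed
      qed (use D in auto)
      obtain M where M: "\<And>s. norm (g s) \<le> M" using gb by (auto simp: bounded_iff)
      have "norm (g' s) \<le> norm e + M" for s
        unfolding g'_def using M[of "s - \<tau>"] norm_triangle_ineq[of "indicator {0<..\<tau>} s *\<^sub>R e" "g (s - \<tau>)"]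
        by (auto simp: indicator_def split: if_splits intro: order_trans[OF _ le_add_same_cancel2[THEN iffD2]])
      then show "bounded (range g')" by (auto simp: bounded_iff)
      let ?E = "\<lambda>s. ennreal (1 / 2 * (norm (g s))\<^sup>2 + W (v s))" and ?E' = "\<lambda>s. ennreal (1 / 2 * (norm (g' s))\<^sup>2 + W (v' s))"
      have "(\<integral>\<^sup>+s. indicator {0<..} s * ?E' s \<partial>lborel)
          = (\<integral>\<^sup>+s. indicator {0<..\<tau>} s * ?E' s + indicator {\<tau><..} s * ?E' s \<partial>lborel)"
        using \<tau> by (intro nn_integral_cong) (auto simp: indicator_def)
      also have "\<dots> = (\<integral>\<^sup>+s. indicator {0<..\<tau>} s * ?E' s \<partial>lborel) + (\<integral>\<^sup>+s. indicator {\<tau><..} s * ?E' s \<partial>lborel)"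
        by (rule nn_integral_add) measurable
      also have "(\<integral>\<^sup>+s. indicator {0<..\<tau>} s * ?E' s \<partial>lborel) \<le> (\<integral>\<^sup>+s. ennreal (2 * B) * indicator {0<..\<tau>} s \<partial>lborel)"
      proof (rule nn_integral_mono)
        fix s
        show "indicator {0<..\<tau>} s * ?E' s \<le> ennreal (2 * B) * indicator {0<..\<tau>} s"
        proof (cases "s \<in> {0<..\<tau>}")
          case True
          then have s: "0 < s" "s \<le> \<tau>" by auto
          have s1: "s * inverse \<tau> \<le> 1" using s \<tau> by (simp add: field_simps)
          have "g' s = e" using s g0 by (simp add: g'_def)
          moreover have "v' s \<in> closed_segment p q"
            unfolding in_segment using s \<tau> s1
            by (intro exI[of _ "s / \<tau>"]) (simp add: v'2 e_def algebra_simps divide_inverse)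
          then have "W (v' s) \<le> B" by (rule step.hyps(3))
          ultimately have "1 / 2 * (norm (g' s))\<^sup>2 + W (v' s) \<le> 2 * B"
            using step.hyps(2) by (simp add: ne)
          then show ?thesis using True by (simp add: ennreal_leI)
        qed simp
      qed
      also have "\<dots> = ennreal (2 * B) * ennreal \<tau>"
        using \<tau> by (subst nn_integral_cmult_indicator) auto
      also have "\<dots> = ennreal (norm (p - q) * sqrt (2 * B))"
      proof -
        define r where "r = sqrt (2 * B)"
        have r: "r > 0" "2 * B = r * r" using step.hyps(2) by (simp_all add: r_def)
        have "2 * B * \<tau> = norm (p - q) * sqrt (2 * B)"
          unfolding \<tau>_def r_def[symmetric] r(2) using r(1) by simp
        then show ?thesis using step.hyps(2) by (simp add: ennreal_mult'[symmetric])
      qed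
      also have "(\<integral>\<^sup>+s. indicator {\<tau><..} s * ?E' s \<partial>lborel) = (\<integral>\<^sup>+s. indicator {\<tau><..} (\<tau> + 1 * s) * ?E' (\<tau> + 1 * s) \<partial>lborel)"
        by (subst nn_integral_real_affine[where c=1 and t=\<tau>]) (auto simp: mult.commute)
      also have "\<dots> = (\<integral>\<^sup>+s. indicator {0<..} s * ?E s \<partial>lborel)"
        using \<tau> by (intro nn_integral_cong) (auto simp: indicator_def v'3 g'_def)
      also note en
      finally show "(\<integral>\<^sup>+s. indicator {0<..} s * ?E' s \<partial>lborel) \<le> ennreal (c + norm (p - q) * sqrt (2 * B))"
        using c step.hyps(2) by (simp add: ennreal_plus add.commute add_mono)
    qed (use cv' in auto)
    then show ?thesis using c' by blast
  qed
qed

text \<open>The fundamental theorem of calculus with finitely many exceptional points, applied to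
  the product of the test function with the continuous v; the corners of the curve leave no jump
  terms.\<close>

lemma has_weak_partial_polygonal_curve:
  assumes "polygonal_curve W A p c v g"
  shows "has_weak_partial {0<..} 1 v g"
  unfolding has_weak_partial_def
proof (intro conjI allI impI)
  have cv: "continuous_on UNIV v" and gm [measurable]: "g \<in> borel_measurable borel" and gb: "bounded (range g)"
    using assms by (auto simp: polygonal_curve_def)
  obtain D where D: "finite D" "\<And>s. s \<notin> D \<Longrightarrow> (v has_vector_derivative g s) (at s)"
    using assms by (auto simp: polygonal_curve_def)
  obtain M where M: "\<And>s. norm (g s) \<le> M" using gb by (auto simp: bounded_iff)
  show lv: "locally_integrable_on {0<..} v" by (rule locally_integrable_on_continuous[OF cv])
  have "integrable lebesgue (\<lambda>x. indicator K x *\<^sub>R g x)" if K: "compact K" for K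
  proof -
    have "integrable lborel (\<lambda>x. indicator K x *\<^sub>R g x)"
    proof (rule Bochner_Integration.integrable_bound)
      show "integrable lborel (\<lambda>x. M * indicator K x)"
        using K emeasure_compact_finite[OF K] by (intro integrable_mult_right integrable_real_indicator) (auto simp: borel_compact)
      show "AE x in lborel. norm (indicator K x *\<^sub>R g x) \<le> norm (M * indicator K x :: real)"
        using M by (intro AE_I2) (auto simp: indicator_def intro: order_trans[OF _ abs_ge_self])
    qed (use K in \<open>auto simp: borel_compact intro!: borel_measurable_scaleR borel_measurable_indicator\<close>)
    then show ?thesis by (subst integrable_completion) auto
  qed
  then show lg: "locally_integrable_on {0<..} g"
    by (simp add: locally_integrable_on_def set_integrable_def)
  fix \<phi> :: "real \<Rightarrow> real" assume t: "test_function {0<..} \<phi>"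
  obtain K R where K: "K \<subseteq> {0<..}" "K \<subseteq> cball 0 R" "Ck_on (Suc 0) \<phi> UNIV"
    "\<And>x. x \<notin> K \<Longrightarrow> \<phi> x = 0" "\<And>x h. x \<notin> K \<Longrightarrow> frechet_derivative \<phi> (at x) h = 0"
    using test_function_support[OF t] by metis
  let ?\<phi>' = "\<lambda>s. frechet_derivative \<phi> (at s) 1"
  have D\<phi>: "(\<phi> has_real_derivative ?\<phi>' s) (at s)" for s
  proof -
    have *: "(\<phi> has_derivative frechet_derivative \<phi> (at s)) (at s)"
      using Ck_on_Suc_has_derivative[OF K(3)] by simp
    have "frechet_derivative \<phi> (at s) h = ?\<phi>' s * h" for h
      using linear_scale[OF has_derivative_linear[OF *], of h 1] by (simp add: mult.commute)
    then have "frechet_derivative \<phi> (at s) = (*) (?\<phi>' s)" by blast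
    with * show ?thesis by (simp add: has_field_derivative_def)
  qed
  let ?f = "\<lambda>s. \<phi> s *\<^sub>R g s + ?\<phi>' s *\<^sub>R v s"
  have i1: "set_integrable lebesgue {0<..} (\<lambda>s. \<phi> s *\<^sub>R g s)" and i2: "set_integrable lebesgue {0<..} (\<lambda>s. ?\<phi>' s *\<^sub>R v s)"
    by (rule set_integrable_test_scaleR[OF t lg] set_integrable_test_scaleR[OF t lv])+
  have out: "\<phi> s = 0" "?\<phi>' s = 0" if "s \<notin> {- \<bar>R\<bar>..\<bar>R\<bar>}" for s
  proof -
    have "s \<notin> K" using that K(2) by (auto simp: dist_real_def)
    then show "\<phi> s = 0" "?\<phi>' s = 0" using K by auto
  qed
  \<comment> \<open>The additional 1 puts both endpoints outside the support of the test function,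
    so the boundary terms vanish.\<close>
  let ?R = "\<bar>R\<bar> + 1"
  have "(?f has_integral (\<phi> ?R *\<^sub>R v ?R - \<phi> (- ?R) *\<^sub>R v (- ?R))) {- ?R..?R}"
  proof (rule fundamental_theorem_of_calculus_strong[OF D(1)])
    show "((\<lambda>s. \<phi> s *\<^sub>R v s) has_vector_derivative ?f s) (at s)" if "s \<in> {- ?R..?R} - D" for s
      using has_vector_derivative_scaleR[OF D\<phi>[of s] D(2)[of s]] that by simp
    show "continuous_on {- ?R..?R} (\<lambda>s. \<phi> s *\<^sub>R v s)"
      by (intro continuous_intros continuous_on_subset[OF cv] continuous_on_subset[OF Ck_on_imp_continuous_on[OF K(3)]]) auto
  qed simp
  then have hi: "(?f has_integral 0) {- ?R..?R}" using out[of ?R] out[of "- ?R"] by simp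
  have eq: "indicator {0<..} s *\<^sub>R ?f s = indicator {- ?R..?R} s *\<^sub>R ?f s" for s
  proof (cases "s \<in> K")
    case True
    then have "s \<in> {0<..}" "s \<in> {- \<bar>R\<bar>..\<bar>R\<bar>}" using K(1,2) by (auto simp: dist_real_def subset_iff)
    then show ?thesis by simp
  qed (simp add: K)
  have si: "set_integrable lebesgue {0<..} ?f" by (rule set_integral_add(1)[OF i1 i2])
  then have "set_integrable lebesgue {- ?R..?R} ?f" unfolding set_integrable_def eq .
  then have "(LINT s:{- ?R..?R}|lebesgue. ?f s) = 0"
    using set_lebesgue_integral_eq_integral(2) hi by (metis integral_unique)
  then have "(LINT s:{0<..}|lebesgue. ?f s) = 0" unfolding set_lebesgue_integral_def eq .
  then have "(LINT s:{0<..}|lebesgue. \<phi> s *\<^sub>R g s) + (LINT s:{0<..}|lebesgue. ?\<phi>' s *\<^sub>R v s) = 0"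
    by (simp add: set_integral_add(2)[OF i1 i2])
  then show "(LINT s:{0<..}|lebesgue. ?\<phi>' s *\<^sub>R v s) = - (LINT s:{0<..}|lebesgue. \<phi> s *\<^sub>R g s)"
    by (simp add: add_eq_0_iff)
qed

lemma L2_loc_bounded_measurable:
  fixes f :: "'a::euclidean_space \<Rightarrow> 'b::euclidean_space"
  assumes [measurable]: "f \<in> borel_measurable borel" and M: "\<And>K. compact K \<Longrightarrow> bounded (f ` K)"
  shows "L2_loc \<Omega> f"
  unfolding L2_loc_def L2_on_def set_borel_measurable_def set_integrable_def
proof (intro allI impI conjI; elim conjE)
  fix K :: "'a set" assume K: "compact K"
  then have [measurable]: "K \<in> sets borel" by (rule borel_compact)
  show "(\<lambda>x. indicator K x *\<^sub>R f x) \<in> borel_measurable lebesgue"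
    by (rule measurable_completion) measurable
  obtain B where B: "\<And>x. x \<in> K \<Longrightarrow> norm (f x) \<le> B" using M[OF K] by (auto simp: bounded_iff)
  have "integrable lborel (\<lambda>x. indicator K x *\<^sub>R (norm (f x))\<^sup>2)"
  proof (rule Bochner_Integration.integrable_bound)
    show "integrable lborel (\<lambda>x. B\<^sup>2 * indicator K x :: real)"
      using emeasure_compact_finite[OF K] by (intro integrable_mult_right integrable_real_indicator) auto
    show "AE x in lborel. norm (indicator K x *\<^sub>R (norm (f x))\<^sup>2) \<le> norm (B\<^sup>2 * indicator K x :: real)"
      using B by (intro AE_I2) (auto simp: indicator_def power_mono)
  qed measurable
  then show "integrable lebesgue (\<lambda>x. indicator K x *\<^sub>R (norm (f x))\<^sup>2)"
    by (subst integrable_completion) auto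
qed

text \<open>The curve is an admissible competitor: it is continuous at 0 and rests in A from some
  time on. Uniqueness of weak derivatives lets g replace the chosen \<open>weak_partial\<close> in
  its energy.\<close>

lemma sigma_plus_le_polygonal_curve:
  assumes "polygonal_curve W A p c v g" and W: "continuous_on UNIV W"
  shows "sigma_plus W A p \<le> ennreal c"
proof -
  have cv: "continuous_on UNIV v" and v0: "v 0 = p" and gm [measurable]: "g \<in> borel_measurable borel" and gb: "bounded (range g)"
    and en: "(\<integral>\<^sup>+s. indicator {0<..} s * ennreal (1 / 2 * (norm (g s))\<^sup>2 + W (v s)) \<partial>lborel) \<le> ennreal c"
    using assms by (auto simp: polygonal_curve_def)
  obtain T a where T: "a \<in> A" "\<And>s. s \<ge> T \<Longrightarrow> v s = a" using assms by (auto simp: polygonal_curve_def)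
  have [measurable]: "v \<in> borel_measurable borel" "(\<lambda>s. W (v s)) \<in> borel_measurable borel"
    by (auto intro!: borel_measurable_continuous_onI continuous_on_compose2[OF W] cv)
  have wp: "has_weak_partial {0<..} 1 v g" by (rule has_weak_partial_polygonal_curve[OF assms(1)])
  have "v \<in> half_line_class A p"
    unfolding half_line_class_def H1_loc_def
  proof (intro CollectI conjI ballI)
    show "L2_loc {0<..} v"
      by (rule L2_loc_bounded_measurable)
        (auto intro!: compact_imp_bounded compact_continuous_image continuous_on_subset[OF cv])
    show "\<exists>g. has_weak_partial {0<..} i v g \<and> L2_loc {0<..} g" if "i \<in> Basis" for i :: real
      using that wp gb by (intro exI[of _ g]) (auto intro!: L2_loc_bounded_measurable intro: bounded_subset)
    have "(v \<longlongrightarrow> v 0) (at 0)" using cv by (simp add: continuous_on_eq_continuous_at isCont_def)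
    then show "(v \<longlongrightarrow> p) (at_right 0)" using v0 by (auto intro: tendsto_mono[OF at_le])
    have "\<forall>\<^sub>F s in at_top. infdist (v s) A = 0"
      using eventually_ge_at_top[of T] by eventually_elim (simp add: T)
    then show "((\<lambda>s. infdist (v s) A) \<longlongrightarrow> 0) at_top" by (rule tendsto_eventually)
  qed
  then have "sigma_plus W A p \<le> half_line_energy W v" unfolding sigma_plus_def by (rule INF_lower)
  also have "half_line_energy W v = (\<integral>\<^sup>+s. indicator {0<..} s * ennreal (1 / 2 * (norm (g s))\<^sup>2 + W (v s)) \<partial>lebesgue)"
    unfolding half_line_energy_def
  proof (rule nn_integral_cong_AE)
    show "AE s in lebesgue. ennreal (1 / 2 * (norm (weak_partial {0<..} 1 v s))\<^sup>2 + W (v s)) * indicator {0<..} s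
        = indicator {0<..} s * ennreal (1 / 2 * (norm (g s))\<^sup>2 + W (v s))"
      using weak_partial_AE_eq[OF open_greaterThan wp] by eventually_elim (auto simp: indicator_def)
  qed
  also have "\<dots> = (\<integral>\<^sup>+s. indicator {0<..} s * ennreal (1 / 2 * (norm (g s))\<^sup>2 + W (v s)) \<partial>lborel)"
    by (rule nn_integral_completion)
  also note en
  finally show ?thesis .
qed

lemma sigma_plus_le_chain_cost:
  assumes "continuous_on UNIV W" "\<And>u. 0 \<le> W u" "\<And>a. a \<in> A \<Longrightarrow> W a = 0" "chain_cost W A p c"
  shows "sigma_plus W A p \<le> ennreal c"
  using ex_polygonal_curve[OF assms] sigma_plus_le_polygonal_curve[OF _ assms(1)] by blast

section \<open>The calibrating function\<close>

lemma C1_compact_support_Lipschitz: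
  fixes f :: "'a::euclidean_space \<Rightarrow> 'b::euclidean_space"
  assumes f: "Ck_on (Suc 0) f UNIV" "\<And>x. x \<notin> cball 0 R \<Longrightarrow> f x = 0"
  obtains L where "0 \<le> L" "\<And>x y. norm (f x - f y) \<le> L * norm (x - y)"
proof -
  note D = Ck_on_Suc_has_derivative[OF f(1) open_UNIV UNIV_I]
  have "\<exists>B. \<forall>x. norm (frechet_derivative f (at x) i) \<le> B" for i
  proof -
    have "frechet_derivative f (at x) i = 0" if "x \<notin> cball 0 R" for x
      using frechet_derivative_zero_outside[of R f] f(2) that by blast
    from bounded_continuous_compact_support[OF C1_continuous_derivative[OF f(1) open_UNIV] this] show ?thesis by blast
  qed
  then obtain B where B: "\<And>i x. norm (frechet_derivative f (at x) i) \<le> B i" by metis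
  define L where "L = (\<Sum>i\<in>Basis. B i)"
  have B0: "0 \<le> B i" for i using order_trans[OF norm_ge_zero B] .
  have "norm (frechet_derivative f (at x) h) \<le> L * norm h" for x h
  proof -
    have lin: "linear (frechet_derivative f (at x))" using D by (rule has_derivative_linear)
    have "frechet_derivative f (at x) h = (\<Sum>i\<in>Basis. (h \<bullet> i) *\<^sub>R frechet_derivative f (at x) i)"
      by (subst euclidean_representation[of h, symmetric]) (simp only: linear_sum[OF lin] linear_scale[OF lin])
    also have "norm \<dots> \<le> (\<Sum>i\<in>Basis. B i * norm h)"
    proof (rule order_trans[OF norm_sum sum_mono])
      fix i :: 'a assume "i \<in> Basis"
      then show "norm ((h \<bullet> i) *\<^sub>R frechet_derivative f (at x) i) \<le> B i * norm h"
        using mult_mono[OF Basis_le_norm[of i h] B[of x i]] by (simp add: mult.commute)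
    qed
    finally show ?thesis by (simp add: L_def sum_distrib_right)
  qed
  then have on: "onorm (frechet_derivative f (at x)) \<le> L" for x by (rule onorm_le)
  have "norm (f x - f y) \<le> L * norm (x - y)" for x y
    by (rule differentiable_bound[OF convex_UNIV D on]) auto
  moreover have "0 \<le> L" unfolding L_def by (intro sum_nonneg B0)
  ultimately show thesis using that by blast
qed

lemma Ck_on_gradient: "Ck_on (Suc k) f S \<Longrightarrow> open S \<Longrightarrow> Ck_on k (gradient f) S"
  unfolding gradient_def[abs_def]
  by (intro Ck_on_sum Ck_on_bounded_linear[OF bounded_linear_scaleR_left]) (auto simp: Ck_on.simps)

section \<open>Quadratic behaviour of the potential at its zeros\<close>

text \<open>The constant is the minimum over the compact unit sphere; homogeneity of degree two
  extends the bound to all vectors.\<close>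

lemma quadratic_form_pos_lower_bound:
  fixes H :: "'a::euclidean_space \<Rightarrow> 'a"
  assumes H: "bounded_linear H" and pos: "\<And>\<xi>. \<xi> \<noteq> 0 \<Longrightarrow> H \<xi> \<bullet> \<xi> > 0"
  obtains c where "c > 0" "\<And>\<xi>. c * (norm \<xi>)\<^sup>2 \<le> H \<xi> \<bullet> \<xi>"
proof -
  have "continuous_on (sphere 0 1) (\<lambda>\<xi>. H \<xi> \<bullet> \<xi>)"
    by (intro continuous_intros linear_continuous_on H)
  moreover have "sphere (0::'a) 1 \<noteq> {}" by simp
  ultimately obtain e where e: "e \<in> sphere 0 1" "\<And>x. x \<in> sphere 0 1 \<Longrightarrow> H e \<bullet> e \<le> H x \<bullet> x"
    using continuous_attains_inf[of "sphere 0 1" "\<lambda>\<xi>. H \<xi> \<bullet> \<xi>"] by auto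
  have "(H e \<bullet> e) * (norm \<xi>)\<^sup>2 \<le> H \<xi> \<bullet> \<xi>" for \<xi>
  proof (cases "\<xi> = 0")
    case True
    then show ?thesis using bounded_linear.linear[OF H] by (simp add: linear_0)
  next
    case False
    let ?x = "\<xi> /\<^sub>R norm \<xi>"
    have "H e \<bullet> e \<le> H ?x \<bullet> ?x" using False by (intro e(2)) simp
    also have "\<dots> = (H \<xi> \<bullet> \<xi>) / (norm \<xi>)\<^sup>2"
      using linear_scale[OF bounded_linear.linear[OF H]] by (simp add: power2_eq_square divide_inverse)
    finally show ?thesis using False by (simp add: pos_le_divide_eq)
  qed
  moreover have "H e \<bullet> e > 0" using e(1) by (intro pos) auto
  ultimately show thesis using that by blast
qed

text \<open>The gradient vanishes at the minimum a, so near a it is the Hessian up to an error of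
  half the smallest value c of the quadratic form. Integrating along the ray from a gives the lower
  constant c / 4 and the upper constant (N + c / 2) / 2, where N bounds the norm of the
  Hessian.\<close>

lemma quadratic_well:
  fixes W :: "'b::euclidean_space \<Rightarrow> real"
  assumes W: "Ck_on (Suc (Suc 0)) W UNIV" "\<And>u. 0 \<le> W u" "W a = 0"
    and hess: "\<And>\<xi>. \<xi> \<noteq> 0 \<Longrightarrow> hessian W a \<xi> \<bullet> \<xi> > 0"
  obtains r k K where "0 < r" "0 < k" "0 < K"
    "\<And>p. norm (p - a) \<le> r \<Longrightarrow> k * (norm (p - a))\<^sup>2 \<le> W p \<and> W p \<le> K * (norm (p - a))\<^sup>2"
proof -
  have W1: "Ck_on (Suc 0) W UNIV" using Ck_on_SucD[OF W(1)] .
  have DW: "(W has_derivative (\<lambda>h. gradient W x \<bullet> h)) (at x)" for x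
  proof -
    have "frechet_derivative W (at x) = (\<lambda>h. gradient W x \<bullet> h)"
      using frechet_derivative_eq_gradient[OF Ck_on_1_differentiable[OF W1]] by blast
    then show ?thesis using Ck_on_Suc_has_derivative[OF W1 open_UNIV UNIV_I, of x] by simp
  qed
  have g0: "gradient W a = 0"
  proof -
    have "(\<lambda>h. gradient W a \<bullet> h) = (\<lambda>h. 0)"
      by (rule differential_zero_maxmin[OF _ open_UNIV DW]) (use W in auto)
    then have "gradient W a \<bullet> gradient W a = 0" by metis
    then show ?thesis by simp
  qed
  have DG: "(gradient W has_derivative hessian W a) (at a)"
    unfolding hessian_def by (rule Ck_on_Suc_has_derivative[OF Ck_on_gradient[OF W(1)]]) auto
  then have H: "bounded_linear (hessian W a)" by (rule has_derivative_bounded_linear)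
  obtain c where c: "c > 0" "\<And>\<xi>. c * (norm \<xi>)\<^sup>2 \<le> hessian W a \<xi> \<bullet> \<xi>"
    using quadratic_form_pos_lower_bound[OF H hess] by blast
  obtain N where N: "N > 0" "\<And>\<xi>. norm (hessian W a \<xi>) \<le> norm \<xi> * N"
    using bounded_linear.pos_bounded[OF H] by blast
  obtain r where r: "r > 0" "\<And>x. norm (x - a) < r \<Longrightarrow> norm (gradient W x - hessian W a (x - a)) \<le> c / 2 * norm (x - a)"
    using DG c(1) unfolding has_derivative_at_alt g0 by (auto dest!: spec[of _ "c / 2"])
  have main: "c / 4 * (norm (p - a))\<^sup>2 \<le> W p \<and> W p \<le> (N + c / 2) / 2 * (norm (p - a))\<^sup>2" if p: "norm (p - a) \<le> r / 2" for p
  proof -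
    define \<xi> where "\<xi> = p - a"
    define w where "w t = W (a + t *\<^sub>R \<xi>)" for t
    define w' where "w' t = gradient W (a + t *\<^sub>R \<xi>) \<bullet> \<xi>" for t
    have Dw: "(w has_real_derivative w' t) (at t)" for t
    proof -
      have "((\<lambda>t. a + t *\<^sub>R \<xi>) has_derivative (\<lambda>t. t *\<^sub>R \<xi>)) (at t)"
        by (auto intro!: derivative_eq_intros)
      from has_derivative_compose[OF this DW] show ?thesis
        by (simp add: w_def[abs_def] w'_def has_field_derivative_def mult_commute_abs)
    qed
    have b: "c / 2 * t * (norm \<xi>)\<^sup>2 \<le> w' t" "w' t \<le> (N + c / 2) * t * (norm \<xi>)\<^sup>2" if t: "0 \<le> t" "t \<le> 1" for t
    proof -
      let ?e = "gradient W (a + t *\<^sub>R \<xi>) - hessian W a (t *\<^sub>R \<xi>)"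
      have tn: "norm (t *\<^sub>R \<xi>) = t * norm \<xi>" using t by simp
      have "t * norm \<xi> \<le> 1 * norm \<xi>" using t by (intro mult_right_mono) auto
      then have "norm (t *\<^sub>R \<xi>) < r" using p r(1) unfolding tn \<xi>_def[symmetric] by linarith
      then have "norm (a + t *\<^sub>R \<xi> - a) < r" by (simp only: add_diff_cancel_left')
      from r(2)[OF this] have "norm ?e \<le> c / 2 * (t * norm \<xi>)" using t by simp
      then have "\<bar>?e \<bullet> \<xi>\<bar> \<le> c / 2 * (t * norm \<xi>) * norm \<xi>"
        using Cauchy_Schwarz_ineq2[of ?e \<xi>] mult_right_mono[of "norm ?e" _ "norm \<xi>"] by (meson norm_ge_zero order_trans)
      moreover have "w' t = t * (hessian W a \<xi> \<bullet> \<xi>) + ?e \<bullet> \<xi>"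
        using linear_scale[OF bounded_linear.linear[OF H], of t \<xi>] by (simp add: w'_def inner_diff_left)
      moreover have "t * (c * (norm \<xi>)\<^sup>2) \<le> t * (hessian W a \<xi> \<bullet> \<xi>)" using c(2) t by (intro mult_left_mono) auto
      moreover have "t * (hessian W a \<xi> \<bullet> \<xi>) \<le> t * (N * (norm \<xi>)\<^sup>2)"
      proof (rule mult_left_mono[OF _ t(1)])
        have "hessian W a \<xi> \<bullet> \<xi> \<le> norm (hessian W a \<xi>) * norm \<xi>" by (rule norm_cauchy_schwarz)
        also have "\<dots> \<le> (norm \<xi> * N) * norm \<xi>" using N(2) by (intro mult_right_mono) auto
        finally show "hessian W a \<xi> \<bullet> \<xi> \<le> N * (norm \<xi>)\<^sup>2" by (simp add: power2_eq_square mult_ac)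
      qed
      moreover define m where "m = t * (norm \<xi>)\<^sup>2"
      moreover have "c / 2 * (t * norm \<xi>) * norm \<xi> = c * m / 2" "t * (c * (norm \<xi>)\<^sup>2) = c * m"
        "t * (N * (norm \<xi>)\<^sup>2) = N * m" "c / 2 * t * (norm \<xi>)\<^sup>2 = c * m / 2"
        "(N + c / 2) * t * (norm \<xi>)\<^sup>2 = N * m + c * m / 2"
        by (simp_all add: m_def power2_eq_square algebra_simps)
      ultimately show "c / 2 * t * (norm \<xi>)\<^sup>2 \<le> w' t" "w' t \<le> (N + c / 2) * t * (norm \<xi>)\<^sup>2"
        by linarith+
    qed
    \<comment> \<open>The integration along the ray is done by monotonicity: subtracting the
      comparison parabola leaves a function with derivative of one sign on [0, 1].\<close>
    have "w 0 - c / 4 * 0\<^sup>2 * (norm \<xi>)\<^sup>2 \<le> w 1 - c / 4 * 1\<^sup>2 * (norm \<xi>)\<^sup>2"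
    proof (rule DERIV_nonneg_imp_nondecreasing[of 0 1 "\<lambda>t. w t - c / 4 * t\<^sup>2 * (norm \<xi>)\<^sup>2"], simp)
      fix t :: real assume t: "0 \<le> t" "t \<le> 1"
      have "((\<lambda>t. w t - c / 4 * t\<^sup>2 * (norm \<xi>)\<^sup>2) has_real_derivative (w' t - c / 2 * t * (norm \<xi>)\<^sup>2)) (at t)"
        by (auto intro!: derivative_eq_intros Dw)
      then show "\<exists>y. ((\<lambda>t. w t - c / 4 * t\<^sup>2 * (norm \<xi>)\<^sup>2) has_real_derivative y) (at t) \<and> 0 \<le> y"
        using b(1)[OF t] by (intro exI conjI) auto
    qed
    moreover have "w 1 - (N + c / 2) / 2 * 1\<^sup>2 * (norm \<xi>)\<^sup>2 \<le> w 0 - (N + c / 2) / 2 * 0\<^sup>2 * (norm \<xi>)\<^sup>2"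
    proof (rule DERIV_nonpos_imp_nonincreasing[of 0 1 "\<lambda>t. w t - (N + c / 2) / 2 * t\<^sup>2 * (norm \<xi>)\<^sup>2"], simp)
      fix t :: real assume t: "0 \<le> t" "t \<le> 1"
      have "((\<lambda>t. w t - (N + c / 2) / 2 * t\<^sup>2 * (norm \<xi>)\<^sup>2) has_real_derivative (w' t - (N + c / 2) * t * (norm \<xi>)\<^sup>2)) (at t)"
        by (auto intro!: derivative_eq_intros Dw)
      then show "\<exists>y. ((\<lambda>t. w t - (N + c / 2) / 2 * t\<^sup>2 * (norm \<xi>)\<^sup>2) has_real_derivative y) (at t) \<and> y \<le> 0"
        using b(2)[OF t] by (intro exI conjI) auto
    qed
    ultimately show ?thesis using W(3) by (simp add: w_def \<xi>_def)
  qed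
  show thesis
    by (rule that[of "r / 2" "c / 4" "(N + c / 2) / 2"]) (use r c N main in auto)
qed

text \<open>\<open>F\<close> is the truncated distance to the wells in the metric \<open>sqrt (2 W) |du|\<close>; the cutoff \<open>G\<close> of \<open>W\<close> is
  Lipschitz, so that \<open>G \<circ> u\<close> depends continuously on \<open>u\<close> in \<open>L\<^sup>2\<close>.\<close>

lemma ex_calibration:
  fixes W :: "'b::euclidean_space \<Rightarrow> real" and A :: "'b set" and z :: 'b
  assumes W: "Ck_on 2 W UNIV" "\<And>u. 0 \<le> W u"
    and A: "finite A" "A \<noteq> {}" "\<And>u. W u = 0 \<longleftrightarrow> u \<in> A"
    and hess: "\<And>a \<xi>. a \<in> A \<Longrightarrow> \<xi> \<noteq> 0 \<Longrightarrow> hessian W a \<xi> \<bullet> \<xi> > 0"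
    and coercive: "Liminf at_infinity (\<lambda>u. ereal (W u)) > 0"
  obtains \<sigma> F G K L where "sigma_plus W A z = ennreal \<sigma>" "0 \<le> \<sigma>" "0 \<le> K" "0 \<le> L"
    "F z = \<sigma>" "\<And>u. 0 \<le> F u" "\<And>u. F u \<le> \<sigma>" "\<And>u. F u \<le> K * W u"
    "\<And>u v. \<bar>F u - F v\<bar> \<le> L * norm (u - v)"
    "\<And>u. 0 \<le> G u" "\<And>u. G u \<le> W u" "\<And>u v. \<bar>G u - G v\<bar> \<le> L * norm (u - v)"
    "\<And>\<tau>. \<tau> > 0 \<Longrightarrow> \<exists>\<delta>>0. \<forall>p q. norm (p - q) < \<delta> \<longrightarrow> \<bar>F p - F q\<bar> \<le> (sqrt (2 * G p) + \<tau>) * norm (p - q)"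
proof -
  have W2: "Ck_on (Suc (Suc 0)) W UNIV" using W(1) by (simp add: numeral_2_eq_2)
  note W1 = Ck_on_SucD[OF W2]
  have cW: "continuous_on UNIV W" using Ck_on_imp_continuous_on[OF W(1)] .
  have WA: "W a = 0" if "a \<in> A" for a using A(3) that by simp
  let ?C = "\<lambda>p. {c. chain_cost W A p c}"
  define \<phi> where "\<phi> p = Inf (?C p)" for p
  have cost0: "0 \<le> c" if "chain_cost W A p c" for p c
    using ex_polygonal_curve[OF cW W(2) _ that] WA by blast
  have bdd: "bdd_below (?C p)" for p using cost0 by (auto simp: bdd_below_def)
  have segB: "\<exists>B>0. \<forall>x\<in>closed_segment p q. W x \<le> B" for p q
  proof -
    have "compact (W ` closed_segment p q)"
      by (intro compact_continuous_image continuous_on_subset[OF cW]) auto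
    then obtain B where "B > 0" "\<forall>y\<in>W ` closed_segment p q. norm y \<le> B"
      using compact_imp_bounded bounded_pos by metis
    then show ?thesis by force
  qed
  have ne: "?C p \<noteq> {}" for p
  proof -
    obtain a where a: "a \<in> A" using A(2) by blast
    obtain B where "B > 0" "\<forall>x\<in>closed_segment p a. W x \<le> B" using segB by blast
    then show ?thesis using chain_cost.step[OF chain_cost.base[OF a, of W], of B p] by auto
  qed
  have \<phi>0: "0 \<le> \<phi> p" for p unfolding \<phi>_def using ne cost0 by (intro cInf_greatest) auto
  have \<phi>step: "\<phi> p \<le> \<phi> q + norm (p - q) * sqrt (2 * B)" if "0 < B" "\<And>x. x \<in> closed_segment p q \<Longrightarrow> W x \<le> B" for p q B
  proof -
    have "\<phi> p - norm (p - q) * sqrt (2 * B) \<le> c" if "chain_cost W A q c" for c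
      using cInf_lower[OF _ bdd, of "c + norm (p - q) * sqrt (2 * B)" p]
        chain_cost.step[OF that \<open>0 < B\<close> \<open>\<And>x. x \<in> closed_segment p q \<Longrightarrow> W x \<le> B\<close>] by (simp add: \<phi>_def)
    then have "\<phi> p - norm (p - q) * sqrt (2 * B) \<le> \<phi> q" unfolding \<phi>_def[of q] using ne by (intro cInf_greatest) auto
    then show ?thesis by simp
  qed
  have \<phi>A: "\<phi> a = 0" if "a \<in> A" for a
    using cInf_lower[OF _ bdd, of 0 a] chain_cost.base[OF that, of W] \<phi>0[of a] by (simp add: \<phi>_def)
  have \<sigma>cost: "sigma_plus W A p \<le> ennreal c" if "chain_cost W A p c" for p c
    using sigma_plus_le_chain_cost[OF cW W(2) _ that] WA by blast
  obtain c0 where "chain_cost W A z c0" using ne[of z] by blast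
  from \<sigma>cost[OF this] have "sigma_plus W A z < top"
    using ennreal_less_top le_less_trans by blast
  then obtain \<sigma> where \<sigma>: "sigma_plus W A z = ennreal \<sigma>" "0 \<le> \<sigma>"
    by (cases "sigma_plus W A z") auto
  \<comment> \<open>This direction makes the truncation take the value \<sigma> at z: F z = min
    (\<phi> z) \<sigma>.\<close>
  have \<sigma>\<phi>: "\<sigma> \<le> \<phi> z"
    unfolding \<phi>_def
  proof (rule cInf_greatest[OF ne])
    fix c assume "c \<in> ?C z"
    then have "ennreal \<sigma> \<le> ennreal c" using \<sigma>cost[of z c] \<sigma>(1) by simp
    then show "\<sigma> \<le> c" using \<sigma>(2) cost0 \<open>c \<in> ?C z\<close> by (simp add: ennreal_le_iff)
  qed
  obtain w0 R0 where w0: "w0 > 0" "\<And>u. R0 \<le> norm u \<Longrightarrow> w0 \<le> W u"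
  proof -
    obtain w where w: "0 < ereal w" "ereal w < Liminf at_infinity (\<lambda>u. ereal (W u))"
      using ereal_dense2[OF coercive] by blast
    then have "\<forall>\<^sub>F u in at_infinity. ereal w < ereal (W u)" using less_LiminfD by blast
    then obtain b where "\<forall>u. b \<le> norm u \<longrightarrow> w < W u" by (auto simp: eventually_at_infinity)
    then show thesis using w(1) by (intro that[of w b]) (auto intro: less_imp_le)
  qed
  \<comment> \<open>Outside radius R0 the degenerate metric is at least \<open>sqrt (2 * w0)\<close>
    times the Euclidean one, and A lies inside. A step starting outside is charged through its
    starting point alone, where W is at most B, so the place where a chain enters the ball need not
    be located.\<close>
  have leave: "(norm p - R0) * sqrt (2 * w0) \<le> c" if "chain_cost W A p c" for p c
    using that
  proof induction
    case (base a)
    then have "norm a < R0" using w0(2)[of a] w0(1) WA by force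
    then show ?case using w0(1) by (simp add: mult_nonpos_nonneg)
  next
    case (step q c B p)
    show ?case
    proof (cases "norm p < R0")
      case True
      then have "(norm p - R0) * sqrt (2 * w0) \<le> 0" using w0(1) by (simp add: mult_nonpos_nonneg)
      also have "0 \<le> c + norm (p - q) * sqrt (2 * B)" using cost0[OF step.hyps(1)] step.hyps(2) by simp
      finally show ?thesis .
    next
      case False
      have "w0 \<le> W p" using False by (intro w0) simp
      also have "\<dots> \<le> B" by (rule step.hyps(3)) simp
      finally have "sqrt (2 * w0) \<le> sqrt (2 * B)" by simp
      then have "norm (p - q) * sqrt (2 * w0) \<le> norm (p - q) * sqrt (2 * B)" by (intro mult_left_mono) auto
      moreover have "(norm p - R0) * sqrt (2 * w0) \<le> (norm q - R0 + norm (p - q)) * sqrt (2 * w0)"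
        using norm_triangle_ineq2[of p q] w0(1) by (intro mult_right_mono) auto
      ultimately show ?thesis using step.IH by (simp add: algebra_simps)
    qed
  qed
  \<comment> \<open>From this radius on every chain to A costs at least \<sigma>, so the truncated
    distance is constant there.\<close>
  define R1 where "R1 = \<bar>R0\<bar> + \<sigma> / sqrt (2 * w0)"
  have far: "\<sigma> \<le> \<phi> p" if "R1 \<le> norm p" for p
    unfolding \<phi>_def
  proof (rule cInf_greatest[OF ne])
    fix c assume "c \<in> ?C p"
    then have "(norm p - R0) * sqrt (2 * w0) \<le> c" using leave by simp
    moreover have "\<sigma> / sqrt (2 * w0) * sqrt (2 * w0) \<le> (norm p - R0) * sqrt (2 * w0)"
      using that w0(1) by (intro mult_right_mono) (auto simp: R1_def)
    ultimately show "\<sigma> \<le> c" using w0(1) by simp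
  qed
  define F where "F p = min (\<phi> p) \<sigma>" for p
  have F0: "0 \<le> F p" "F p \<le> \<sigma>" for p using \<phi>0 \<sigma>(2) by (auto simp: F_def)
  have R1: "0 \<le> R1" using \<sigma>(2) w0(1) by (simp add: R1_def)
  \<comment> \<open>Agrees with W up to radius R1 + 1. The extra unit covers pairs of points at
    distance below 1 of which at least one lies in the ball of radius R1, where F may vary.\<close>
  define G where "G p = ball_cutoff 0 (R1 + 1) (R1 + 2) p * W p" for p
  have G0: "0 \<le> G p" "G p \<le> W p" for p
    using W(2)[of p] ball_cutoff_bounds[of 0 "R1 + 1" "R1 + 2" p] by (auto simp: G_def mult_left_le_one_le)
  have GW: "G p = W p" if "norm p \<le> R1 + 1" for p
    using that R1 by (simp add: G_def ball_cutoff_eq_1)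
  have G1: "Ck_on (Suc 0) G UNIV" unfolding G_def by (intro Ck_on_mult Ck_on_ball_cutoff W1) auto
  have Gout: "G p = 0" if "p \<notin> cball 0 (R1 + 2)" for p
    using that R1 by (simp add: G_def ball_cutoff_eq_0)
  obtain LG where LG: "0 \<le> LG" "\<And>u v. norm (G u - G v) \<le> LG * norm (u - v)"
    using C1_compact_support_Lipschitz[OF G1 Gout] by blast
  have loc: "\<exists>\<delta>>0. \<forall>p q. norm (p - q) < \<delta> \<longrightarrow> \<bar>F p - F q\<bar> \<le> (sqrt (2 * G p) + \<tau>) * norm (p - q)" if \<tau>: "\<tau> > 0" for \<tau>
  proof -
    let ?S = "\<lambda>p. sqrt (2 * W p)"
    have "uniformly_continuous_on (cball 0 (R1 + 1)) ?S"
      by (intro compact_uniformly_continuous continuous_intros continuous_on_subset[OF cW]) auto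
    then obtain d where d: "d > 0" "\<And>x y. x \<in> cball 0 (R1 + 1) \<Longrightarrow> y \<in> cball 0 (R1 + 1) \<Longrightarrow> dist x y < d \<Longrightarrow> dist (?S x) (?S y) < \<tau>"
      unfolding uniformly_continuous_on_def using \<tau> by metis
    have "\<bar>F p - F q\<bar> \<le> (sqrt (2 * G p) + \<tau>) * norm (p - q)" if pq: "norm (p - q) < min d 1" for p q
    proof (cases "R1 \<le> norm p \<and> R1 \<le> norm q")
      case True
      then have "F p = F q" using far[of p] far[of q] by (simp add: F_def)
      then show ?thesis using G0 \<tau> by simp
    next
      case False
      have "norm p \<le> norm q + norm (p - q)" "norm q \<le> norm p + norm (p - q)"
        using norm_triangle_ineq2[of p q] norm_triangle_ineq3[of p q] by auto
      then have b: "norm p \<le> R1 + 1" "norm q \<le> R1 + 1" using False pq by auto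
      \<comment> \<open>Chosen so that \<open>sqrt (2 * B)\<close> is the desired slope; uniform
        continuity makes B an upper bound for W along the whole segment.\<close>
      define B where "B = (?S p + \<tau>)\<^sup>2 / 2"
      have Sp: "0 \<le> ?S p" using W(2) by simp
      have "0 < ?S p + \<tau>" using Sp \<tau> by linarith
      then have B: "0 < B" "sqrt (2 * B) = ?S p + \<tau>" by (simp_all add: B_def)
      have seg: "W x \<le> B" if x: "x \<in> closed_segment p q" for x
      proof -
        have "x \<in> cball 0 (R1 + 1)"
          using x b closed_segment_subset[of p "cball 0 (R1 + 1)" q] by auto
        moreover have "dist x p \<le> dist p q"
          using segment_bound(1)[OF x] by (simp add: dist_norm norm_minus_commute)
        ultimately have "dist (?S x) (?S p) < \<tau>" using d(2)[of x p] b pq by (simp add: dist_norm)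
        then have "?S x \<le> ?S p + \<tau>" by (simp add: dist_real_def)
        then have "(?S x)\<^sup>2 \<le> (?S p + \<tau>)\<^sup>2" using W(2) by (intro power_mono) auto
        then show ?thesis using W(2)[of x] by (simp add: B_def)
      qed
      have "\<phi> p \<le> \<phi> q + norm (p - q) * (?S p + \<tau>)" using \<phi>step[OF B(1), of p q] seg B(2) by simp
      moreover have "\<phi> q \<le> \<phi> p + norm (p - q) * (?S p + \<tau>)"
        using \<phi>step[OF B(1), of q p] seg B(2) by (simp add: closed_segment_commute norm_minus_commute)
      moreover have "0 \<le> norm (p - q) * (?S p + \<tau>)" using Sp \<tau> by simp
      ultimately have "\<bar>F p - F q\<bar> \<le> norm (p - q) * (?S p + \<tau>)" by (auto simp: F_def min_def)
      then show ?thesis using GW[OF b(1)] by (simp add: mult.commute)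
    qed
    then show ?thesis using d(1) by (intro exI[of _ "min d 1"]) auto
  qed
  obtain LF where LF: "0 \<le> LF" "\<And>u v. \<bar>F u - F v\<bar> \<le> LF * norm (u - v)"
  proof -
    obtain \<delta> where \<delta>: "\<delta> > 0" "\<And>p q. norm (p - q) < \<delta> \<Longrightarrow> \<bar>F p - F q\<bar> \<le> (sqrt (2 * G p) + 1) * norm (p - q)"
      using loc[of 1] by auto
    obtain Gm where Gm: "Gm > 0" "\<And>p. norm (G p) \<le> Gm"
      using bounded_continuous_compact_support[OF Ck_on_imp_continuous_on[OF G1] Gout] by blast
    \<comment> \<open>Below distance \<delta> the local estimate with \<tau> = 1 and the bound on G
      give the slope; at larger distances the oscillation of F is at most \<sigma>.\<close>
    define L where "L = max (sqrt (2 * Gm) + 1) (\<sigma> / \<delta>)"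
    have "\<bar>F u - F v\<bar> \<le> L * norm (u - v)" for u v
    proof (cases "norm (u - v) < \<delta>")
      case True
      have "\<bar>F u - F v\<bar> \<le> (sqrt (2 * G u) + 1) * norm (u - v)" by (rule \<delta>(2)[OF True])
      also have "\<dots> \<le> L * norm (u - v)"
        using Gm(2)[of u] by (intro mult_right_mono) (auto simp: L_def le_max_iff_disj)
      finally show ?thesis .
    next
      case False
      have "\<bar>F u - F v\<bar> \<le> \<sigma>" using F0[of u] F0[of v] by auto
      also have "\<sigma> = \<sigma> / \<delta> * \<delta>" using \<delta>(1) by simp
      also have "\<dots> \<le> L * norm (u - v)"
        using False \<delta>(1) \<sigma>(2) by (intro mult_mono) (auto simp: L_def le_max_iff_disj)
      finally show ?thesis .
    qed
    moreover have "0 \<le> L" using Gm(1) by (simp add: L_def le_max_iff_disj)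
    ultimately show thesis using that by blast
  qed
  have "\<exists>r k K. 0 < r \<and> 0 < k \<and> 0 < K \<and> (\<forall>p. norm (p - a) \<le> r \<longrightarrow> k * (norm (p - a))\<^sup>2 \<le> W p \<and> W p \<le> K * (norm (p - a))\<^sup>2)"
    if a: "a \<in> A" for a
    using quadratic_well[OF W2 W(2) WA[OF a] hess[OF a]] by metis
  then obtain r k K where q: "\<And>a. a \<in> A \<Longrightarrow> 0 < r a" "\<And>a. a \<in> A \<Longrightarrow> 0 < k a" "\<And>a. a \<in> A \<Longrightarrow> 0 < K a"
    "\<And>a p. a \<in> A \<Longrightarrow> norm (p - a) \<le> r a \<Longrightarrow> k a * (norm (p - a))\<^sup>2 \<le> W p \<and> W p \<le> K a * (norm (p - a))\<^sup>2"
    by metis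
  \<comment> \<open>The straight segment from p to the well a costs at most
    \<open>sqrt (2 * K a)\<close> times the squared distance, while W p is at least
    \<open>k a\<close> times it. The sum dominates the ratios of all wells.\<close>
  define K1 where "K1 = (\<Sum>a\<in>A. sqrt (2 * K a) / k a)"
  have K1a: "sqrt (2 * K a) / k a \<le> K1" if "a \<in> A" for a
    unfolding K1_def using A(1) q(2,3) that by (intro member_le_sum) (auto intro!: divide_nonneg_nonneg less_imp_le)
  have K10: "0 \<le> K1" unfolding K1_def using q(2,3) by (intro sum_nonneg divide_nonneg_nonneg) (auto intro: less_imp_le)
  have near: "F p \<le> K1 * W p" if a: "a \<in> A" and p: "norm (p - a) \<le> r a" for a p
  proof (cases "p = a")
    case True
    then show ?thesis using \<phi>A[OF a] WA[OF a] \<sigma>(2) by (simp add: F_def)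
  next
    case False
    let ?n = "norm (p - a)"
    define B where "B = K a * ?n\<^sup>2"
    have B: "0 < B" using q(3)[OF a] False by (simp add: B_def)
    have seg: "W x \<le> B" if x: "x \<in> closed_segment p a" for x
    proof -
      have n: "norm (x - a) \<le> ?n" using segment_bound(2)[OF x] by (simp add: norm_minus_commute)
      then have "W x \<le> K a * (norm (x - a))\<^sup>2" using q(4)[OF a, of x] p by auto
      also have "\<dots> \<le> B" unfolding B_def using n q(3)[OF a] by (intro mult_left_mono power_mono) auto
      finally show ?thesis .
    qed
    have "\<phi> p \<le> \<phi> a + ?n * sqrt (2 * B)" by (rule \<phi>step[OF B seg])
    then have "\<phi> p \<le> ?n * sqrt (2 * B)" using \<phi>A[OF a] by simp
    also have "sqrt (2 * B) = sqrt (2 * K a) * ?n" by (simp add: B_def real_sqrt_mult mult.assoc[symmetric])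
    also have "?n * (sqrt (2 * K a) * ?n) = sqrt (2 * K a) / k a * (k a * ?n\<^sup>2)"
      using q(2)[OF a] by (simp add: power2_eq_square)
    also have "\<dots> \<le> K1 * W p"
      using q(4)[OF a p] q(2,3)[OF a] K1a[OF a] K10 by (intro mult_mono) auto
    finally show ?thesis by (simp add: F_def min_le_iff_disj)
  qed
  \<comment> \<open>On this compact set free of wells W has a positive minimum; beyond radius R0 the
    bound w0 from coercivity takes over.\<close>
  define Q where "Q = cball 0 R0 - (\<Union>a\<in>A. ball a (r a))"
  have "compact Q" unfolding Q_def by (intro compact_diff open_UN) auto
  obtain w1 where w1: "w1 > 0" "\<And>u. u \<in> Q \<Longrightarrow> w1 \<le> W u"
  proof (cases "Q = {}")
    case True
    then show thesis using that[of 1] by simp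
  next
    case False
    obtain x where x: "x \<in> Q" "\<And>y. y \<in> Q \<Longrightarrow> W x \<le> W y"
      using continuous_attains_inf[OF \<open>compact Q\<close> False continuous_on_subset[OF cW]] by auto
    have "x \<notin> A" using x(1) q(1) by (auto simp: Q_def)
    then have "W x > 0" using A(3) W(2)[of x] by (metis less_le)
    then show thesis using x(2) that by blast
  qed
  \<comment> \<open>The second summand handles points away from the wells, where F <= \<sigma> and W
    is at least the minimum of w0 and w1.\<close>
  define K2 where "K2 = K1 + \<sigma> / min w0 w1"
  have m: "0 < min w0 w1" using w0(1) w1(1) by simp
  have K20: "0 \<le> K2" "K1 \<le> K2" "\<sigma> / min w0 w1 \<le> K2" using K10 \<sigma>(2) m by (auto simp: K2_def intro: divide_nonneg_pos)
  have FK: "F p \<le> K2 * W p" for p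
  proof (cases "\<exists>a\<in>A. norm (p - a) \<le> r a")
    case True
    then have "F p \<le> K1 * W p" using near by blast
    also have "\<dots> \<le> K2 * W p" using K20 W(2) by (intro mult_right_mono) auto
    finally show ?thesis .
  next
    case False
    then have "p \<notin> (\<Union>a\<in>A. ball a (r a))" by (auto simp: dist_norm norm_minus_commute)
    then have "min w0 w1 \<le> W p"
      using w1(2)[of p] w0(2)[of p] by (cases "R0 \<le> norm p") (auto simp: Q_def)
    have "F p \<le> \<sigma>" by (rule F0)
    also have "\<sigma> = \<sigma> / min w0 w1 * min w0 w1" using less_imp_neq[OF m] by simp
    also have "\<dots> \<le> K2 * W p" using K20 \<open>min w0 w1 \<le> W p\<close> m \<sigma>(2) by (intro mult_mono) auto
    finally show ?thesis .
  qed
  have LF': "\<bar>F u - F v\<bar> \<le> max LF LG * norm (u - v)" for u v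
    by (rule order_trans[OF LF(2) mult_right_mono]) auto
  have LG': "\<bar>G u - G v\<bar> \<le> max LF LG * norm (u - v)" for u v
    by (rule order_trans[OF LG(2)[unfolded real_norm_def] mult_right_mono]) auto
  show thesis
    by (rule that[of \<sigma> K2 "max LF LG" F G, OF \<sigma> K20(1) _ _ F0 FK LF' G0 LG' loc])
      (use LF(1) \<sigma>\<phi> in \<open>auto simp: F_def\<close>)
qed

section \<open>Square-integrable functions and the Dirichlet class\<close>

text \<open>Restrictions to an increasing sequence of compact sets exhausting \<Omega> are
  measurable and converge pointwise. This is how measurability of the chosen
  \<open>weak_partial\<close> on all of \<Omega> is obtained.\<close>

lemma set_borel_measurable_locally_integrable:
  fixes g :: "'a::euclidean_space \<Rightarrow> 'b::euclidean_space"
  assumes "open \<Omega>" "locally_integrable_on \<Omega> g"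
  shows "set_borel_measurable lebesgue \<Omega> g"
proof -
  obtain D where D: "countable D" "D \<subseteq> Pow \<Omega>" "\<And>X. X \<in> D \<Longrightarrow> \<exists>a b. X = cbox a b" "\<Union>D = \<Omega>"
    using open_countable_Union_open_cbox[OF assms(1)] by metis
  show ?thesis
  proof (cases "D = {}")
    case True
    then show ?thesis using D(4) by (simp add: set_borel_measurable_def)
  next
    case False
    let ?K = "\<lambda>n. \<Union>m\<le>n. from_nat_into D m"
    have K: "compact (?K n)" "?K n \<subseteq> \<Omega>" for n
    proof -
      have mem: "from_nat_into D m \<in> D" for m using False by (rule from_nat_into)
      have "compact (from_nat_into D m)" for m
        using D(3)[OF mem[of m]] by (elim exE) simp
      then show "compact (?K n)" by (intro compact_UN) auto
      show "?K n \<subseteq> \<Omega>" using mem D(2) by blast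
    qed
    have m: "(\<lambda>x. indicat_real (?K n) x *\<^sub>R g x) \<in> borel_measurable lebesgue" for n
    proof -
      have "set_integrable lebesgue (?K n) g"
        using assms(2) K[of n] unfolding locally_integrable_on_def by (elim allE impE) (rule conjI, assumption+)
      then show ?thesis unfolding set_integrable_def by (rule borel_measurable_integrable)
    qed
    have "(\<lambda>n. indicator (?K n) x *\<^sub>R g x) \<longlonglongrightarrow> indicator \<Omega> x *\<^sub>R g x" for x
    proof (cases "x \<in> \<Omega>")
      case True
      then obtain X where "X \<in> D" "x \<in> X" using D(4) by blast
      then obtain N where "x \<in> from_nat_into D N" using from_nat_into_surj[OF D(1)] by blast
      then have "indicator (?K n) x *\<^sub>R g x = indicator \<Omega> x *\<^sub>R g x" if "n \<ge> N" for n
        using that True by (auto simp: indicator_def)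
      then show ?thesis by (intro tendsto_eventually eventually_sequentiallyI)
    next
      case False
      then have "x \<notin> ?K n" for n using K(2) by blast
      then show ?thesis using False by simp
    qed
    then show ?thesis
      unfolding set_borel_measurable_def by (intro borel_measurable_LIMSEQ_metric[OF m])
  qed
qed

lemma L2_onD:
  assumes "L2_on S f"
  shows "(\<lambda>x. indicator S x *\<^sub>R f x) \<in> borel_measurable lebesgue"
    "set_integrable lebesgue S (\<lambda>x. (norm (f x))\<^sup>2)"
  using assms by (auto simp: L2_on_def set_borel_measurable_def)

lemma L2_on_diff:
  fixes f g :: "'a::euclidean_space \<Rightarrow> 'b::euclidean_space"
  assumes f: "L2_on S f" and g: "L2_on S g"
  shows "L2_on S (\<lambda>x. f x - g x)"
proof -
  note [measurable] = L2_onD(1)[OF f] L2_onD(1)[OF g]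
  have eq: "indicator S x *\<^sub>R (f x - g x) = indicator S x *\<^sub>R f x - indicator S x *\<^sub>R g x" for x
    by (simp add: scaleR_diff_right)
  have m: "(\<lambda>x. indicator S x *\<^sub>R (f x - g x)) \<in> borel_measurable lebesgue" unfolding eq by measurable
  have "integrable lebesgue (\<lambda>x. indicator S x *\<^sub>R (norm (f x - g x))\<^sup>2)"
  proof (rule Bochner_Integration.integrable_bound)
    show "integrable lebesgue (\<lambda>x. 2 * (indicator S x *\<^sub>R (norm (f x))\<^sup>2 + indicator S x *\<^sub>R (norm (g x))\<^sup>2))"
      using L2_onD(2)[OF f] L2_onD(2)[OF g] unfolding set_integrable_def
      by (intro integrable_mult_right Bochner_Integration.integrable_add)
    have "(\<lambda>x. (norm (indicator S x *\<^sub>R (f x - g x)))\<^sup>2) \<in> borel_measurable lebesgue" using m by measurable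
    also have "(\<lambda>x. (norm (indicator S x *\<^sub>R (f x - g x)))\<^sup>2) = (\<lambda>x. indicator S x *\<^sub>R (norm (f x - g x))\<^sup>2)"
      by (auto simp: indicator_def fun_eq_iff)
    finally show "(\<lambda>x. indicator S x *\<^sub>R (norm (f x - g x))\<^sup>2) \<in> borel_measurable lebesgue" .
    show "AE x in lebesgue. norm (indicator S x *\<^sub>R (norm (f x - g x))\<^sup>2)
        \<le> norm (2 * (indicator S x *\<^sub>R (norm (f x))\<^sup>2 + indicator S x *\<^sub>R (norm (g x))\<^sup>2))"
    proof (rule AE_I2)
      fix x
      have "(norm (f x - g x))\<^sup>2 \<le> (norm (f x) + norm (g x))\<^sup>2"
        by (intro power_mono norm_triangle_ineq4) simp
      also have "\<dots> \<le> 2 * ((norm (f x))\<^sup>2 + (norm (g x))\<^sup>2)"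
        using sum_squares_bound[of "norm (f x)" "norm (g x)"] by (simp add: power2_sum)
      finally show "norm (indicator S x *\<^sub>R (norm (f x - g x))\<^sup>2)
        \<le> norm (2 * (indicator S x *\<^sub>R (norm (f x))\<^sup>2 + indicator S x *\<^sub>R (norm (g x))\<^sup>2))"
        by (auto simp: indicator_def)
    qed
  qed
  with m show ?thesis by (simp add: L2_on_def set_borel_measurable_def set_integrable_def)
qed

lemma L2_on_AE_cong:
  fixes f g :: "'a::euclidean_space \<Rightarrow> 'b::euclidean_space"
  assumes "L2_on S f" "set_borel_measurable lebesgue S g" "AE x in lebesgue. x \<in> S \<longrightarrow> g x = f x"
  shows "L2_on S g"
proof -
  have "(\<lambda>x. (norm (indicator S x *\<^sub>R g x))\<^sup>2) \<in> borel_measurable lebesgue"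
    using assms(2) unfolding set_borel_measurable_def by measurable
  also have "(\<lambda>x. (norm (indicator S x *\<^sub>R g x))\<^sup>2) = (\<lambda>x. indicator S x *\<^sub>R (norm (g x))\<^sup>2)"
    by (auto simp: indicator_def fun_eq_iff)
  finally have m: "(\<lambda>x. indicator S x *\<^sub>R (norm (g x))\<^sup>2) \<in> borel_measurable lebesgue" .
  have "AE x in lebesgue. indicator S x *\<^sub>R (norm (f x))\<^sup>2 = indicator S x *\<^sub>R (norm (g x))\<^sup>2"
    using assms(3) by eventually_elim (auto simp: indicator_def)
  then have "integrable lebesgue (\<lambda>x. indicator S x *\<^sub>R (norm (g x))\<^sup>2)"
    using L2_onD(2)[OF assms(1)] m unfolding set_integrable_def
    by (subst integrable_cong_AE[where g="\<lambda>x. indicator S x *\<^sub>R (norm (f x))\<^sup>2"]) auto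
  with assms(2) show ?thesis by (simp add: L2_on_def set_integrable_def)
qed

lemma L2_on_continuous_compact_support:
  fixes f :: "'a::euclidean_space \<Rightarrow> 'b::euclidean_space"
  assumes "open \<Omega>" "continuous_on UNIV f" "\<And>x. x \<notin> cball 0 R \<Longrightarrow> f x = 0"
  shows "L2_on \<Omega> f"
proof -
  have "integrable lborel (\<lambda>x. (norm (f x))\<^sup>2)"
    using assms by (intro integrable_continuous_compact_support[where R=R] continuous_intros) auto
  then have "integrable lebesgue (\<lambda>x. (norm (f x))\<^sup>2)" by (subst integrable_completion) auto
  then have "integrable lebesgue (\<lambda>x. indicator \<Omega> x *\<^sub>R (norm (f x))\<^sup>2)"
    using assms(1) by (intro integrable_mult_indicator open_sets_lebesgue)
  moreover have "(\<lambda>x. indicator \<Omega> x *\<^sub>R f x) \<in> borel_measurable lebesgue"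
    using continuous_measurable_lebesgue[OF assms(2)] open_sets_lebesgue[OF assms(1)]
    by (intro borel_measurable_scaleR borel_measurable_indicator)
  ultimately show ?thesis by (simp add: L2_on_def set_borel_measurable_def set_integrable_def)
qed

text \<open>The chosen representative equals the square-integrable g almost everywhere; its own
  measurability comes from local integrability.\<close>

lemma L2_on_weak_partial:
  fixes u :: "'a::euclidean_space \<Rightarrow> 'b::euclidean_space"
  assumes "open \<Omega>" "has_weak_partial \<Omega> i u g" "L2_on \<Omega> g"
  shows "L2_on \<Omega> (weak_partial \<Omega> i u)"
proof (rule L2_on_AE_cong[OF assms(3) _ weak_partial_AE_eq[OF assms(1,2)]])
  show "set_borel_measurable lebesgue \<Omega> (weak_partial \<Omega> i u)"
    using weak_partial_works[OF assms(2)] assms(1)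
    by (intro set_borel_measurable_locally_integrable) (auto simp: has_weak_partial_def)
qed

lemma test_function_L2:
  assumes "open \<Omega>" "test_function \<Omega> (\<phi> :: 'a::euclidean_space \<Rightarrow> 'b::euclidean_space)"
  shows "L2_on \<Omega> \<phi>" "L2_on \<Omega> (\<lambda>x. frechet_derivative \<phi> (at x) i)"
proof -
  obtain K R where K: "K \<subseteq> cball 0 R" "Ck_on (Suc 0) \<phi> UNIV"
    "\<And>x. x \<notin> K \<Longrightarrow> \<phi> x = 0" "\<And>x h. x \<notin> K \<Longrightarrow> frechet_derivative \<phi> (at x) h = 0"
    using test_function_support[OF assms(2)] by metis
  show "L2_on \<Omega> \<phi>"
    by (rule L2_on_continuous_compact_support[OF assms(1) Ck_on_imp_continuous_on[OF K(2)], of R]) (use K in blast)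
  show "L2_on \<Omega> (\<lambda>x. frechet_derivative \<phi> (at x) i)"
    by (rule L2_on_continuous_compact_support[OF assms(1) C1_continuous_derivative[OF K(2) open_UNIV], of R]) (use K in blast)
qed

text \<open>The displayed quantity is the squared \<open>H1_norm\<close> of u - z - \<phi> k: by
  uniqueness its weak partials are those of u minus the classical partials of \<phi> k, since
  constants have weak derivative zero. Separate integrals are what the limit passage uses.\<close>

lemma dirichlet_class_approx:
  fixes u :: "'a::euclidean_space \<Rightarrow> 'b::euclidean_space"
  assumes \<Omega>: "open \<Omega>" and u: "u \<in> dirichlet_class \<Omega> z"
  obtains \<phi> where "L2_on \<Omega> u" "\<And>i. i \<in> Basis \<Longrightarrow> L2_on \<Omega> (weak_partial \<Omega> i u)" "\<And>k. test_function \<Omega> (\<phi> k)"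
    "(\<lambda>k. (LINT x:\<Omega>|lebesgue. (norm (u x - (z + \<phi> k x)))\<^sup>2)
       + (\<Sum>i\<in>Basis. LINT x:\<Omega>|lebesgue. (norm (weak_partial \<Omega> i u x - frechet_derivative (\<phi> k) (at x) i))\<^sup>2)) \<longlonglongrightarrow> 0"
proof -
  let ?g = "\<lambda>i. weak_partial \<Omega> i u"
  have uL: "L2_on \<Omega> u" and ug: "\<And>i. i \<in> Basis \<Longrightarrow> \<exists>g. has_weak_partial \<Omega> i u g \<and> L2_on \<Omega> g"
    using u by (auto simp: dirichlet_class_def H1_def)
  have gL: "L2_on \<Omega> (?g i)" and gw: "has_weak_partial \<Omega> i u (?g i)" if "i \<in> Basis" for i
    using ug[OF that] L2_on_weak_partial[OF \<Omega>] weak_partial_works by blast+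
  obtain \<phi> where \<phi>: "\<And>k. test_function \<Omega> (\<phi> k)" "(\<lambda>k. H1_norm \<Omega> (\<lambda>x. u x - z - \<phi> k x)) \<longlonglongrightarrow> 0"
    and zL: "L2_on \<Omega> (\<lambda>x. u x - z)"
    using u by (auto simp: dirichlet_class_def H1_0_def H1_def)
  let ?T = "\<lambda>k. (LINT x:\<Omega>|lebesgue. (norm (u x - (z + \<phi> k x)))\<^sup>2)
       + (\<Sum>i\<in>Basis. LINT x:\<Omega>|lebesgue. (norm (?g i x - frechet_derivative (\<phi> k) (at x) i))\<^sup>2)"
  have T: "?T k = (H1_norm \<Omega> (\<lambda>x. u x - z - \<phi> k x))\<^sup>2" for k
  proof -
    let ?w = "\<lambda>x. u x - z - \<phi> k x" and ?d = "\<lambda>i x. ?g i x - frechet_derivative (\<phi> k) (at x) i"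
    have C1: "Ck_on (Suc 0) (\<phi> k) UNIV" using \<phi>(1)[of k] by (simp add: test_function_def smooth_on_def)
    have w: "has_weak_partial \<Omega> i ?w (?d i)" if i: "i \<in> Basis" for i
    proof -
      have "has_weak_partial \<Omega> i (\<lambda>x. z) (\<lambda>x. frechet_derivative (\<lambda>x. z) (at x) i)"
        using i by (intro has_weak_partial_C1) auto
      from has_weak_partial_diff[OF gw[OF i] this]
      have "has_weak_partial \<Omega> i (\<lambda>x. u x - z) (?g i)" by simp
      then show ?thesis using i by (intro has_weak_partial_diff has_weak_partial_C1 C1) auto
    qed
    have wL: "L2_on \<Omega> ?w" by (intro L2_on_diff zL test_function_L2 \<Omega> \<phi>)
    have dL: "L2_on \<Omega> (?d i)" if "i \<in> Basis" for i
      using that by (intro L2_on_diff gL test_function_L2 \<Omega> \<phi>)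
    let ?p = "\<lambda>i. weak_partial \<Omega> i ?w"
    have pL: "L2_on \<Omega> (?p i)" if "i \<in> Basis" for i
      using L2_on_weak_partial[OF \<Omega> w[OF that] dL[OF that]] .
    have "(LINT x:\<Omega>|lebesgue. (norm (?p i x))\<^sup>2) = (LINT x:\<Omega>|lebesgue. (norm (?d i x))\<^sup>2)" if i: "i \<in> Basis" for i
      unfolding set_lebesgue_integral_def
    proof (rule integral_cong_AE)
      show "AE x in lebesgue. indicat_real \<Omega> x *\<^sub>R (norm (?p i x))\<^sup>2 = indicat_real \<Omega> x *\<^sub>R (norm (?d i x))\<^sup>2"
        using weak_partial_AE_eq[OF \<Omega> w[OF i]] by eventually_elim (auto simp: indicator_def)
    qed (use L2_onD(2)[OF pL[OF i]] L2_onD(2)[OF dL[OF i]] in \<open>auto simp: set_integrable_def\<close>)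
    moreover have "(LINT x:\<Omega>|lebesgue. (norm (?w x))\<^sup>2 + weak_gradient_sq \<Omega> ?w x)
       = (LINT x:\<Omega>|lebesgue. (norm (?w x))\<^sup>2) + (\<Sum>i\<in>Basis. LINT x:\<Omega>|lebesgue. (norm (?p i x))\<^sup>2)"
    proof -
      have i: "set_integrable lebesgue \<Omega> (\<lambda>x. (norm (?p i x))\<^sup>2)" if "i \<in> Basis" for i
        using L2_onD(2)[OF pL[OF that]] .
      have s: "(\<lambda>x. indicat_real \<Omega> x *\<^sub>R weak_gradient_sq \<Omega> ?w x) = (\<lambda>x. \<Sum>i\<in>Basis. indicat_real \<Omega> x *\<^sub>R (norm (?p i x))\<^sup>2)"
        by (simp add: weak_gradient_sq_def sum_distrib_left)
      have "set_integrable lebesgue \<Omega> (weak_gradient_sq \<Omega> ?w)"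
        unfolding set_integrable_def s using i by (intro Bochner_Integration.integrable_sum) (simp add: set_integrable_def)
      moreover have "(LINT x:\<Omega>|lebesgue. weak_gradient_sq \<Omega> ?w x) = (\<Sum>i\<in>Basis. LINT x:\<Omega>|lebesgue. (norm (?p i x))\<^sup>2)"
        unfolding set_lebesgue_integral_def s using i
        by (intro Bochner_Integration.integral_sum) (simp add: set_integrable_def)
      ultimately show ?thesis using set_integral_add(2)[OF L2_onD(2)[OF wL]] by simp
    qed
    moreover have "0 \<le> (LINT x:\<Omega>|lebesgue. (norm (?w x))\<^sup>2 + weak_gradient_sq \<Omega> ?w x)"
      unfolding set_lebesgue_integral_def
      by (intro integral_nonneg_AE AE_I2) (auto simp: weak_gradient_sq_def intro!: sum_nonneg mult_nonneg_nonneg add_nonneg_nonneg)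
    ultimately show ?thesis by (simp add: H1_norm_def diff_diff_eq)
  qed
  have "?T \<longlonglongrightarrow> 0" unfolding T using tendsto_power[OF \<phi>(2), of 2] by simp
  with uL gL \<phi>(1) that show thesis by blast
qed

lemma Lipschitz_continuous_on:
  fixes F :: "'b::euclidean_space \<Rightarrow> real"
  assumes "\<And>p q. \<bar>F p - F q\<bar> \<le> L * norm (p - q)" "0 \<le> L"
  shows "continuous_on UNIV F"
proof -
  have "L-lipschitz_on UNIV F"
    using assms by (intro lipschitz_onI) (auto simp: dist_norm)
  then show ?thesis by (rule lipschitz_on_continuous_on)
qed

text \<open>The linear growth of F is dominated by a constant plus a multiple of the square, and a
  bounded \<Omega> has finite measure.\<close>

lemma set_integrable_Lipschitz_compose:
  fixes u :: "'a::euclidean_space \<Rightarrow> 'b::euclidean_space" and F :: "'b \<Rightarrow> real"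
  assumes \<Omega>: "open \<Omega>" "bounded \<Omega>" and u: "L2_on \<Omega> u"
    and F: "\<And>p q. \<bar>F p - F q\<bar> \<le> L * norm (p - q)" "0 \<le> L"
  shows "set_integrable lebesgue \<Omega> (\<lambda>x. F (u x))"
  unfolding set_integrable_def
proof (rule Bochner_Integration.integrable_bound)
  have fin: "emeasure lebesgue \<Omega> < \<infinity>"
    using emeasure_bounded_finite[OF \<Omega>(2)] \<Omega>(1) by simp
  show "integrable lebesgue (\<lambda>x. (\<bar>F 0\<bar> + L) * indicator \<Omega> x + L * (indicator \<Omega> x *\<^sub>R (norm (u x))\<^sup>2))"
    using L2_onD(2)[OF u] fin open_sets_lebesgue[OF \<Omega>(1)] unfolding set_integrable_def
    by (intro Bochner_Integration.integrable_add integrable_mult_right integrable_real_indicator) auto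
  have "F \<in> borel_measurable borel"
    using Lipschitz_continuous_on[of F L] F by (intro borel_measurable_continuous_onI) blast
  from measurable_compose[OF L2_onD(1)[OF u] this]
  have "(\<lambda>x. indicator \<Omega> x *\<^sub>R F (indicator \<Omega> x *\<^sub>R u x)) \<in> borel_measurable lebesgue"
    using open_sets_lebesgue[OF \<Omega>(1)]
    by (intro borel_measurable_scaleR borel_measurable_indicator)
  also have "(\<lambda>x. indicator \<Omega> x *\<^sub>R F (indicator \<Omega> x *\<^sub>R u x)) = (\<lambda>x. indicator \<Omega> x *\<^sub>R F (u x))"
    by (auto simp: indicator_def fun_eq_iff)
  finally show "(\<lambda>x. indicator \<Omega> x *\<^sub>R F (u x)) \<in> borel_measurable lebesgue" .
  show "AE x in lebesgue. norm (indicator \<Omega> x *\<^sub>R F (u x))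
      \<le> norm ((\<bar>F 0\<bar> + L) * indicator \<Omega> x + L * (indicator \<Omega> x *\<^sub>R (norm (u x))\<^sup>2))"
  proof (rule AE_I2)
    fix x
    let ?n = "norm (u x)"
    have "2 * ?n \<le> ?n\<^sup>2 + 1"
      using zero_le_power2[of "?n - 1"] by (simp add: power2_diff)
    then have "?n \<le> 1 + ?n\<^sup>2" using norm_ge_zero[of "u x"] by linarith
    then have "L * ?n \<le> L * (1 + ?n\<^sup>2)" using F(2) by (rule mult_left_mono)
    then have "\<bar>F (u x)\<bar> \<le> \<bar>F 0\<bar> + L * (1 + ?n\<^sup>2)" using F(1)[of "u x" 0] by simp
    moreover have "0 \<le> \<bar>F 0\<bar> + L * (1 + ?n\<^sup>2)" using F(2) by simp
    ultimately show "norm (indicator \<Omega> x *\<^sub>R F (u x))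
      \<le> norm ((\<bar>F 0\<bar> + L) * indicator \<Omega> x + L * (indicator \<Omega> x *\<^sub>R (norm (u x))\<^sup>2))"
      by (cases "x \<in> \<Omega>") (simp_all add: distrib_left add.assoc)
  qed
qed

section \<open>The calibration inequality\<close>

lemma set_integrable_sum:
  fixes f :: "'i \<Rightarrow> 'a \<Rightarrow> 'b::{banach, second_countable_topology}"
  assumes "\<And>i. i \<in> I \<Longrightarrow> set_integrable M A (f i)"
  shows "set_integrable M A (\<lambda>x. \<Sum>i\<in>I. f i x)"
    "(LINT x:A|M. \<Sum>i\<in>I. f i x) = (\<Sum>i\<in>I. LINT x:A|M. f i x)"
  using assms unfolding set_integrable_def set_lebesgue_integral_def scaleR_sum_right
  by (auto intro!: Bochner_Integration.integrable_sum Bochner_Integration.integral_sum)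

lemma C1_field_component:
  assumes "C1_field X R"
  shows "Ck_on (Suc 0) (\<lambda>x. X x \<bullet> i) UNIV" "frechet_derivative (\<lambda>x. X x \<bullet> i) (at x) h = frechet_derivative X (at x) h \<bullet> i"
proof -
  note X = C1_fieldD(1)[OF assms]
  show "Ck_on (Suc 0) (\<lambda>x. X x \<bullet> i) UNIV"
    by (rule Ck_on_bounded_linear[OF bounded_linear_inner_left open_UNIV X])
  have "((\<lambda>x. X x \<bullet> i) has_derivative (\<lambda>h. frechet_derivative X (at x) h \<bullet> i)) (at x)"
    by (rule has_derivative_inner_left[OF Ck_on_Suc_has_derivative[OF X open_UNIV UNIV_I]])
  from fun_cong[OF frechet_derivative_at[OF this], of h]
  show "frechet_derivative (\<lambda>x. X x \<bullet> i) (at x) h = frechet_derivative X (at x) h \<bullet> i" by (rule sym)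
qed

text \<open>Young's inequality turns \<open>|X| sqrt (2 G) |du|\<close> into the energy density.\<close>

lemma flux_calibration_smooth:
  fixes \<phi> :: "'a::euclidean_space \<Rightarrow> 'b::euclidean_space" and F G :: "'b \<Rightarrow> real"
  assumes \<phi>: "test_function \<Omega> \<phi>" and \<Omega>: "open \<Omega>"
    and X: "C1_field X R" "\<And>x. norm (X x) \<le> 1"
    and F: "continuous_on UNIV F" and G: "continuous_on UNIV G" "\<And>p. 0 \<le> G p"
    and loc: "\<And>\<tau>. \<tau> > 0 \<Longrightarrow> \<exists>\<delta>>0. \<forall>p q. norm (p - q) < \<delta> \<longrightarrow> \<bar>F p - F q\<bar> \<le> (sqrt (2 * G p) + \<tau>) * norm (p - q)"
    and \<epsilon>: "\<epsilon> > 0"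
    and int: "set_integrable lebesgue \<Omega> (\<lambda>x. \<epsilon> / 2 * (\<Sum>i\<in>Basis. (norm (frechet_derivative \<phi> (at x) i))\<^sup>2) + 1 / \<epsilon> * G (z + \<phi> x))"
  shows "(LINT x:\<Omega>|lebesgue. (F z - F (z + \<phi> x)) * divergence X x)
    \<le> (LINT x:\<Omega>|lebesgue. \<epsilon> / 2 * (\<Sum>i\<in>Basis. (norm (frechet_derivative \<phi> (at x) i))\<^sup>2) + 1 / \<epsilon> * G (z + \<phi> x))"
proof -
  obtain K R' where K: "K \<subseteq> \<Omega>" "K \<subseteq> cball 0 R'" "Ck_on (Suc 0) \<phi> UNIV"
    "\<And>x. x \<notin> K \<Longrightarrow> \<phi> x = 0" "\<And>x h. x \<notin> K \<Longrightarrow> frechet_derivative \<phi> (at x) h = 0"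
    using test_function_support[OF \<phi>] by metis
  define Q where "Q = max R R'"
  have \<phi>Q: "\<phi> x = 0" if "x \<notin> cball 0 Q" for x
  proof -
    have "x \<notin> K" using that K(2) by (auto simp: Q_def)
    then show ?thesis by (rule K(4))
  qed
  have XQ: "X x = 0" if "x \<notin> cball 0 Q" for x
    using that C1_fieldD(2)[OF X(1), of x] by (auto simp: Q_def)
  note c\<phi> = Ck_on_imp_continuous_on[OF K(3)] and cX = Ck_on_imp_continuous_on[OF C1_fieldD(1)[OF X(1)]]
  let ?f = "\<lambda>x. F z - F (z + \<phi> x)" and ?S = "\<lambda>p. sqrt (2 * G p)"
  let ?d = "\<lambda>i x. norm (frechet_derivative \<phi> (at x) i)"
  have cf: "continuous_on UNIV ?f" by (intro continuous_intros continuous_on_compose2[OF F] c\<phi>) auto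
  have cS: "continuous_on UNIV (\<lambda>x. ?S (z + \<phi> x))" by (intro continuous_intros continuous_on_compose2[OF G(1)] c\<phi>) auto
  have cd: "continuous_on UNIV (?d i)" for i by (intro continuous_intros C1_continuous_derivative K) auto
  have cXi: "continuous_on UNIV (\<lambda>x. frechet_derivative X (at x) i \<bullet> i)" for i
    by (intro continuous_intros C1_continuous_derivative C1_fieldD[OF X(1)]) auto
  have fQ: "?f x = 0" if "x \<notin> cball 0 Q" for x using \<phi>Q[OF that] by simp
  have i1: "integrable lborel (\<lambda>x. ?f x * (frechet_derivative X (at x) i \<bullet> i))" for i
    by (rule integrable_continuous_compact_support[where R=Q]) (use fQ in \<open>auto intro!: continuous_on_mult cf cXi\<close>)
  have i2: "integrable lborel (\<lambda>x. \<bar>X x \<bullet> i\<bar> * ?S (z + \<phi> x) * ?d i x)" for i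
    by (rule integrable_continuous_compact_support[where R=Q])
      (use XQ in \<open>auto intro!: continuous_intros cX cS[simplified] cd\<close>)
  have "(LINT x:\<Omega>|lebesgue. ?f x * divergence X x) = (LINT x|lebesgue. ?f x * divergence X x)"
    unfolding set_lebesgue_integral_def
  proof (rule Bochner_Integration.integral_cong)
    fix x
    have "?f x = 0" if "x \<notin> \<Omega>"
    proof -
      have "x \<notin> K" using that K(1) by blast
      then show ?thesis using K(4)[of x] by simp
    qed
    then show "indicat_real \<Omega> x *\<^sub>R (?f x * divergence X x) = ?f x * divergence X x"
      by (cases "x \<in> \<Omega>") auto
  qed simp
  also have "\<dots> = (LINT x|lborel. ?f x * divergence X x)"
  proof (rule integral_completion)
    have "continuous_on UNIV (\<lambda>x. ?f x * divergence X x)"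
      by (rule continuous_on_mult[OF cf continuous_on_divergence[OF X(1)]])
    from borel_measurable_continuous_onI[OF this]
    show "(\<lambda>x. ?f x * divergence X x) \<in> borel_measurable lborel" by simp
  qed
  also have "\<dots> = (\<Sum>i\<in>Basis. LINT x|lborel. ?f x * (frechet_derivative X (at x) i \<bullet> i))"
    using i1 by (simp only: divergence_def sum_distrib_left) (rule Bochner_Integration.integral_sum)
  also have "\<dots> \<le> (\<Sum>i\<in>Basis. LINT x|lborel. \<bar>X x \<bullet> i\<bar> * ?S (z + \<phi> x) * ?d i x)"
  proof (rule sum_mono)
    fix i :: 'a assume i: "i \<in> Basis"
    have "\<bar>LINT x|lborel. ?f x * frechet_derivative (\<lambda>x. X x \<bullet> i) (at x) i\<bar>
        \<le> (LINT x|lborel. \<bar>X x \<bullet> i\<bar> * ?S (z + \<phi> x) * ?d i x)"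
    proof (rule integral_by_parts_Lipschitz[OF K(3) _ C1_field_component(1)[OF X(1)] _ _ _ _ F])
      show "continuous_on UNIV ?S" by (intro continuous_intros G)
      show "\<exists>\<delta>>0. \<forall>p q. norm (p - q) < \<delta> \<longrightarrow> \<bar>F p - F q\<bar> \<le> (?S p + \<tau>) * norm (p - q)" if "\<tau> > 0" for \<tau>
        by (rule loc[OF that])
    qed (use \<phi>Q XQ G i in auto)
    then show "(LINT x|lborel. ?f x * (frechet_derivative X (at x) i \<bullet> i)) \<le> (LINT x|lborel. \<bar>X x \<bullet> i\<bar> * ?S (z + \<phi> x) * ?d i x)"
      unfolding C1_field_component(2)[OF X(1)] by linarith
  qed
  also have "\<dots> = (LINT x|lborel. (\<Sum>i\<in>Basis. \<bar>X x \<bullet> i\<bar> * ?S (z + \<phi> x) * ?d i x))"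
    by (rule Bochner_Integration.integral_sum[symmetric, OF i2])
  also have "\<dots> = (LINT x|lebesgue. (\<Sum>i\<in>Basis. \<bar>X x \<bullet> i\<bar> * ?S (z + \<phi> x) * ?d i x))"
    by (rule integral_completion[symmetric]) (intro borel_measurable_sum borel_measurable_integrable[OF i2])
  also have "\<dots> \<le> (LINT x:\<Omega>|lebesgue. \<epsilon> / 2 * (\<Sum>i\<in>Basis. (?d i x)\<^sup>2) + 1 / \<epsilon> * G (z + \<phi> x))"
    unfolding set_lebesgue_integral_def
  proof (rule integral_mono)
    show "integrable lebesgue (\<lambda>x. \<Sum>i\<in>Basis. \<bar>X x \<bullet> i\<bar> * ?S (z + \<phi> x) * ?d i x)"
      using i2 by (subst integrable_completion) (auto intro!: Bochner_Integration.integrable_sum borel_measurable_sum borel_measurable_integrable[OF i2, simplified])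
    show "integrable lebesgue (\<lambda>x. indicat_real \<Omega> x *\<^sub>R (\<epsilon> / 2 * (\<Sum>i\<in>Basis. (?d i x)\<^sup>2) + 1 / \<epsilon> * G (z + \<phi> x)))"
      using int by (simp only: set_integrable_def)
    fix x
    show "(\<Sum>i\<in>Basis. \<bar>X x \<bullet> i\<bar> * ?S (z + \<phi> x) * ?d i x)
        \<le> indicat_real \<Omega> x *\<^sub>R (\<epsilon> / 2 * (\<Sum>i\<in>Basis. (?d i x)\<^sup>2) + 1 / \<epsilon> * G (z + \<phi> x))"
    proof (cases "x \<in> \<Omega>")
      case True
      \<comment> \<open>The component a of X is kept with s. Summing over the directions then turns
        its square into |X|^2 <= 1, and no factor depending on the dimension appears.\<close>
      have young: "\<bar>a\<bar> * s * d \<le> \<epsilon> / 2 * d\<^sup>2 + 1 / (2 * \<epsilon>) * (s\<^sup>2 * a\<^sup>2)" for a s d :: real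
      proof -
        have "0 \<le> (\<epsilon> * d - \<bar>a\<bar> * s)\<^sup>2" by simp
        then have "2 * \<epsilon> * (\<bar>a\<bar> * s * d) \<le> \<epsilon>\<^sup>2 * d\<^sup>2 + s\<^sup>2 * a\<^sup>2"
          by (simp add: power2_diff power_mult_distrib algebra_simps)
        also have "\<dots> = 2 * \<epsilon> * (\<epsilon> / 2 * d\<^sup>2 + 1 / (2 * \<epsilon>) * (s\<^sup>2 * a\<^sup>2))"
          using \<epsilon> by (simp add: power2_eq_square algebra_simps)
        finally show ?thesis using \<epsilon> by simp
      qed
      let ?s = "?S (z + \<phi> x)"
      have "(\<Sum>i\<in>Basis. \<bar>X x \<bullet> i\<bar> * ?s * ?d i x) \<le> (\<Sum>i\<in>Basis. \<epsilon> / 2 * (?d i x)\<^sup>2 + 1 / (2 * \<epsilon>) * (?s\<^sup>2 * (X x \<bullet> i)\<^sup>2))"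
        by (intro sum_mono young)
      also have "\<dots> = \<epsilon> / 2 * (\<Sum>i\<in>Basis. (?d i x)\<^sup>2) + 1 / (2 * \<epsilon>) * (?s\<^sup>2 * (\<Sum>i\<in>Basis. (X x \<bullet> i)\<^sup>2))"
        by (simp add: sum.distrib sum_distrib_left)
      also have "(\<Sum>i\<in>Basis. (X x \<bullet> i)\<^sup>2) = (norm (X x))\<^sup>2"
        unfolding power2_norm_eq_inner euclidean_inner[of "X x" "X x"] by (simp add: power2_eq_square)
      also have "1 / (2 * \<epsilon>) * (?s\<^sup>2 * (norm (X x))\<^sup>2) \<le> 1 / (2 * \<epsilon>) * (?s\<^sup>2 * 1)"
        using X(2)[of x] \<epsilon> by (intro mult_left_mono) (auto simp: power_le_one)
      also have "1 / (2 * \<epsilon>) * (?s\<^sup>2 * 1) = 1 / \<epsilon> * G (z + \<phi> x)" using G(2) \<epsilon> by simp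
      finally show ?thesis using True by simp
    next
      case False
      then have "x \<notin> K" using K(1) by blast
      then show ?thesis using K(5)[of x] False by simp
    qed
  qed
  finally show ?thesis .
qed

section \<open>From test functions to the whole Dirichlet class\<close>

text \<open>With a free parameter t this bounds an integral of |u - v| over a set of finite measure
  by the squared L2 distance, in place of the Cauchy-Schwarz inequality for integrals.\<close>

lemma norm_le_half_add_power2:
  fixes s t :: real
  assumes "t > 0"
  shows "s \<le> t / 2 + s\<^sup>2 / (2 * t)"
proof -
  have "0 \<le> (s - t)\<^sup>2" by simp
  then have "2 * t * s \<le> 2 * t * (t / 2 + s\<^sup>2 / (2 * t))"
    using assms by (simp add: power2_diff power2_eq_square algebra_simps)
  then show ?thesis using assms by simp
qed

text \<open>Expanding the square of |a| + |a - b| and absorbing the mixed term by Young's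
  inequality. The parameter lets squared gradients be compared with a factor as close to 1 as
  desired.\<close>

lemma power2_norm_le_perturb:
  fixes a b :: "'b::real_normed_vector"
  assumes "t > 0"
  shows "(norm b)\<^sup>2 \<le> (1 + t) * (norm a)\<^sup>2 + (1 + 1 / t) * (norm (a - b))\<^sup>2"
proof -
  let ?a = "norm a" and ?d = "norm (a - b)"
  have "norm b \<le> ?a + ?d" using norm_triangle_ineq2[of b a] by (simp add: norm_minus_commute)
  then have "(norm b)\<^sup>2 \<le> (?a + ?d)\<^sup>2" by (intro power_mono) auto
  also have "\<dots> = ?a\<^sup>2 + ?d\<^sup>2 + 2 * ?a * ?d" by (simp add: power2_sum)
  also have "2 * ?a * ?d \<le> t * ?a\<^sup>2 + 1 / t * ?d\<^sup>2"
  proof -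
    have "0 \<le> (t * ?a - ?d)\<^sup>2" by simp
    then have "t * (2 * ?a * ?d) \<le> t * (t * ?a\<^sup>2 + 1 / t * ?d\<^sup>2)"
      using assms by (simp add: power2_diff power_mult_distrib power2_eq_square algebra_simps)
    then show ?thesis using assms by simp
  qed
  finally show ?thesis by (simp add: algebra_simps)
qed

text \<open>The smooth inequality is applied to approximating test functions, and both sides are
  compared with u at the price of the L2 errors \<open>a k\<close>, \<open>b k\<close> and of terms
  proportional to t. For fixed t these errors vanish as k grows; then t tends to 0. The Lipschitz
  bounds on F and G make the comparison possible.\<close>

lemma flux_calibration:
  fixes u :: "'a::euclidean_space \<Rightarrow> 'b::euclidean_space" and F G :: "'b \<Rightarrow> real"
  assumes \<Omega>: "open \<Omega>" "bounded \<Omega>" and u: "u \<in> dirichlet_class \<Omega> z"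
    and X: "C1_field X R" "\<And>x. norm (X x) \<le> 1" and Dv: "\<And>x. \<bar>divergence X x\<bar> \<le> Dv"
    and L: "0 \<le> L" and F: "\<And>p q. \<bar>F p - F q\<bar> \<le> L * norm (p - q)" "\<And>p. 0 \<le> F p"
    and G: "\<And>p q. \<bar>G p - G q\<bar> \<le> L * norm (p - q)" "\<And>p. 0 \<le> G p"
    and loc: "\<And>\<tau>. \<tau> > 0 \<Longrightarrow> \<exists>\<delta>>0. \<forall>p q. norm (p - q) < \<delta> \<longrightarrow> \<bar>F p - F q\<bar> \<le> (sqrt (2 * G p) + \<tau>) * norm (p - q)"
    and \<epsilon>: "\<epsilon> > 0"
  shows "F z * (LINT x|lborel. indicator \<Omega> x * divergence X x)
    \<le> Dv * (LINT x:\<Omega>|lebesgue. F (u x)) + \<epsilon> / 2 * (\<Sum>i\<in>Basis. LINT x:\<Omega>|lebesgue. (norm (weak_partial \<Omega> i u x))\<^sup>2)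
      + 1 / \<epsilon> * (LINT x:\<Omega>|lebesgue. G (u x))"
proof -
  let ?g = "\<lambda>i. weak_partial \<Omega> i u"
  obtain \<phi> where uL: "L2_on \<Omega> u" and gL: "\<And>i. i \<in> Basis \<Longrightarrow> L2_on \<Omega> (?g i)" and \<phi>: "\<And>k. test_function \<Omega> (\<phi> k)"
    and lim: "(\<lambda>k. (LINT x:\<Omega>|lebesgue. (norm (u x - (z + \<phi> k x)))\<^sup>2)
       + (\<Sum>i\<in>Basis. LINT x:\<Omega>|lebesgue. (norm (?g i x - frechet_derivative (\<phi> k) (at x) i))\<^sup>2)) \<longlonglongrightarrow> 0"
    by (rule dirichlet_class_approx[OF \<Omega>(1) u]) (rule that)
  define a where "a k = (LINT x:\<Omega>|lebesgue. (norm (u x - (z + \<phi> k x)))\<^sup>2)" for k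
  define b where "b k = (\<Sum>i\<in>Basis. LINT x:\<Omega>|lebesgue. (norm (?g i x - frechet_derivative (\<phi> k) (at x) i))\<^sup>2)" for k
  define g2 where "g2 = (\<Sum>i\<in>Basis. LINT x:\<Omega>|lebesgue. (norm (?g i x))\<^sup>2)"
  define P where "P = (LINT x:\<Omega>|lebesgue. divergence X x)"
  define IF where "IF = (LINT x:\<Omega>|lebesgue. F (u x))"
  define IG where "IG = (LINT x:\<Omega>|lebesgue. G (u x))"
  define V where "V = measure lebesgue \<Omega>"
  have Dv0: "0 \<le> Dv" using order_trans[OF abs_ge_zero Dv] .
  have \<Omega>l: "\<Omega> \<in> sets lebesgue" using \<Omega>(1) by (rule open_sets_lebesgue)
  have fin: "emeasure lebesgue \<Omega> < \<infinity>" using emeasure_bounded_finite[OF \<Omega>(2)] \<Omega>(1) by simp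
  have a0: "0 \<le> a k" and b0: "0 \<le> b k" for k
    unfolding a_def b_def set_lebesgue_integral_def by (auto intro!: integral_nonneg_AE sum_nonneg)
  have ab: "(\<lambda>k. a k + b k) \<longlonglongrightarrow> 0" using lim by (simp add: a_def b_def)
  have Peq: "(LINT x|lborel. indicator \<Omega> x * divergence X x) = P"
  proof -
    have "(\<lambda>x. indicator \<Omega> x * divergence X x) \<in> borel_measurable lborel"
      using \<Omega>(1) borel_measurable_integrable[OF integrable_divergence[OF X(1)]]
      by (intro borel_measurable_times borel_measurable_indicator) auto
    from integral_completion[OF this] show ?thesis by (simp add: P_def set_lebesgue_integral_def)
  qed
  have iF: "set_integrable lebesgue \<Omega> (\<lambda>x. F (u x))" and iG: "set_integrable lebesgue \<Omega> (\<lambda>x. G (u x))"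
    using set_integrable_Lipschitz_compose[OF \<Omega> uL F(1) L] set_integrable_Lipschitz_compose[OF \<Omega> uL G(1) L] by auto
  have iD: "set_integrable lebesgue \<Omega> (divergence X)"
  proof -
    have "integrable lebesgue (divergence X)"
      using integrable_divergence[OF X(1)] by (subst integrable_completion) auto
    from integrable_mult_indicator[OF \<Omega>l this] show ?thesis by (simp only: set_integrable_def)
  qed
  have ig: "set_integrable lebesgue \<Omega> (\<lambda>x. \<Sum>i\<in>Basis. (norm (?g i x))\<^sup>2)"
    using L2_onD(2)[OF gL] by (intro set_integrable_sum) auto
  have ineq: "F z * P \<le> Dv * (IF + L * (t / 2 * V + a k / (2 * t))) + (\<epsilon> / 2 * ((1 + t) * g2 + (1 + 1 / t) * b k)
      + 1 / \<epsilon> * (IG + L * (t / 2 * V + a k / (2 * t))))" if t: "t > 0" for t k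
  proof -
    let ?v = "\<lambda>x. z + \<phi> k x" and ?d = "\<lambda>i x. frechet_derivative (\<phi> k) (at x) i"
    have C1: "Ck_on (Suc 0) (\<phi> k) UNIV" using \<phi>[of k] by (simp add: test_function_def smooth_on_def)
    have dL: "L2_on \<Omega> (?d i)" for i by (rule test_function_L2(2)[OF \<Omega>(1) \<phi>])
    have zL: "L2_on \<Omega> (\<lambda>x. z)"
      unfolding L2_on_def set_borel_measurable_def set_integrable_def
      using \<Omega>l fin by (auto intro!: integrable_real_indicator integrable_mult_left borel_measurable_scaleR)
    \<comment> \<open>Here z + \<phi> is written as z - ((z - z) - \<phi>), so that closure under
      differences suffices.\<close>
    have vL: "L2_on \<Omega> ?v"
      using L2_on_diff[OF zL L2_on_diff[OF L2_on_diff[OF zL zL] test_function_L2(1)[OF \<Omega>(1) \<phi>]], of k] by simp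
    have iFv: "set_integrable lebesgue \<Omega> (\<lambda>x. F (?v x))" and iGv: "set_integrable lebesgue \<Omega> (\<lambda>x. G (?v x))"
      using set_integrable_Lipschitz_compose[OF \<Omega> vL F(1) L] set_integrable_Lipschitz_compose[OF \<Omega> vL G(1) L] by auto
    have iw: "set_integrable lebesgue \<Omega> (\<lambda>x. (norm (u x - ?v x))\<^sup>2)" by (rule L2_onD(2)[OF L2_on_diff[OF uL vL]])
    have i1: "set_integrable lebesgue \<Omega> (\<lambda>x. 1)" using \<Omega>l fin by (auto simp: set_integrable_def)
    have l1: "(LINT x:\<Omega>|lebesgue. 1) = V" using \<Omega>l fin by (simp add: set_lebesgue_integral_def V_def)
    let ?e = "\<lambda>x. L * (t / 2 * 1 + (norm (u x - ?v x))\<^sup>2 / (2 * t))"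
    have ie: "set_integrable lebesgue \<Omega> ?e"
      by (intro set_integrable_mult_right set_integral_add(1) set_integrable_divide i1 iw)
    have le: "(LINT x:\<Omega>|lebesgue. t / 2 * 1 + (norm (u x - ?v x))\<^sup>2 / (2 * t)) = t / 2 * V + a k / (2 * t)"
      by (simp only: set_integral_mult_right set_integral_add(2)[OF set_integrable_mult_right[OF i1] set_integrable_divide[OF iw]]
          set_integral_divide_zero l1 a_def)
    have pert: "H (?v x) \<le> H (u x) + ?e x" if H: "\<And>p q. \<bar>H p - H q\<bar> \<le> L * norm (p - q)" for H :: "'b \<Rightarrow> real" and x
    proof -
      have "H (?v x) \<le> H (u x) + L * norm (u x - ?v x)" using H[of "u x" "?v x"] by linarith
      also have "L * norm (u x - ?v x) \<le> ?e x"
        using norm_le_half_add_power2[OF t, of "norm (u x - ?v x)"] L by (intro mult_left_mono) auto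
      finally show ?thesis by simp
    qed
    let ?dd = "\<lambda>x. \<Sum>i\<in>Basis. (norm (?d i x))\<^sup>2" and ?gg = "\<lambda>x. \<Sum>i\<in>Basis. (norm (?g i x))\<^sup>2"
      and ?bb = "\<lambda>x. \<Sum>i\<in>Basis. (norm (?g i x - ?d i x))\<^sup>2"
    have idd: "set_integrable lebesgue \<Omega> ?dd" using L2_onD(2)[OF dL] by (intro set_integrable_sum) auto
    have ibb: "set_integrable lebesgue \<Omega> ?bb" using L2_onD(2)[OF L2_on_diff[OF gL dL]] by (intro set_integrable_sum) auto
    have lgg: "(LINT x:\<Omega>|lebesgue. ?gg x) = g2"
      unfolding g2_def by (rule set_integrable_sum(2)[OF L2_onD(2)[OF gL]])
    have lbb: "(LINT x:\<Omega>|lebesgue. ?bb x) = b k"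
      unfolding b_def by (rule set_integrable_sum(2)[OF L2_onD(2)[OF L2_on_diff[OF gL dL]]])
    have dd: "?dd x \<le> (1 + t) * ?gg x + (1 + 1 / t) * ?bb x" for x
      unfolding sum_distrib_left sum.distrib[symmetric] by (intro sum_mono power2_norm_le_perturb t)
    have iE: "set_integrable lebesgue \<Omega> (\<lambda>x. \<epsilon> / 2 * ?dd x + 1 / \<epsilon> * G (?v x))"
      by (intro set_integral_add(1) set_integrable_mult_right idd iGv)
    have iFD: "set_integrable lebesgue \<Omega> (\<lambda>x. F (?v x) * divergence X x)"
    proof (rule set_integrable_bound[OF set_integrable_mult_right[OF iFv, of Dv]])
      have "(\<lambda>x. (indicator \<Omega> x *\<^sub>R F (?v x)) * divergence X x) \<in> borel_measurable lebesgue"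
        using iFv continuous_measurable_lebesgue[OF continuous_on_divergence[OF X(1)]]
        by (intro borel_measurable_times) (auto simp: set_integrable_def)
      then show "set_borel_measurable lebesgue \<Omega> (\<lambda>x. F (?v x) * divergence X x)"
        by (simp add: set_borel_measurable_def mult.assoc)
      show "AE x in lebesgue. x \<in> \<Omega> \<longrightarrow> norm (F (?v x) * divergence X x) \<le> norm (Dv * F (?v x))"
        using Dv F(2) Dv0 by (intro AE_I2) (auto simp: abs_mult mult.commute intro!: mult_right_mono)
    qed
    have iFz: "set_integrable lebesgue \<Omega> (\<lambda>x. F z * divergence X x)" by (intro set_integrable_mult_right iD)
    have "F z * P = (LINT x:\<Omega>|lebesgue. F z * divergence X x)" by (simp add: P_def)
    also have "\<dots> = (LINT x:\<Omega>|lebesgue. (F z - F (?v x)) * divergence X x) + (LINT x:\<Omega>|lebesgue. F (?v x) * divergence X x)"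
      using set_integral_diff(2)[OF iFz iFD] by (simp add: left_diff_distrib)
    also have "(LINT x:\<Omega>|lebesgue. (F z - F (?v x)) * divergence X x) \<le> (LINT x:\<Omega>|lebesgue. \<epsilon> / 2 * ?dd x + 1 / \<epsilon> * G (?v x))"
      by (rule flux_calibration_smooth[OF \<phi> \<Omega>(1) X(1) _ _ _ _ _ \<epsilon> iE])
        (use X(2) G(2) loc Lipschitz_continuous_on[OF F(1) L] Lipschitz_continuous_on[OF G(1) L] in auto)
    also have "\<dots> \<le> (LINT x:\<Omega>|lebesgue. \<epsilon> / 2 * ((1 + t) * ?gg x + (1 + 1 / t) * ?bb x) + 1 / \<epsilon> * (G (u x) + ?e x))"
    proof (rule set_integral_mono[OF iE])
      show "set_integrable lebesgue \<Omega> (\<lambda>x. \<epsilon> / 2 * ((1 + t) * ?gg x + (1 + 1 / t) * ?bb x) + 1 / \<epsilon> * (G (u x) + ?e x))"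
        by (intro set_integral_add(1) set_integrable_mult_right ig ibb iG ie)
      show "\<epsilon> / 2 * ?dd x + 1 / \<epsilon> * G (?v x) \<le> \<epsilon> / 2 * ((1 + t) * ?gg x + (1 + 1 / t) * ?bb x) + 1 / \<epsilon> * (G (u x) + ?e x)" for x
        using \<epsilon> dd[of x] pert[OF G(1), of x] by (intro add_mono mult_left_mono) auto
    qed
    also have "\<dots> = \<epsilon> / 2 * ((1 + t) * g2 + (1 + 1 / t) * b k) + 1 / \<epsilon> * (IG + L * (t / 2 * V + a k / (2 * t)))"
      by (simp only: set_integral_add(2) set_integral_add(1) set_integrable_mult_right set_integral_mult_right ig ibb iG ie lgg lbb le IG_def)
    also have "(LINT x:\<Omega>|lebesgue. F (?v x) * divergence X x) \<le> (LINT x:\<Omega>|lebesgue. Dv * (F (u x) + ?e x))"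
    proof (rule set_integral_mono[OF iFD])
      show "set_integrable lebesgue \<Omega> (\<lambda>x. Dv * (F (u x) + ?e x))"
        by (intro set_integral_add(1) set_integrable_mult_right iF ie)
      show "F (?v x) * divergence X x \<le> Dv * (F (u x) + ?e x)" for x
      proof -
        have "F (?v x) * divergence X x \<le> F (?v x) * Dv" using Dv[of x] F(2) by (intro mult_left_mono) auto
        also have "\<dots> \<le> (F (u x) + ?e x) * Dv" using pert[OF F(1), of x] Dv0 by (rule mult_right_mono)
        finally show ?thesis by (simp only: mult.commute)
      qed
    qed
    also have "\<dots> = Dv * (IF + L * (t / 2 * V + a k / (2 * t)))"
      by (simp only: set_integral_add(2) iF ie set_integral_mult_right le IF_def)
    finally show ?thesis by linarith
  qed
  have alim: "a \<longlonglongrightarrow> 0" and blim: "b \<longlonglongrightarrow> 0"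
    by (rule tendsto_sandwich[OF _ _ tendsto_const ab]; use a0 b0 in auto)+
  have tineq: "F z * P \<le> Dv * (IF + L * (t / 2 * V)) + (\<epsilon> / 2 * ((1 + t) * g2) + 1 / \<epsilon> * (IG + L * (t / 2 * V)))"
    if t: "t > 0" for t
  proof -
    have "(\<lambda>k. Dv * (IF + L * (t / 2 * V + a k / (2 * t))) + (\<epsilon> / 2 * ((1 + t) * g2 + (1 + 1 / t) * b k)
      + 1 / \<epsilon> * (IG + L * (t / 2 * V + a k / (2 * t)))))
      \<longlonglongrightarrow> Dv * (IF + L * (t / 2 * V + 0 / (2 * t))) + (\<epsilon> / 2 * ((1 + t) * g2 + (1 + 1 / t) * 0)
      + 1 / \<epsilon> * (IG + L * (t / 2 * V + 0 / (2 * t))))"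
      using t by (intro tendsto_intros alim blim) auto
    then have "F z * P \<le> Dv * (IF + L * (t / 2 * V + 0 / (2 * t))) + (\<epsilon> / 2 * ((1 + t) * g2 + (1 + 1 / t) * 0)
      + 1 / \<epsilon> * (IG + L * (t / 2 * V + 0 / (2 * t))))"
      by (rule LIMSEQ_le_const) (use ineq[OF t] in auto)
    then show ?thesis by simp
  qed
  have "F z * P \<le> Dv * (IF + L * (0 / 2 * V)) + (\<epsilon> / 2 * ((1 + 0) * g2) + 1 / \<epsilon> * (IG + L * (0 / 2 * V)))"
  proof (rule tendsto_lowerbound)
    show "((\<lambda>t. Dv * (IF + L * (t / 2 * V)) + (\<epsilon> / 2 * ((1 + t) * g2) + 1 / \<epsilon> * (IG + L * (t / 2 * V)))) \<longlongrightarrow>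
      Dv * (IF + L * (0 / 2 * V)) + (\<epsilon> / 2 * ((1 + 0) * g2) + 1 / \<epsilon> * (IG + L * (0 / 2 * V)))) (at_right 0)"
      by (intro tendsto_intros) auto
    show "\<forall>\<^sub>F t in at_right 0. F z * P \<le> Dv * (IF + L * (t / 2 * V)) + (\<epsilon> / 2 * ((1 + t) * g2) + 1 / \<epsilon> * (IG + L * (t / 2 * V)))"
      using tineq by (auto simp: eventually_at_filter)
  qed simp
  then show ?thesis by (simp add: Peq IF_def IG_def g2_def)
qed

text \<open>Finite energy j makes W composed with u integrable, with integral at most \<epsilon> j.
  Through F <= K W the divergence term costs at most Dv K \<epsilon> j, and through G <= W the
  remaining terms are at most the energy itself.\<close>

lemma J_energy_lower_bound:
  fixes u :: "'a::euclidean_space \<Rightarrow> 'b::euclidean_space" and W F G :: "'b \<Rightarrow> real"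
  assumes \<Omega>: "open \<Omega>" "bounded \<Omega>" and u: "u \<in> dirichlet_class \<Omega> z"
    and X: "C1_field X R" "\<And>x. norm (X x) \<le> 1" and Dv: "\<And>x. \<bar>divergence X x\<bar> \<le> Dv"
    and L: "0 \<le> L" and F: "\<And>p q. \<bar>F p - F q\<bar> \<le> L * norm (p - q)" "\<And>p. 0 \<le> F p" "\<And>p. F p \<le> K * W p" "0 \<le> K"
    and G: "\<And>p q. \<bar>G p - G q\<bar> \<le> L * norm (p - q)" "\<And>p. 0 \<le> G p" "\<And>p. G p \<le> W p"
    and W: "continuous_on UNIV W" "\<And>p. 0 \<le> W p"
    and loc: "\<And>\<tau>. \<tau> > 0 \<Longrightarrow> \<exists>\<delta>>0. \<forall>p q. norm (p - q) < \<delta> \<longrightarrow> \<bar>F p - F q\<bar> \<le> (sqrt (2 * G p) + \<tau>) * norm (p - q)"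
    and \<epsilon>: "\<epsilon> > 0" and J: "J_energy W \<epsilon> \<Omega> u = ennreal j" "0 \<le> j"
  shows "F z * (LINT x|lborel. indicator \<Omega> x * divergence X x) \<le> (1 + Dv * K * \<epsilon>) * j"
proof -
  let ?g = "\<lambda>x. \<Sum>i\<in>Basis. (norm (weak_partial \<Omega> i u x))\<^sup>2"
  have uL: "L2_on \<Omega> u" and gL: "\<And>i. i \<in> Basis \<Longrightarrow> L2_on \<Omega> (weak_partial \<Omega> i u)"
    by (rule dirichlet_class_approx[OF \<Omega>(1) u]; blast)+
  have \<Omega>l: "\<Omega> \<in> sets lebesgue" using \<Omega>(1) by (rule open_sets_lebesgue)
  have Dv0: "0 \<le> Dv" using order_trans[OF abs_ge_zero Dv] .
  have ig: "set_integrable lebesgue \<Omega> ?g" and lg: "(LINT x:\<Omega>|lebesgue. ?g x) = (\<Sum>i\<in>Basis. LINT x:\<Omega>|lebesgue. (norm (weak_partial \<Omega> i u x))\<^sup>2)"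
    by (rule set_integrable_sum[OF L2_onD(2)[OF gL]]; assumption)+
  have iF: "set_integrable lebesgue \<Omega> (\<lambda>x. F (u x))" and iG: "set_integrable lebesgue \<Omega> (\<lambda>x. G (u x))"
    using set_integrable_Lipschitz_compose[OF \<Omega> uL F(1) L] set_integrable_Lipschitz_compose[OF \<Omega> uL G(1) L] by auto
  have mW: "(\<lambda>x. indicator \<Omega> x * W (u x)) \<in> borel_measurable lebesgue"
  proof -
    from measurable_compose[OF L2_onD(1)[OF uL] borel_measurable_continuous_onI[OF W(1)]]
    have "(\<lambda>x. indicat_real \<Omega> x * W (indicator \<Omega> x *\<^sub>R u x)) \<in> borel_measurable lebesgue"
      using \<Omega>l by (intro borel_measurable_times borel_measurable_indicator)
    also have "(\<lambda>x. indicat_real \<Omega> x * W (indicator \<Omega> x *\<^sub>R u x)) = (\<lambda>x. indicator \<Omega> x * W (u x))"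
      by (auto simp: indicator_def fun_eq_iff)
    finally show ?thesis .
  qed
  have mg: "(\<lambda>x. indicator \<Omega> x * ?g x) \<in> borel_measurable lebesgue"
    using borel_measurable_integrable[OF ig[unfolded set_integrable_def]] by simp
  define E where "E x = \<epsilon> / 2 * (indicator \<Omega> x * ?g x) + 1 / \<epsilon> * (indicator \<Omega> x * W (u x))" for x
  have mE: "E \<in> borel_measurable lebesgue"
    unfolding E_def
    by (rule borel_measurable_add[OF borel_measurable_times[OF borel_measurable_const mg]
        borel_measurable_times[OF borel_measurable_const mW]])
  have E0: "0 \<le> E x" for x
    unfolding E_def using \<epsilon> W(2) by (intro add_nonneg_nonneg mult_nonneg_nonneg sum_nonneg) auto
  have "(\<integral>\<^sup>+x. ennreal (E x) \<partial>lebesgue) = ennreal j"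
    unfolding J(1)[symmetric] J_energy_def
    by (intro nn_integral_cong) (simp add: E_def weak_gradient_sq_def indicator_def)
  then have iE: "integrable lebesgue E" and lE: "(LINT x|lebesgue. E x) = j"
    using integrableI_nn_integral_finite[OF mE AE_I2[OF E0]] integral_eq_nn_integral[OF mE AE_I2[OF E0]] J(2) by auto
  define I\<^sub>W where "I\<^sub>W = (LINT x:\<Omega>|lebesgue. W (u x))"
  have iW: "set_integrable lebesgue \<Omega> (\<lambda>x. W (u x))"
    unfolding set_integrable_def
  proof (rule Bochner_Integration.integrable_bound[OF integrable_mult_right[OF iE, of \<epsilon>]])
    show "AE x in lebesgue. norm (indicator \<Omega> x *\<^sub>R W (u x)) \<le> norm (\<epsilon> * E x)"
    proof (rule AE_I2)
      fix x
      have "0 \<le> \<epsilon> * (\<epsilon> / 2 * (indicator \<Omega> x * ?g x))"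
        using \<epsilon> by (intro mult_nonneg_nonneg sum_nonneg) auto
      then have "indicator \<Omega> x * W (u x) \<le> \<epsilon> * E x" using \<epsilon> by (simp add: E_def distrib_left)
      moreover have "0 \<le> indicator \<Omega> x * W (u x)" using W(2) by simp
      ultimately show "norm (indicator \<Omega> x *\<^sub>R W (u x)) \<le> norm (\<epsilon> * E x)" by simp
    qed
  qed (use mW in simp)
  have j: "j = \<epsilon> / 2 * (LINT x:\<Omega>|lebesgue. ?g x) + 1 / \<epsilon> * I\<^sub>W"
    unfolding lE[symmetric] I\<^sub>W_def set_lebesgue_integral_def E_def
    using ig iW by (simp add: set_integrable_def)
  have g0: "0 \<le> (LINT x:\<Omega>|lebesgue. ?g x)"
    unfolding set_lebesgue_integral_def by (intro integral_nonneg_AE AE_I2) (auto intro!: mult_nonneg_nonneg sum_nonneg)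
  have "I\<^sub>W \<le> \<epsilon> * j" using \<epsilon> g0 by (simp add: j distrib_left)
  have FW: "(LINT x:\<Omega>|lebesgue. F (u x)) \<le> K * I\<^sub>W"
    unfolding I\<^sub>W_def set_integral_mult_right[symmetric]
    by (rule set_integral_mono[OF iF set_integrable_mult_right[OF iW]]) (use F(3) in auto)
  have GW: "(LINT x:\<Omega>|lebesgue. G (u x)) \<le> I\<^sub>W"
    unfolding I\<^sub>W_def by (rule set_integral_mono[OF iG iW]) (use G(3) in auto)
  have "F z * (LINT x|lborel. indicator \<Omega> x * divergence X x)
      \<le> Dv * (LINT x:\<Omega>|lebesgue. F (u x)) + \<epsilon> / 2 * (LINT x:\<Omega>|lebesgue. ?g x) + 1 / \<epsilon> * (LINT x:\<Omega>|lebesgue. G (u x))"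
    unfolding lg by (rule flux_calibration[OF \<Omega> u X(1) _ Dv L F(1,2) G(1,2) loc \<epsilon>]) (use X(2) in auto)
  also have "\<dots> \<le> Dv * (K * (\<epsilon> * j)) + \<epsilon> / 2 * (LINT x:\<Omega>|lebesgue. ?g x) + 1 / \<epsilon> * I\<^sub>W"
    using FW GW \<open>I\<^sub>W \<le> \<epsilon> * j\<close> Dv0 F(4) \<epsilon> by (intro add_mono mult_left_mono order_trans[OF FW mult_left_mono]) auto
  also have "\<dots> = (1 + Dv * K * \<epsilon>) * j" by (simp add: j algebra_simps)
  finally show ?thesis .
qed

theorem theorem3p3:
  fixes W :: "'b::euclidean_space \<Rightarrow> real" and A :: "'b set" and z :: 'b and M :: real
    and \<Omega> :: "'a::euclidean_space set"
  assumes "Ck_on 2 W UNIV" and "\<And>u. W u \<ge> 0"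
    and "finite A" and "card A \<ge> 2" and "\<And>u. W u = 0 \<longleftrightarrow> u \<in> A"
    and "\<And>a \<xi>. a \<in> A \<Longrightarrow> \<xi> \<noteq> 0 \<Longrightarrow> hessian W a \<xi> \<bullet> \<xi> > 0"
    and "Liminf at_infinity (\<lambda>u. ereal (W u)) > 0"
    and "M > 0" and "\<And>u. norm u > M \<Longrightarrow> gradient W u \<bullet> u > 0"
    and "z \<notin> A" and "norm z \<le> M"
    and "DIM('a) \<ge> 2" and "smooth_bounded_domain \<Omega>"
  shows "\<exists>C>0. \<forall>\<epsilon>>0. \<forall>u. is_J_minimizer W z \<epsilon> \<Omega> u \<longrightarrow>
    enn2ereal (J_energy W \<epsilon> \<Omega> u) \<ge>
      enn2ereal (sigma_plus W A z) * enn2ereal (hausdorff_measure (DIM('a) - 1) (frontier \<Omega>))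
        * ereal (1 - C * \<epsilon> powr (1/3))"
proof -
  note W = assms(1,2)
  have \<Omega>: "open \<Omega>" "bounded \<Omega>" using assms(13) by (auto simp: smooth_bounded_domain_def)
  have "A \<noteq> {}" using assms(4) by auto
  obtain \<sigma> F G K L where \<sigma>: "sigma_plus W A z = ennreal \<sigma>" "0 \<le> \<sigma>" and KL: "0 \<le> K" "0 \<le> L"
    and F: "F z = \<sigma>" "\<And>u. 0 \<le> F u" "\<And>u. F u \<le> K * W u" "\<And>u v. \<bar>F u - F v\<bar> \<le> L * norm (u - v)"
    and G: "\<And>u. 0 \<le> G u" "\<And>u. G u \<le> W u" "\<And>u v. \<bar>G u - G v\<bar> \<le> L * norm (u - v)"
    and loc: "\<And>\<tau>. \<tau> > 0 \<Longrightarrow> \<exists>\<delta>>0. \<forall>p q. norm (p - q) < \<delta> \<longrightarrow> \<bar>F p - F q\<bar> \<le> (sqrt (2 * G p) + \<tau>) * norm (p - q)"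
    by (rule ex_calibration[OF W assms(3) \<open>A \<noteq> {}\<close> assms(5-7), of z]) blast+
  obtain X R where X: "C1_field X R" "\<And>x. norm (X x) \<le> 1" "\<And>p. p \<in> frontier \<Omega> \<Longrightarrow> is_normal_at \<Omega> p (X p)"
    using ex_normal_field[OF assms(13)] by metis
  define P where "P = (LINT x|lborel. indicator \<Omega> x * divergence X x)"
  have HP: "hausdorff_measure (DIM('a) - 1) (frontier \<Omega>) \<le> ennreal P"
    unfolding P_def by (rule hausdorff_measure_frontier_le[OF assms(13,12) X])
  then obtain h where h: "hausdorff_measure (DIM('a) - 1) (frontier \<Omega>) = ennreal h" "0 \<le> h"
    by (cases "hausdorff_measure (DIM('a) - 1) (frontier \<Omega>)") (auto simp: top_unique)
  \<comment> \<open>\<open>ennreal\<close> sends negative reals to 0, so the bound in extended reals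
    yields only this alternative; for h = 0 the final estimate is trivial.\<close>
  have hP: "h \<le> P \<or> h = 0" using HP h by (cases "0 \<le> P") (auto simp: ennreal_le_iff ennreal_neg)
  obtain Dv where Dv: "Dv > 0" "\<And>x. norm (divergence X x) \<le> Dv"
    using bounded_continuous_compact_support[OF continuous_on_divergence[OF X(1)] divergence_outside[OF X(1)]] by blast
  \<comment> \<open>The maximum with 1 ensures that C s < 1 forces s < 1, hence \<epsilon> < 1 and
    \<epsilon> <= s.\<close>
  define C where "C = max 1 (Dv * K)"
  have C: "1 \<le> C" "Dv * K \<le> C" by (auto simp: C_def)
  show ?thesis
  proof (intro exI[of _ C] conjI allI impI)
    fix \<epsilon> :: real and u :: "'a \<Rightarrow> 'b"
    assume \<epsilon>: "\<epsilon> > 0" and "is_J_minimizer W z \<epsilon> \<Omega> u"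
    then have u: "u \<in> dirichlet_class \<Omega> z" by (simp add: is_J_minimizer_def)
    define s where "s = \<epsilon> powr (1 / 3)"
    have s0: "0 < s" using \<epsilon> by (simp add: s_def)
    have RHS: "enn2ereal (sigma_plus W A z) * enn2ereal (hausdorff_measure (DIM('a) - 1) (frontier \<Omega>))
        * ereal (1 - C * \<epsilon> powr (1/3)) = ereal (\<sigma> * h * (1 - C * s))"
      using \<sigma> h by (simp add: enn2ereal_ennreal s_def)
    show "enn2ereal (J_energy W \<epsilon> \<Omega> u) \<ge>
      enn2ereal (sigma_plus W A z) * enn2ereal (hausdorff_measure (DIM('a) - 1) (frontier \<Omega>))
        * ereal (1 - C * \<epsilon> powr (1/3))"
    proof (cases "J_energy W \<epsilon> \<Omega> u")
      case top
      then show ?thesis by (simp add: enn2ereal_top)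
    next
      case (real j)
      \<comment> \<open>If C s >= 1 the left side is nonpositive. Otherwise \<epsilon> <= s turns
        the factor 1 + Dv K \<epsilon> into 1 + C s, and (1 + C s) (1 - C s) <= 1 moves it to the
        other side.\<close>
      have "\<sigma> * h * (1 - C * s) \<le> j"
      proof (cases "1 - C * s \<le> 0")
        case True
        then have "\<sigma> * h * (1 - C * s) \<le> 0" using \<sigma>(2) h(2) by (simp add: mult_nonneg_nonpos)
        then show ?thesis using real by simp
      next
        case False
        have "s \<le> C * s" using C(1) s0 by simp
        then have "s < 1" using False by linarith
        then have "\<epsilon> < 1" using ge_one_powr_ge_zero[of \<epsilon> "1 / 3"] by (force simp: s_def)
        then have "\<epsilon> powr 1 \<le> \<epsilon> powr (1 / 3)" using \<epsilon> by (intro powr_mono') auto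
        then have \<epsilon>s: "\<epsilon> \<le> s" using \<epsilon> by (simp add: s_def)
        have "F z * P \<le> (1 + Dv * K * \<epsilon>) * j"
          unfolding P_def
          by (rule J_energy_lower_bound[OF \<Omega> u X(1) _ _ KL(2) F(4,2,3) KL(1) G(3,1,2) Ck_on_imp_continuous_on[OF W(1)] W(2) loc \<epsilon> real(2,1)])
            (use X(2) Dv(2) in auto)
        then have "\<sigma> * P \<le> (1 + Dv * K * \<epsilon>) * j" by (simp add: F(1))
        moreover have "0 \<le> (1 + Dv * K * \<epsilon>) * j" using Dv(1) KL(1) \<epsilon> real by simp
        ultimately have "\<sigma> * h \<le> (1 + Dv * K * \<epsilon>) * j"
          using hP \<sigma>(2) mult_left_mono[of h P \<sigma>] by (elim disjE) auto
        also have "\<dots> \<le> (1 + C * s) * j"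
          using C(2) \<epsilon> \<epsilon>s real C(1) by (intro mult_right_mono add_left_mono mult_mono) auto
        finally have "\<sigma> * h * (1 - C * s) \<le> (1 + C * s) * j * (1 - C * s)"
          using False by (intro mult_right_mono) auto
        also have "\<dots> = j - (C * s)\<^sup>2 * j" by (simp add: power2_eq_square algebra_simps)
        also have "\<dots> \<le> j" using real by simp
        finally show ?thesis .
      qed
      then show ?thesis unfolding RHS using real by (simp add: enn2ereal_ennreal)
    qed
  qed (use C in simp)
qed

end
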